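(* Let $n\ge 3$, $s\in(0,1)$, $2^*=\frac{2n}{n-2}$ and $\lambda\le 0$. Assume that $\Omega\subseteq\mathbb{R}^n$ is a nonempty open set which is bounded and star-shaped. Then, for every exponent $p\in[1,2^*-1)$, there do not exist solutions to the problem $$\begin{cases}-\Delta u+(-\Delta)^s u=u^{2^*-1}+\lambda u^p&\text{in }\Omega,\\ u\gneqq 0&\text{in }\Omega,\\ u\equiv 0&\text{in }\mathbb{R}^n\setminus\Omega.\end{cases}$$
   Context: Let $\mathcal{X}^{1,2}(\Omega)=\{u\in H^1(\mathbb{R}^n): u|_\Omega\in H^1_0(\Omega),\ u\equiv0\text{ a.e. in }\mathbb{R}^n\setminus\Omega\}$ ($\Omega$ bounded). A solution of the problem is a function $u\in\mathcal{X}^{1,2}(\Omega)$ with $u\ge0$ a.e. in $\Omega$, $|\{x\in\Omega:u(x)>0\}|>0$, such that for every $v\in\mathcal{X}^{1,2}(\Omega)$ $$\int_\Omega\nabla u\cdot\nabla v\,dx+\iint_{\mathbb{R}^{2n}}\frac{(u(x)-u(y))(v(x)-v(y))}{|x-y|^{n+2s}}\,dx\,dy=\int_\Omega(u^{2^*-1}+\lambda u^p)v\,dx .$$ *)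

theory Defs
  imports "HOL-Analysis.Analysis"
begin

text \<open>
  Functions in Lebesgue and Sobolev spaces are represented by pointwise defined,
  Lebesgue measurable representatives.
\<close>

primrec Ck :: "nat \<Rightarrow> ('a::euclidean_space \<Rightarrow> real) \<Rightarrow> bool" where
  "Ck 0 f \<longleftrightarrow> continuous_on UNIV f"
| "Ck (Suc k) f \<longleftrightarrow>
     (\<forall>x. f differentiable (at x)) \<and>
     (\<forall>b\<in>Basis. Ck k (\<lambda>x. frechet_derivative f (at x) b))"

definition test_functions :: "'a::euclidean_space set \<Rightarrow> ('a \<Rightarrow> real) set" where
  "test_functions \<Omega> =
     {\<phi>. (\<forall>k. Ck k \<phi>) \<and> compact (closure {x. \<phi> x \<noteq> 0}) \<and> closure {x. \<phi> x \<noteq> 0} \<subseteq> \<Omega>}"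

definition grad :: "('a::euclidean_space \<Rightarrow> real) \<Rightarrow> 'a \<Rightarrow> 'a" where
  "grad \<phi> x = (\<Sum>b\<in>Basis. frechet_derivative \<phi> (at x) b *\<^sub>R b)"

definition locally_integrable_on ::
    "'a::euclidean_space set \<Rightarrow> ('a \<Rightarrow> 'b::euclidean_space) \<Rightarrow> bool" where
  "locally_integrable_on \<Omega> f \<longleftrightarrow>
     (\<forall>K. compact K \<and> K \<subseteq> \<Omega> \<longrightarrow> set_integrable lebesgue K f)"

definition L2 :: "'a::euclidean_space set \<Rightarrow> ('a \<Rightarrow> 'b::euclidean_space) set" where
  "L2 \<Omega> = {f. set_borel_measurable lebesgue \<Omega> f \<and>
               set_integrable lebesgue \<Omega> (\<lambda>x. (norm (f x))\<^sup>2)}"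

definition has_weak_gradient ::
    "'a::euclidean_space set \<Rightarrow> ('a \<Rightarrow> real) \<Rightarrow> ('a \<Rightarrow> 'a) \<Rightarrow> bool" where
  "has_weak_gradient \<Omega> u g \<longleftrightarrow>
     locally_integrable_on \<Omega> u \<and> locally_integrable_on \<Omega> g \<and>
     (\<forall>\<phi>\<in>test_functions \<Omega>.
        (LINT x:\<Omega>|lebesgue. u x *\<^sub>R grad \<phi> x) = - (LINT x:\<Omega>|lebesgue. \<phi> x *\<^sub>R g x))"

text \<open>
  The weak gradient is determined only up to a null set; the choice made here is
  immaterial, as it is only ever used under an integral.
\<close>

definition weak_gradient ::
    "'a::euclidean_space set \<Rightarrow> ('a \<Rightarrow> real) \<Rightarrow> 'a \<Rightarrow> 'a" where
  "weak_gradient \<Omega> u = (SOME g. has_weak_gradient \<Omega> u g)"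

definition H1 :: "'a::euclidean_space set \<Rightarrow> ('a \<Rightarrow> real) set" where
  "H1 \<Omega> = {u \<in> L2 \<Omega>. \<exists>g\<in>L2 \<Omega>. has_weak_gradient \<Omega> u g}"

text \<open>
  The closure of the test functions in \<open>H1 \<Omega>\<close>. Only the values of \<open>u\<close> on \<open>\<Omega>\<close> matter,
  so \<open>u \<in> H10 \<Omega>\<close> is meaningful for \<open>u\<close> defined on the whole space and is a
  statement about its restriction to \<open>\<Omega>\<close>.
\<close>

definition H10 :: "'a::euclidean_space set \<Rightarrow> ('a \<Rightarrow> real) set" where
  "H10 \<Omega> = {u \<in> H1 \<Omega>. \<exists>\<phi> :: nat \<Rightarrow> 'a \<Rightarrow> real.
     (\<forall>k. \<phi> k \<in> test_functions \<Omega>) \<and>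
     (\<lambda>k. (LINT x:\<Omega>|lebesgue. (\<phi> k x - u x)\<^sup>2) +
          (LINT x:\<Omega>|lebesgue. (norm (grad (\<phi> k) x - weak_gradient \<Omega> u x))\<^sup>2))
       \<longlonglongrightarrow> 0}"

definition X12 :: "'a::euclidean_space set \<Rightarrow> ('a \<Rightarrow> real) set" where
  "X12 \<Omega> = {u \<in> H1 UNIV. u \<in> H10 \<Omega> \<and> (AE x in lebesgue. x \<notin> \<Omega> \<longrightarrow> u x = 0)}"

definition critical_exponent :: "nat \<Rightarrow> real" where
  "critical_exponent n = 2 * real n / (real n - 2)"

definition local_form ::
    "'a::euclidean_space set \<Rightarrow> ('a \<Rightarrow> real) \<Rightarrow> ('a \<Rightarrow> real) \<Rightarrow> real" where
  "local_form \<Omega> u v =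
     (LINT x:\<Omega>|lebesgue. weak_gradient UNIV u x \<bullet> weak_gradient UNIV v x)"

text \<open>
  No normalising constant is attached to the nonlocal form. On the diagonal, a null
  set, the integrand is \<open>0 / 0 = 0\<close>.
\<close>

definition nonlocal_form ::
    "real \<Rightarrow> ('a::euclidean_space \<Rightarrow> real) \<Rightarrow> ('a \<Rightarrow> real) \<Rightarrow> real" where
  "nonlocal_form s u v =
     (LINT (x, y)|(lebesgue :: ('a \<times> 'a) measure).
        (u x - u y) * (v x - v y) / norm (x - y) powr (real DIM('a) + 2 * s))"

definition is_solution ::
    "real \<Rightarrow> real \<Rightarrow> real \<Rightarrow> 'a::euclidean_space set \<Rightarrow> ('a \<Rightarrow> real) \<Rightarrow> bool" where
  "is_solution s lam p \<Omega> u \<longleftrightarrow>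
     u \<in> X12 \<Omega> \<and>
     (AE x in lebesgue. x \<in> \<Omega> \<longrightarrow> u x \<ge> 0) \<and>
     emeasure lebesgue {x \<in> \<Omega>. u x > 0} > 0 \<and>
     (\<forall>v\<in>X12 \<Omega>.
        local_form \<Omega> u v + nonlocal_form s u v =
        (LINT x:\<Omega>|lebesgue.
           (u x powr (critical_exponent DIM('a) - 1) + lam * u x powr p) * v x))"

end

theory Submission
  imports Defs
begin

text \<open>
  The proof is Pohozaev's argument carried out on the weak formulation, without any
  pointwise regularity of the solution. Let \<open>a\<close> be a centre of star-shapedness, \<open>n\<close> the
  dimension, \<open>q = 2 * n / (n - 2)\<close>, and let \<open>E\<close> and \<open>K\<close> be the local and the nonlocal energy
  of a solution \<open>u\<close>. For \<open>t > 1\<close> the dilate \<open>u\<^sub>t x = u (a + t *\<^sub>R (x - a))\<close> still lives in \<open>\<Omega>\<close>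
  and is an admissible test function. Scaling and the Cauchy-Schwarz inequality bound the
  two forms evaluated at \<open>u\<close> and \<open>u\<^sub>t\<close> by \<open>t powr ((2 - n) / 2) * E\<close> and
  \<open>t powr ((2 * s - n) / 2) * K\<close>, with equality at \<open>t = 1\<close> (lemma \<open>dilation_test\<close>).
  On the other side of the equation, convexity of powers compares \<open>u powr (q - 1) * (u\<^sub>t - u)\<close>
  with \<open>(u\<^sub>t powr q - u powr q) / q\<close>, whose integral is an explicit function of \<open>t\<close>
  (lemma \<open>dilation_lower_bound\<close>). Dividing by \<open>t - 1\<close> and letting \<open>t\<close> tend to \<open>1\<close> gives
  \<open>Pohozaev_inequality\<close>. Combined with the equation tested with \<open>u\<close> itself, it says that
  \<open>(1 - s) * K\<close> is at most \<open>lam * (n / (p + 1) - (n - 2) / 2)\<close> times the integral of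
  \<open>u powr (p + 1)\<close>. The bracket is positive because \<open>p\<close> is subcritical, so \<open>K \<le> 0\<close>. Hence \<open>u\<close>
  is constant almost everywhere, and it vanishes outside a bounded set.

  The comparison by convexity is useful only if its error is \<open>o(t - 1)\<close>. Where \<open>u\<close> and \<open>u\<^sub>t\<close>
  are bounded the error is quadratic in \<open>u\<^sub>t - u\<close>, and \<open>u\<^sub>t - u\<close> is of order \<open>t - 1\<close> in the mean
  square since \<open>u\<close> has a square integrable gradient. Where they are large, one needs that
  \<open>u powr (q - 1)\<close> is square integrable, which is more than finite energy provides. It is
  extracted from the equation as follows. Testing with a smooth truncation of \<open>u\<close> at height
  \<open>k\<close>, where both the nonlocal term and the term with \<open>lam\<close> have a favourable sign, bounds
  the energy of the truncation by \<open>k\<close> times the integral of \<open>u powr (q - 1)\<close> over \<open>{k \<le> u}\<close>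
  (\<open>truncated_energy\<close>). A weak Sobolev inequality, which only rests on the estimate for
  translations, converts this into a bound for the measure of \<open>{2 * k \<le> u}\<close> with a constant
  that tends to \<open>0\<close> as \<open>k\<close> grows (\<open>small_level_sets\<close>). For dyadic \<open>k\<close> this is a second order
  difference inequality for the tails. Since the tails are known to decay like \<open>1 / k\<close>, it
  forces them to decay at any prescribed geometric rate (\<open>second_order_decay\<close>).

  The analysis is done for Borel functions with a given gradient that are limits of test
  functions, the predicate \<open>H10_pair\<close>. Uniqueness of weak gradients identifies these with the
  members of \<open>X12 \<Omega>\<close> up to null sets (\<open>H10_pair_in_X12\<close>, \<open>X12_imp_H10_pair\<close>).
\<close>

section \<open>Smooth functions\<close>

lemma Ck_SucI:
  assumes "\<And>x. (f has_derivative D x) (at x)"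
    and "\<And>b. b \<in> Basis \<Longrightarrow> Ck k (\<lambda>x. D x b)"
  shows "Ck (Suc k) f"
proof -
  have "frechet_derivative f (at x) = D x" for x
    using frechet_derivative_at[OF assms(1)] by simp
  then show ?thesis
    using assms by (auto simp: differentiable_def)
qed

lemma Ck_has_derivative:
  assumes "Ck (Suc k) f"
  shows "(f has_derivative frechet_derivative f (at x)) (at x)"
  using assms frechet_derivative_works by auto

lemma Ck_partial_derivative:
  "Ck (Suc k) f \<Longrightarrow> b \<in> Basis \<Longrightarrow> Ck k (\<lambda>x. frechet_derivative f (at x) b)"
  by simp

lemma Ck_Suc_imp_Ck: "Ck (Suc k) f \<Longrightarrow> Ck k f"
proof (induction k arbitrary: f)
  case 0
  then show ?case
    by (auto intro!: continuous_at_imp_continuous_on differentiable_imp_continuous_within)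
next
  case (Suc k)
  then show ?case
    by (metis Ck.simps(2))
qed

lemma Ck_const: "Ck k (\<lambda>x. c)"
proof (induction k arbitrary: c)
  case (Suc k)
  show ?case
    by (rule Ck_SucI[where D = "\<lambda>x h. 0"]) (use Suc in auto)
qed simp

lemma Ck_add: "Ck k f \<Longrightarrow> Ck k g \<Longrightarrow> Ck k (\<lambda>x. f x + g x)"
proof (induction k arbitrary: f g)
  case (Suc k)
  note fg = Suc.prems[THEN Ck_has_derivative] Suc.prems[THEN Ck_partial_derivative]
  show ?case
    by (rule Ck_SucI, rule has_derivative_add[OF fg(1,2)], rule Suc.IH[OF fg(3,4)])
qed (auto intro: continuous_intros)

lemma Ck_mult: "Ck k f \<Longrightarrow> Ck k g \<Longrightarrow> Ck k (\<lambda>x. f x * g x)"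
proof (induction k arbitrary: f g)
  case (Suc k)
  note fg = Suc.prems[THEN Ck_has_derivative] Suc.prems[THEN Ck_partial_derivative]
    Suc.prems[THEN Ck_Suc_imp_Ck]
  show ?case
    by (rule Ck_SucI, rule has_derivative_mult[OF fg(1,2)],
        rule Ck_add[OF Suc.IH[OF fg(5,4)] Suc.IH[OF fg(3,6)]])
qed (auto intro: continuous_intros)

lemma Ck_prod:
  assumes "\<And>i. i \<in> I \<Longrightarrow> Ck k (f i)"
  shows "Ck k (\<lambda>x. \<Prod>i\<in>I. f i x)"
  using assms by (induction I rule: infinite_finite_induct) (auto intro!: Ck_const Ck_mult)

lemma Ck_inner: "Ck k (\<lambda>x. x \<bullet> v + c)"
proof (cases k)
  case (Suc j)
  have "((\<lambda>x. x \<bullet> v + c) has_derivative (\<lambda>h. h \<bullet> v)) (at x)" for x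
    by (auto intro!: derivative_eq_intros)
  then show ?thesis
    unfolding Suc by (rule Ck_SucI) (rule Ck_const)
qed (auto intro!: continuous_intros)

lemma Ck_affine: "Ck k f \<Longrightarrow> Ck k (\<lambda>x. f (c + t *\<^sub>R x))"
proof (induction k arbitrary: f)
  case 0
  then show ?case
    by (auto intro!: continuous_on_compose2[of UNIV f] continuous_intros)
next
  case (Suc k)
  let ?D = "\<lambda>x h. t * frechet_derivative f (at (c + t *\<^sub>R x)) h"
  have "((\<lambda>x. f (c + t *\<^sub>R x)) has_derivative ?D x) (at x)" for x
  proof -
    have "((\<lambda>x. c + t *\<^sub>R x) has_derivative (\<lambda>h. t *\<^sub>R h)) (at x)"
      by (auto intro!: derivative_eq_intros)
    from has_derivative_compose[OF this Ck_has_derivative[OF Suc.prems]]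
    have "((\<lambda>x. f (c + t *\<^sub>R x)) has_derivative
        (\<lambda>h. frechet_derivative f (at (c + t *\<^sub>R x)) (t *\<^sub>R h))) (at x)" .
    moreover have "linear (frechet_derivative f (at (c + t *\<^sub>R x)))"
      using Ck_has_derivative[OF Suc.prems] has_derivative_linear by blast
    ultimately show ?thesis
      by (simp add: linear_cmul)
  qed
  then show ?case
    by (rule Ck_SucI) (intro Ck_mult Ck_const Suc.IH Ck_partial_derivative[OF Suc.prems])
qed

lemma frechet_derivative_real:
  fixes \<theta> :: "real \<Rightarrow> real"
  assumes "\<And>z. (\<theta> has_real_derivative \<theta>' z) (at z)"
  shows "frechet_derivative \<theta> (at z) = (\<lambda>h. \<theta>' z * h)"
  using frechet_derivative_at[of \<theta> "\<lambda>h. \<theta>' z * h" z] assms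
  by (simp add: has_field_derivative_def)

text \<open>
  The outer function lives on the line, where a Frechet derivative is determined by its
  value at \<open>1\<close>. Therefore the derivative of the composition is again a product of a
  composition with a \<open>Ck\<close> function, and the induction closes.
\<close>

lemma Ck_compose_real:
  fixes \<theta> :: "real \<Rightarrow> real"
  shows "Ck k \<theta> \<Longrightarrow> Ck k f \<Longrightarrow> Ck k (\<lambda>x. \<theta> (f x))"
proof (induction k arbitrary: \<theta> f)
  case 0
  then show ?case
    by (auto intro: continuous_on_compose2[of UNIV \<theta>])
next
  case (Suc k)
  let ?D = "\<lambda>x h. frechet_derivative \<theta> (at (f x)) 1 * frechet_derivative f (at x) h"
  have "((\<lambda>x. \<theta> (f x)) has_derivative ?D x) (at x)" for x
  proof -
    have lin: "linear (frechet_derivative \<theta> (at (f x)))"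
      using Ck_has_derivative[OF Suc.prems(1)] has_derivative_linear by blast
    have *: "frechet_derivative \<theta> (at (f x)) = (\<lambda>r. frechet_derivative \<theta> (at (f x)) 1 * r)"
    proof
      fix r
      show "frechet_derivative \<theta> (at (f x)) r = frechet_derivative \<theta> (at (f x)) 1 * r"
        using linear_cmul[OF lin, of r 1] by (simp add: mult.commute)
    qed
    show ?thesis
      using has_derivative_compose[OF Ck_has_derivative[OF Suc.prems(2)]
        Ck_has_derivative[OF Suc.prems(1)], of x]
      by (subst (asm) *)
  qed
  then show ?case
  proof (rule Ck_SucI)
    fix b :: 'a
    assume "b \<in> Basis"
    then show "Ck k (\<lambda>x. ?D x b)"
      using Suc.prems Ck_Suc_imp_Ck[OF Suc.prems(2)]
      by (intro Ck_mult Suc.IH[of "\<lambda>z. frechet_derivative \<theta> (at z) 1"]) auto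
  qed
qed

text \<open>
  The standard smooth function that vanishes to infinite order at \<open>0\<close>. It has two uses:
  products of it approximate indicators of boxes, and a rescaled copy serves as a smooth
  truncation that cuts off small values and is bounded above.
\<close>

definition flat :: "real \<Rightarrow> real" where
  "flat z = (if z \<le> 0 then 0 else exp (- 1 / z))"

lemma flat_nonneg: "0 \<le> flat z"
  and flat_le_1: "flat z \<le> 1"
  and flat_eq_0: "z \<le> 0 \<Longrightarrow> flat z = 0"
  by (auto simp: flat_def)

lemma flat_pos_iff: "flat z \<noteq> 0 \<longleftrightarrow> 0 < z"
  by (auto simp: flat_def)

lemma power_div_fact_le_exp:
  fixes x :: real
  assumes "0 \<le> x"
  shows "x ^ m / fact m \<le> exp x"
proof -
  have "(\<Sum>n\<in>{m}. x ^ n /\<^sub>R fact n) \<le> (\<Sum>n. x ^ n /\<^sub>R fact n)"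
    using assms summable_exp_generic[of x] by (intro sum_le_suminf) auto
  then show ?thesis
    by (simp add: exp_def divide_inverse mult.commute)
qed

lemma flat_le_power:
  assumes "0 < z"
  shows "flat z \<le> fact m * z ^ m"
proof -
  have "(1 / z) ^ m / fact m \<le> exp (1 / z)"
    using assms by (intro power_div_fact_le_exp) auto
  then have "1 / exp (1 / z) \<le> 1 / ((1 / z) ^ m / fact m)"
    using assms by (intro divide_left_mono) auto
  then show ?thesis
    using assms by (simp add: flat_def exp_minus power_divide field_simps)
qed

lemma flat_over_power_bound: "\<bar>flat z / z ^ m\<bar> \<le> fact (m + 2) * z\<^sup>2"
proof (cases "z \<le> 0")
  case False
  then have "flat z / z ^ m \<le> fact (m + 2) * z ^ (m + 2) / z ^ m"
    by (intro divide_right_mono flat_le_power) auto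
  also have "\<dots> = fact (m + 2) * z\<^sup>2"
    using False by (simp add: power_add power2_eq_square)
  finally show ?thesis
    using False flat_nonneg[of z] by simp
qed (simp add: flat_def)

text \<open>
  The functions \<open>flat z / z ^ m\<close> are closed under differentiation up to linear combination,
  which is why smoothness is proved for all \<open>m\<close> at once. At \<open>0\<close> the convention \<open>x / 0 = 0\<close>
  gives the right value.
\<close>

lemma flat_over_power_has_derivative:
  "((\<lambda>z. flat z / z ^ m) has_real_derivative
     (flat z / z ^ (m + 2) - real m * (flat z / z ^ Suc m))) (at z)"
proof -
  consider "z < 0" | "z = 0" | "z > 0" by linarith
  then show ?thesis
  proof cases
    case 1
    have "((\<lambda>z::real. 0) has_real_derivative 0) (at z)" by simp
    then have "((\<lambda>z. flat z / z ^ m) has_real_derivative 0) (at z)"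
      by (rule has_field_derivative_transform_within_open[where S = "{..<0}"])
        (use 1 in \<open>auto simp: flat_def\<close>)
    then show ?thesis using 1 by (simp add: flat_def)
  next
    case 2
    have "(\<lambda>h. flat h / h ^ m / h) \<midarrow>0\<rightarrow> 0"
    proof (rule Lim_null_comparison)
      show "\<forall>\<^sub>F h in at 0. norm (flat h / h ^ m / h) \<le> fact (Suc m + 2) * h\<^sup>2"
      proof (rule always_eventually, safe)
        fix h :: real
        show "norm (flat h / h ^ m / h) \<le> fact (Suc m + 2) * h\<^sup>2"
          using flat_over_power_bound[of h "Suc m"] by (simp add: mult.commute del: fact_Suc)
      qed
      show "(\<lambda>h::real. fact (Suc m + 2) * h\<^sup>2) \<midarrow>0\<rightarrow> 0"
        by (auto intro!: tendsto_eq_intros)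
    qed
    then show ?thesis
      using 2 by (simp add: DERIV_def flat_eq_0)
  next
    case 3
    have "((\<lambda>z. exp (- 1 / z) / z ^ m) has_real_derivative
       (exp (- 1 / z) / z ^ (m + 2) - real m * (exp (- 1 / z) / z ^ Suc m))) (at z)"
    proof -
      have e: "((\<lambda>z. exp (- 1 / z)) has_real_derivative exp (- 1 / z) / z\<^sup>2) (at z)"
        using 3 by (auto intro!: derivative_eq_intros simp: power2_eq_square)
      have p: "((\<lambda>z. inverse (z ^ m)) has_real_derivative - real m / z ^ Suc m) (at z)"
      proof (cases m)
        case (Suc j)
        have "((\<lambda>z. inverse (z ^ m)) has_real_derivative
            - (inverse (z ^ m) * (real m * z ^ j) * inverse (z ^ m))) (at z)"
          using 3 DERIV_pow[of m z] by (intro DERIV_inverse') (auto simp: Suc)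
        also have "inverse (z ^ m) * (real m * z ^ j) * inverse (z ^ m) = real m / z ^ Suc m"
          using 3 by (simp add: Suc divide_simps)
        finally show ?thesis by simp
      qed simp
      show ?thesis
        using DERIV_mult[OF e p] 3
        by (simp add: divide_inverse power_add power2_eq_square algebra_simps)
    qed
    then have "((\<lambda>z. flat z / z ^ m) has_real_derivative
       (exp (- 1 / z) / z ^ (m + 2) - real m * (exp (- 1 / z) / z ^ Suc m))) (at z)"
      by (rule has_field_derivative_transform_within_open[where S = "{0<..}"])
        (use 3 in \<open>auto simp: flat_def\<close>)
    then show ?thesis using 3 by (simp add: flat_def)
  qed
qed

lemma Ck_flat_over_power: "Ck k (\<lambda>z. flat z / z ^ m)"
proof (induction k arbitrary: m)
  case 0
  show ?case
    using flat_over_power_has_derivative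
    by (auto intro!: continuous_at_imp_continuous_on DERIV_isCont)
next
  case (Suc k)
  have "((\<lambda>z. flat z / z ^ m) has_derivative
     (\<lambda>h. (flat z / z ^ (m + 2) + - real m * (flat z / z ^ Suc m)) * h)) (at z)" for z
    using flat_over_power_has_derivative[of m z]
    by (simp add: has_field_derivative_def)
  then show ?case
    by (rule Ck_SucI) (intro Ck_mult Ck_add Ck_const Suc)
qed

lemma Ck_flat: "Ck k flat"
  using Ck_flat_over_power[of k 0] by simp

lemma flat_has_derivative: "(flat has_real_derivative flat z / z\<^sup>2) (at z)"
  using flat_over_power_has_derivative[of 0 z] by (simp add: power2_eq_square)

text \<open>
  With \<open>y = 1 / (2 * z)\<close> the claim is the square of \<open>2 * y \<le> exp y\<close>, which holds because
  \<open>2 \<le> exp 1\<close> and \<open>y \<le> exp (y - 1)\<close>.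
\<close>

lemma flat_derivative_le_1: "flat z / z\<^sup>2 \<le> 1"
proof (cases "z \<le> 0")
  case False
  define y where "y = 1 / (2 * z)"
  have y: "0 < y" using False by (simp add: y_def)
  have "2 * y \<le> exp 1 * exp (y - 1)"
    using y exp_ge_add_one_self[of 1] exp_ge_add_one_self[of "y - 1"]
    by (intro mult_mono) auto
  also have "\<dots> = exp y"
    by (simp add: exp_diff)
  finally have "(2 * y)\<^sup>2 \<le> (exp y)\<^sup>2"
    using y by (intro power_mono) auto
  moreover have "(exp y)\<^sup>2 = exp (1 / z)"
    by (simp add: y_def flip: exp_double)
  moreover have "(2 * y)\<^sup>2 = 1 / z\<^sup>2"
    by (simp add: y_def power_divide)
  ultimately have "exp (- 1 / z) * (1 / z\<^sup>2) \<le> exp (- 1 / z) * exp (1 / z)"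
    by (intro mult_left_mono) auto
  then show ?thesis
    using False by (simp add: flat_def flip: exp_add)
qed (simp add: flat_def)

lemma flat_mono: "y \<le> z \<Longrightarrow> flat y \<le> flat z"
  by (auto simp: flat_def field_simps)

lemma flat_ge: "1 \<le> z \<Longrightarrow> 1 / 3 \<le> flat z"
proof -
  assume "1 \<le> z"
  have "1 / 3 \<le> exp (- 1 :: real)"
    using exp_le by (simp add: exp_minus field_simps)
  also have "\<dots> = flat 1"
    by (simp add: flat_def)
  also have "\<dots> \<le> flat z"
    by (rule flat_mono) fact
  finally show ?thesis .
qed

section \<open>Test functions\<close>

lemma test_functions_mono: "\<Omega> \<subseteq> \<Omega>' \<Longrightarrow> test_functions \<Omega> \<subseteq> test_functions \<Omega>'"
  by (auto simp: test_functions_def)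

lemma test_function_Ck: "\<phi> \<in> test_functions \<Omega> \<Longrightarrow> Ck k \<phi>"
  by (simp add: test_functions_def)

lemma Ck_grad_has_derivative:
  assumes "Ck (Suc 0) \<phi>"
  shows "(\<phi> has_derivative (\<lambda>h. grad \<phi> x \<bullet> h)) (at x)"
proof -
  let ?D = "frechet_derivative \<phi> (at x)"
  have D: "(\<phi> has_derivative ?D) (at x)"
    using assms by (rule Ck_has_derivative)
  have "?D h = grad \<phi> x \<bullet> h" for h
  proof -
    have "?D h = ?D (\<Sum>b\<in>Basis. (h \<bullet> b) *\<^sub>R b)"
      by (simp add: euclidean_representation)
    also have "\<dots> = (\<Sum>b\<in>Basis. (h \<bullet> b) * ?D b)"
      using has_derivative_linear[OF D] by (simp add: linear_sum linear_cmul)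
    also have "\<dots> = grad \<phi> x \<bullet> h"
      by (simp add: grad_def inner_sum_left inner_commute[of h] mult.commute)
    finally show ?thesis .
  qed
  with D show ?thesis
    by (metis (no_types, lifting) ext)
qed

lemma grad_eqI:
  assumes "(\<phi> has_derivative (\<lambda>h. v \<bullet> h)) (at x)"
  shows "grad \<phi> x = v"
proof -
  have "frechet_derivative \<phi> (at x) = (\<lambda>h. v \<bullet> h)"
    using frechet_derivative_at[OF assms] by simp
  then show ?thesis
    by (simp add: grad_def euclidean_representation)
qed

lemma continuous_on_grad: "Ck (Suc 0) \<phi> \<Longrightarrow> continuous_on UNIV (grad \<phi>)"
  unfolding grad_def by (auto intro!: continuous_intros)

lemma test_function_support:
  assumes "\<phi> \<in> test_functions \<Omega>"
  obtains K where "compact K" "K \<subseteq> \<Omega>" "\<And>x. x \<notin> K \<Longrightarrow> \<phi> x = 0" "\<And>x. x \<notin> K \<Longrightarrow> grad \<phi> x = 0"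
proof
  let ?K = "closure {x. \<phi> x \<noteq> 0}"
  show "compact ?K" "?K \<subseteq> \<Omega>"
    using assms by (auto simp: test_functions_def)
  show "\<phi> x = 0" if "x \<notin> ?K" for x
    using that closure_subset[of "{x. \<phi> x \<noteq> 0}"] by auto
  show "grad \<phi> x = 0" if "x \<notin> ?K" for x
  proof (rule grad_eqI)
    have "((\<lambda>_. 0) has_derivative (\<lambda>h. 0 \<bullet> h)) (at x)"
      by simp
    then show "(\<phi> has_derivative (\<lambda>h. 0 \<bullet> h)) (at x)"
    proof (rule has_derivative_transform_within_open)
      show "open (- ?K)" "x \<in> - ?K"
        using that by auto
      show "0 = \<phi> y" if "y \<in> - ?K" for y
        using that closure_subset[of "{x. \<phi> x \<noteq> 0}"] by auto
    qed
  qed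
qed

lemma grad_test_function_eq_0: "\<phi> \<in> test_functions \<Omega> \<Longrightarrow> x \<notin> \<Omega> \<Longrightarrow> grad \<phi> x = 0"
  and test_function_eq_0: "\<phi> \<in> test_functions \<Omega> \<Longrightarrow> x \<notin> \<Omega> \<Longrightarrow> \<phi> x = 0"
  by (metis test_function_support subsetD)+

lemma test_function_continuous:
  assumes "\<phi> \<in> test_functions \<Omega>"
  shows "continuous_on UNIV \<phi>" "continuous_on UNIV (grad \<phi>)"
  using test_function_Ck[OF assms, of 0] continuous_on_grad[OF test_function_Ck[OF assms]]
  by auto

lemma test_function_measurable:
  assumes "\<phi> \<in> test_functions \<Omega>"
  shows "\<phi> \<in> borel_measurable borel" "grad \<phi> \<in> borel_measurable borel"
  using test_function_continuous[OF assms] by (auto intro: borel_measurable_continuous_onI)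

text \<open>
  The support is allowed to be any compact set, so that one set can serve for a function
  and its gradient.
\<close>

lemma integrable_continuous_compact_support:
  fixes f :: "'a::euclidean_space \<Rightarrow> 'b::{banach, second_countable_topology}"
  assumes "continuous_on UNIV f" "compact K" "\<And>x. x \<notin> K \<Longrightarrow> f x = 0"
  shows "integrable lborel f"
proof -
  have "integrable lborel (\<lambda>x. indicator K x *\<^sub>R f x)"
    using assms by (intro borel_integrable_compact) (auto intro: continuous_on_subset)
  also have "(\<lambda>x. indicator K x *\<^sub>R f x) = f"
    using assms(3) by (auto simp: indicator_def)
  finally show ?thesis .
qed

lemma bounded_continuous_compact_support:
  fixes f :: "'a::euclidean_space \<Rightarrow> 'b::real_normed_vector"
  assumes "continuous_on UNIV f" "compact K" "\<And>x. x \<notin> K \<Longrightarrow> f x = 0"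
  obtains M where "0 \<le> M" "\<And>x. norm (f x) \<le> M"
proof -
  have "bounded (f ` K)"
    using assms by (intro compact_imp_bounded compact_continuous_image) (auto intro: continuous_on_subset)
  then obtain M where "\<And>x. x \<in> K \<Longrightarrow> norm (f x) \<le> M"
    by (auto simp: bounded_iff)
  then have "norm (f x) \<le> max 0 M" for x
    using assms(3)[of x] by (cases "x \<in> K") force+
  then show thesis
    using that[of "max 0 M"] by auto
qed

section \<open>Affine substitutions and square integrals\<close>

text \<open>
  The squared norm takes values in \<open>ennreal\<close>, so that convergence to \<open>0\<close> can be stated, and
  limits of estimates can be taken, before anything is known to be integrable.
\<close>

definition l2sq :: "('a::euclidean_space \<Rightarrow> 'b::real_normed_vector) \<Rightarrow> ennreal" where
  "l2sq f = (\<integral>\<^sup>+x. ennreal ((norm (f x))\<^sup>2) \<partial>lborel)"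

lemma norm_add_sq_le: "(norm (a + b))\<^sup>2 \<le> 2 * (norm a)\<^sup>2 + 2 * (norm (b::'b::real_normed_vector))\<^sup>2"
proof -
  have "(norm (a + b))\<^sup>2 \<le> (norm a + norm b)\<^sup>2"
    by (intro power_mono norm_triangle_ineq) auto
  also have "\<dots> \<le> 2 * (norm a)\<^sup>2 + 2 * (norm b)\<^sup>2"
    using sum_squares_bound[of "norm a" "norm b"] by (simp add: power2_sum)
  finally show ?thesis .
qed

lemma l2sq_cong_AE: "AE x in lborel. norm (f x) = norm (g x) \<Longrightarrow> l2sq f = l2sq g"
  unfolding l2sq_def by (intro nn_integral_cong_AE) auto

lemma l2sq_mono_AE: "AE x in lborel. norm (f x) \<le> norm (g x) \<Longrightarrow> l2sq f \<le> l2sq g"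
  unfolding l2sq_def by (intro nn_integral_mono_AE) (auto intro!: ennreal_leI power_mono)

lemma l2sq_add:
  fixes f g :: "'a::euclidean_space \<Rightarrow> 'b::euclidean_space"
  assumes [measurable]: "f \<in> borel_measurable borel" "g \<in> borel_measurable borel"
  shows "l2sq (\<lambda>x. f x + g x) \<le> 2 * l2sq f + 2 * l2sq g"
proof -
  have "l2sq (\<lambda>x. f x + g x) \<le>
      (\<integral>\<^sup>+x. 2 * ennreal ((norm (f x))\<^sup>2) + 2 * ennreal ((norm (g x))\<^sup>2) \<partial>lborel)"
    unfolding l2sq_def
  proof (rule nn_integral_mono)
    fix x
    have "ennreal ((norm (f x + g x))\<^sup>2) \<le> ennreal (2 * (norm (f x))\<^sup>2 + 2 * (norm (g x))\<^sup>2)"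
      by (intro ennreal_leI norm_add_sq_le)
    then show "ennreal ((norm (f x + g x))\<^sup>2) \<le> 2 * ennreal ((norm (f x))\<^sup>2) + 2 * ennreal ((norm (g x))\<^sup>2)"
      by (simp add: ennreal_mult)
  qed
  also have "\<dots> = 2 * l2sq f + 2 * l2sq g"
    unfolding l2sq_def by (simp add: nn_integral_add nn_integral_cmult)
  finally show ?thesis .
qed

lemma l2sq_minus: "l2sq (\<lambda>x. - f x) = l2sq f"
  by (simp add: l2sq_def)

lemma l2sq_diff:
  fixes f g :: "'a::euclidean_space \<Rightarrow> 'b::euclidean_space"
  assumes "f \<in> borel_measurable borel" "g \<in> borel_measurable borel"
  shows "l2sq (\<lambda>x. f x - g x) \<le> 2 * l2sq f + 2 * l2sq g"
  using l2sq_add[of f "\<lambda>x. - g x"] assms by (simp add: l2sq_minus)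

lemma l2sq_scaleR:
  fixes f :: "'a::euclidean_space \<Rightarrow> 'b::euclidean_space"
  assumes [measurable]: "f \<in> borel_measurable borel"
  shows "l2sq (\<lambda>x. c *\<^sub>R f x) = ennreal (c\<^sup>2) * l2sq f"
  unfolding l2sq_def
  by (subst nn_integral_cmult[symmetric])
    (auto simp: power_mult_distrib ennreal_mult intro!: nn_integral_cong)

lemma nn_integral_affine:
  fixes f :: "'a::euclidean_space \<Rightarrow> ennreal"
  assumes [measurable]: "f \<in> borel_measurable borel" and "t \<noteq> 0"
  shows "(\<integral>\<^sup>+x. f x \<partial>lborel) = ennreal (\<bar>t\<bar> ^ DIM('a)) * (\<integral>\<^sup>+x. f (c + t *\<^sub>R x) \<partial>lborel)"
  by (subst lborel_affine[OF assms(2), of c])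
    (simp add: nn_integral_density nn_integral_distr nn_integral_cmult)

lemma lborel_integral_affine:
  fixes f :: "'a::euclidean_space \<Rightarrow> 'b::{banach, second_countable_topology}"
  assumes [measurable]: "f \<in> borel_measurable borel" and "t \<noteq> 0"
  shows "(LINT x|lborel. f x) = \<bar>t\<bar> ^ DIM('a) *\<^sub>R (LINT x|lborel. f (c + t *\<^sub>R x))"
proof -
  have "(LINT x|lborel. f x) = (LINT x|density (distr lborel borel (\<lambda>x. c + t *\<^sub>R x)) (\<lambda>_. ennreal (\<bar>t\<bar> ^ DIM('a))). f x)"
    by (subst lborel_affine[OF assms(2), of c]) simp
  also have "\<dots> = (LINT x|distr lborel borel (\<lambda>x. c + t *\<^sub>R x). \<bar>t\<bar> ^ DIM('a) *\<^sub>R f x)"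
    by (rule integral_density) auto
  also have "\<dots> = (LINT x|lborel. \<bar>t\<bar> ^ DIM('a) *\<^sub>R f (c + t *\<^sub>R x))"
    by (rule integral_distr) auto
  also have "\<dots> = \<bar>t\<bar> ^ DIM('a) *\<^sub>R (LINT x|lborel. f (c + t *\<^sub>R x))"
    by simp
  finally show ?thesis .
qed

lemma lborel_integrable_affine:
  fixes f :: "'a::euclidean_space \<Rightarrow> 'b::{banach, second_countable_topology}"
  assumes f: "integrable lborel f" and t: "t \<noteq> 0"
  shows "integrable lborel (\<lambda>x. f (c + t *\<^sub>R x))"
proof -
  have [measurable]: "f \<in> borel_measurable borel"
    using f by auto
  have "integrable (density (distr lborel borel (\<lambda>x. c + t *\<^sub>R x)) (\<lambda>_. ennreal (\<bar>t\<bar> ^ DIM('a)))) f"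
    using f lborel_affine[OF t, of c] by simp
  then have "integrable (distr lborel borel (\<lambda>x. c + t *\<^sub>R x)) (\<lambda>x. \<bar>t\<bar> ^ DIM('a) *\<^sub>R f x)"
    by (subst (asm) integrable_density) auto
  then have "integrable lborel (\<lambda>x. \<bar>t\<bar> ^ DIM('a) *\<^sub>R f (c + t *\<^sub>R x))"
    by (subst (asm) integrable_distr_eq) auto
  then have "integrable lborel (\<lambda>x. (1 / \<bar>t\<bar> ^ DIM('a)) *\<^sub>R \<bar>t\<bar> ^ DIM('a) *\<^sub>R f (c + t *\<^sub>R x))"
    by (intro integrable_scaleR_right[of "1 / \<bar>t\<bar> ^ DIM('a)"])
  then show ?thesis
    using t by simp
qed

lemma l2sq_affine:
  fixes f :: "'a::euclidean_space \<Rightarrow> 'b::euclidean_space"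
  assumes [measurable]: "f \<in> borel_measurable borel" and "t \<noteq> 0"
  shows "l2sq f = ennreal (\<bar>t\<bar> ^ DIM('a)) * l2sq (\<lambda>x. f (c + t *\<^sub>R x))"
  unfolding l2sq_def using assms by (intro nn_integral_affine) auto

lemma l2sq_affine_le:
  fixes f :: "'a::euclidean_space \<Rightarrow> 'b::euclidean_space"
  assumes "f \<in> borel_measurable borel" and "1 \<le> t"
  shows "l2sq (\<lambda>x. f (c + t *\<^sub>R x)) \<le> l2sq f"
proof -
  have "1 * l2sq (\<lambda>x. f (c + t *\<^sub>R x)) \<le> ennreal (\<bar>t\<bar> ^ DIM('a)) * l2sq (\<lambda>x. f (c + t *\<^sub>R x))"
    using assms(2) by (intro mult_right_mono) (auto simp flip: ennreal_1)
  also have "\<dots> = l2sq f"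
    using assms by (intro l2sq_affine[symmetric]) auto
  finally show ?thesis by simp
qed

lemma l2sq_integral:
  assumes "f \<in> borel_measurable borel" "l2sq f < \<infinity>"
  shows "integrable lborel (\<lambda>x. (norm (f x))\<^sup>2)"
    and "l2sq f = ennreal (\<integral>x. (norm (f x))\<^sup>2 \<partial>lborel)"
proof -
  show i: "integrable lborel (\<lambda>x. (norm (f x))\<^sup>2)"
    using assms unfolding l2sq_def by (intro integrableI_nonneg) auto
  show "l2sq f = ennreal (\<integral>x. (norm (f x))\<^sup>2 \<partial>lborel)"
    using i unfolding l2sq_def by (intro nn_integral_eq_integral) auto
qed

lemma l2sq_integrable:
  assumes "integrable lborel (\<lambda>x. (norm (f x))\<^sup>2)"
  shows "l2sq f = ennreal (\<integral>x. (norm (f x))\<^sup>2 \<partial>lborel)" "l2sq f < \<infinity>"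
proof -
  show "l2sq f = ennreal (\<integral>x. (norm (f x))\<^sup>2 \<partial>lborel)"
    using assms unfolding l2sq_def by (intro nn_integral_eq_integral) auto
  then show "l2sq f < \<infinity>" by simp
qed

lemma l2sq_test_function:
  assumes "\<phi> \<in> test_functions \<Omega>"
  shows "l2sq \<phi> < \<infinity>" "l2sq (grad \<phi>) < \<infinity>"
proof -
  obtain K where K: "compact K" "\<And>x. x \<notin> K \<Longrightarrow> \<phi> x = 0" "\<And>x. x \<notin> K \<Longrightarrow> grad \<phi> x = 0"
    using test_function_support[OF assms] by metis
  note c = test_function_continuous[OF assms]
  show "l2sq \<phi> < \<infinity>"
    by (intro l2sq_integrable integrable_continuous_compact_support[OF _ K(1)])
      (auto intro!: continuous_intros c simp: K)
  show "l2sq (grad \<phi>) < \<infinity>"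
    by (intro l2sq_integrable integrable_continuous_compact_support[OF _ K(1)])
      (auto intro!: continuous_intros c simp: K)
qed

section \<open>Differences along affine flows\<close>

text \<open>
  Translations (\<open>\<kappa> = 0\<close>) and dilations by \<open>1 + \<kappa>\<close> are treated together. The increment along
  the segment from \<open>x\<close> to its image is the integral of a directional derivative; the
  Cauchy-Schwarz inequality and Fubini reduce the claim to the maps
  \<open>x \<mapsto> x + \<sigma> *\<^sub>R (\<kappa> *\<^sub>R x + h)\<close>, which do not decrease volume. The displacement only has to be
  bounded where the segment meets the support of the gradient; for dilations it is
  unbounded elsewhere.
\<close>

lemma test_function_flow_estimate:
  fixes \<phi> :: "'a::euclidean_space \<Rightarrow> real"
  assumes \<phi>: "\<phi> \<in> test_functions UNIV" and "0 \<le> \<kappa>" "0 \<le> R"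
    and R: "\<And>x \<sigma>. 0 \<le> \<sigma> \<Longrightarrow> \<sigma> \<le> 1 \<Longrightarrow> grad \<phi> (x + \<sigma> *\<^sub>R (\<kappa> *\<^sub>R x + h)) \<noteq> 0
        \<Longrightarrow> norm (\<kappa> *\<^sub>R x + h) \<le> R"
  shows "l2sq (\<lambda>x. \<phi> (x + (\<kappa> *\<^sub>R x + h)) - \<phi> x) \<le> ennreal (R\<^sup>2) * l2sq (grad \<phi>)"
proof -
  note [measurable] = test_function_measurable[OF \<phi>]
  note cont = test_function_continuous[OF \<phi>]
  define V where "V = (\<lambda>x. \<kappa> *\<^sub>R x + h)"
  have [measurable]: "V \<in> borel_measurable borel"
    by (simp add: V_def)
  have pointwise: "ennreal ((norm (\<phi> (x + V x) - \<phi> x))\<^sup>2) \<le>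
      (\<integral>\<^sup>+\<sigma>. ennreal (R\<^sup>2) * ennreal ((norm (grad \<phi> (x + \<sigma> *\<^sub>R V x)))\<^sup>2) * indicator {0..1} \<sigma> \<partial>lborel)" for x
  proof -
    define \<gamma> where "\<gamma> = (\<lambda>\<sigma>. grad \<phi> (x + \<sigma> *\<^sub>R V x) \<bullet> V x)"
    have \<gamma>_cont: "continuous_on S \<gamma>" for S
      unfolding \<gamma>_def by (intro continuous_intros continuous_on_compose2[OF cont(2)]) auto
    then have [measurable]: "\<gamma> \<in> borel_measurable borel"
      by (intro borel_measurable_continuous_onI)
    have der: "((\<lambda>\<sigma>. \<phi> (x + \<sigma> *\<^sub>R V x)) has_vector_derivative \<gamma> \<sigma>) (at \<sigma> within A)" for \<sigma> A
    proof -
      have "((\<lambda>\<sigma>. x + \<sigma> *\<^sub>R V x) has_derivative (\<lambda>r. r *\<^sub>R V x)) (at \<sigma> within A)"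
        by (auto intro!: derivative_eq_intros)
      from has_derivative_compose[OF this
          Ck_grad_has_derivative[OF test_function_Ck[OF \<phi>]]]
      show ?thesis
        by (simp add: has_vector_derivative_def \<gamma>_def)
    qed
    have "(\<integral>\<sigma>. indicator {0..1} \<sigma> *\<^sub>R \<gamma> \<sigma> \<partial>lborel) = \<phi> (x + 1 *\<^sub>R V x) - \<phi> (x + 0 *\<^sub>R V x)"
      by (rule integral_FTC_atLeastAtMost) (use der \<gamma>_cont in auto)
    then have "ennreal (norm (\<phi> (x + V x) - \<phi> x)) = ennreal (norm (\<integral>\<sigma>. indicator {0..1} \<sigma> *\<^sub>R \<gamma> \<sigma> \<partial>lborel))"
      by simp
    also have "\<dots> \<le> (\<integral>\<^sup>+\<sigma>. ennreal (norm (indicator {0..1} \<sigma> *\<^sub>R \<gamma> \<sigma>)) \<partial>lborel)"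
      using borel_integrable_compact[OF compact_Icc \<gamma>_cont]
      by (intro integral_norm_bound_ennreal) auto
    also have "\<dots> = (\<integral>\<^sup>+\<sigma>. indicator {0..1} \<sigma> * ennreal \<bar>\<gamma> \<sigma> * indicator {0..1} \<sigma>\<bar> \<partial>lborel)"
      by (intro nn_integral_cong) (auto simp: indicator_def)
    finally have "(ennreal (norm (\<phi> (x + V x) - \<phi> x)))\<^sup>2 \<le>
        (\<integral>\<^sup>+\<sigma>. indicator {0..1} \<sigma> * ennreal \<bar>\<gamma> \<sigma> * indicator {0..1} \<sigma>\<bar> \<partial>lborel)\<^sup>2"
      by (intro power_mono) auto
    also have "\<dots> \<le> (\<integral>\<^sup>+\<sigma>. (indicator {0..1::real} \<sigma>)\<^sup>2 \<partial>lborel) *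
        (\<integral>\<^sup>+\<sigma>. (ennreal \<bar>\<gamma> \<sigma> * indicator {0..1} \<sigma>\<bar>)\<^sup>2 \<partial>lborel)"
      by (intro Cauchy_Schwarz_nn_integral) auto
    also have "(\<integral>\<^sup>+\<sigma>. (indicator {0..1::real} \<sigma>)\<^sup>2 \<partial>lborel) = (\<integral>\<^sup>+\<sigma>. indicator {0..1::real} \<sigma> \<partial>lborel)"
      by (intro nn_integral_cong) (auto simp: indicator_def)
    also have "\<dots> = 1"
      by simp
    also have "1 * (\<integral>\<^sup>+\<sigma>. (ennreal \<bar>\<gamma> \<sigma> * indicator {0..1} \<sigma>\<bar>)\<^sup>2 \<partial>lborel) \<le>
      (\<integral>\<^sup>+\<sigma>. ennreal (R\<^sup>2) * ennreal ((norm (grad \<phi> (x + \<sigma> *\<^sub>R V x)))\<^sup>2) * indicator {0..1} \<sigma> \<partial>lborel)"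
      unfolding mult_1
    proof (rule nn_integral_mono)
      fix \<sigma> :: real
      have "(\<gamma> \<sigma>)\<^sup>2 \<le> R\<^sup>2 * (norm (grad \<phi> (x + \<sigma> *\<^sub>R V x)))\<^sup>2" if \<sigma>: "0 \<le> \<sigma>" "\<sigma> \<le> 1"
      proof (cases "grad \<phi> (x + \<sigma> *\<^sub>R V x) = 0")
        case False
        have "\<bar>\<gamma> \<sigma>\<bar> \<le> norm (grad \<phi> (x + \<sigma> *\<^sub>R V x)) * norm (V x)"
          unfolding \<gamma>_def by (rule Cauchy_Schwarz_ineq2)
        also have "\<dots> \<le> norm (grad \<phi> (x + \<sigma> *\<^sub>R V x)) * R"
          using R[OF \<sigma>, of x] False by (intro mult_left_mono) (auto simp: V_def)
        finally have "\<bar>\<gamma> \<sigma>\<bar>\<^sup>2 \<le> (norm (grad \<phi> (x + \<sigma> *\<^sub>R V x)) * R)\<^sup>2"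
          by (intro power_mono) auto
        then show ?thesis
          by (simp add: power_mult_distrib mult.commute)
      qed (simp add: \<gamma>_def)
      then show "(ennreal \<bar>\<gamma> \<sigma> * indicator {0..1} \<sigma>\<bar>)\<^sup>2 \<le>
          ennreal (R\<^sup>2) * ennreal ((norm (grad \<phi> (x + \<sigma> *\<^sub>R V x)))\<^sup>2) * indicator {0..1} \<sigma>"
        by (auto simp: indicator_def ennreal_power simp flip: ennreal_mult intro!: ennreal_leI)
    qed
    finally show ?thesis
      by (simp add: ennreal_power)
  qed
  have "l2sq (\<lambda>x. \<phi> (x + V x) - \<phi> x) \<le> (\<integral>\<^sup>+x. \<integral>\<^sup>+\<sigma>. ennreal (R\<^sup>2) *
      ennreal ((norm (grad \<phi> (x + \<sigma> *\<^sub>R V x)))\<^sup>2) * indicator {0..1} \<sigma> \<partial>lborel \<partial>lborel)"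
    unfolding l2sq_def by (intro nn_integral_mono pointwise)
  also have "\<dots> = (\<integral>\<^sup>+\<sigma>. \<integral>\<^sup>+x. ennreal (R\<^sup>2) *
      ennreal ((norm (grad \<phi> (x + \<sigma> *\<^sub>R V x)))\<^sup>2) * indicator {0..1} \<sigma> \<partial>lborel \<partial>lborel)"
    by (rule lborel_pair.Fubini') measurable
  also have "\<dots> \<le> (\<integral>\<^sup>+\<sigma>. ennreal (R\<^sup>2) * l2sq (grad \<phi>) * indicator {0..1::real} \<sigma> \<partial>lborel)"
  proof (rule nn_integral_mono)
    fix \<sigma> :: real
    show "(\<integral>\<^sup>+x. ennreal (R\<^sup>2) * ennreal ((norm (grad \<phi> (x + \<sigma> *\<^sub>R V x)))\<^sup>2) * indicator {0..1} \<sigma> \<partial>lborel)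
        \<le> ennreal (R\<^sup>2) * l2sq (grad \<phi>) * indicator {0..1} \<sigma>"
    proof (cases "\<sigma> \<in> {0..1}")
      case True
      have "(\<lambda>x. grad \<phi> (x + \<sigma> *\<^sub>R V x)) = (\<lambda>x. grad \<phi> (\<sigma> *\<^sub>R h + (1 + \<sigma> * \<kappa>) *\<^sub>R x))"
        by (simp add: V_def algebra_simps)
      moreover have "l2sq (\<lambda>x. grad \<phi> (\<sigma> *\<^sub>R h + (1 + \<sigma> * \<kappa>) *\<^sub>R x)) \<le> l2sq (grad \<phi>)"
        using True \<open>0 \<le> \<kappa>\<close> by (intro l2sq_affine_le) auto
      ultimately have "l2sq (\<lambda>x. grad \<phi> (x + \<sigma> *\<^sub>R V x)) \<le> l2sq (grad \<phi>)"
        by simp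
      then show ?thesis
        using True unfolding l2sq_def by (simp add: nn_integral_cmult mult_left_mono)
    qed simp
  qed
  also have "\<dots> = ennreal (R\<^sup>2) * l2sq (grad \<phi>)"
    by (simp add: nn_integral_cmult)
  finally show ?thesis
    by (simp add: V_def)
qed

section \<open>Functions approximable by test functions\<close>

text \<open>
  Membership of \<open>u\<close> in the closure of the test functions, together with the limit \<open>G\<close> of their
  gradients as a second argument. Both norms are taken over the whole space, so that
  \<open>u\<close> and \<open>G\<close> vanish almost everywhere outside \<open>\<Omega>\<close>. Carrying \<open>G\<close> explicitly avoids the choice
  hidden in \<open>weak_gradient\<close>, and Borel measurability makes Fubini's theorem available.
\<close>

definition H10_pair :: "'a::euclidean_space set \<Rightarrow> ('a \<Rightarrow> real) \<Rightarrow> ('a \<Rightarrow> 'a) \<Rightarrow> bool" where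
  "H10_pair \<Omega> u G \<longleftrightarrow> u \<in> borel_measurable borel \<and> G \<in> borel_measurable borel \<and>
     (\<exists>\<phi>. (\<forall>k. \<phi> k \<in> test_functions \<Omega>) \<and> (\<lambda>k. l2sq (\<lambda>x. \<phi> k x - u x)) \<longlonglongrightarrow> 0 \<and>
        (\<lambda>k. l2sq (\<lambda>x. grad (\<phi> k) x - G x)) \<longlonglongrightarrow> 0)"

lemma H10_pair_measurable:
  assumes "H10_pair \<Omega> u G"
  shows "u \<in> borel_measurable borel" "G \<in> borel_measurable borel"
  using assms by (auto simp: H10_pair_def)

lemma H10_pairE:
  assumes "H10_pair \<Omega> u G"
  obtains \<phi> where "\<And>k. \<phi> k \<in> test_functions \<Omega>" "(\<lambda>k. l2sq (\<lambda>x. \<phi> k x - u x)) \<longlonglongrightarrow> 0"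
    "(\<lambda>k. l2sq (\<lambda>x. grad (\<phi> k) x - G x)) \<longlonglongrightarrow> 0"
  using assms by (auto simp: H10_pair_def)

lemma l2sq_limit_finite:
  fixes f :: "nat \<Rightarrow> 'a::euclidean_space \<Rightarrow> 'b::euclidean_space"
  assumes "(\<lambda>k. l2sq (\<lambda>x. f k x - g x)) \<longlonglongrightarrow> 0" "\<And>k. l2sq (f k) < \<infinity>"
    and "\<And>k. f k \<in> borel_measurable borel" "g \<in> borel_measurable borel"
  shows "l2sq g < \<infinity>"
proof -
  have "\<forall>\<^sub>F k in sequentially. l2sq (\<lambda>x. f k x - g x) < 1"
    using assms(1) by (rule order_tendstoD) simp
  then obtain k where k: "l2sq (\<lambda>x. f k x - g x) < 1"
    by (auto simp: eventually_sequentially)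
  have "l2sq g = l2sq (\<lambda>x. f k x - (f k x - g x))"
    by simp
  also have "\<dots> \<le> 2 * l2sq (f k) + 2 * l2sq (\<lambda>x. f k x - g x)"
    using assms by (intro l2sq_diff) auto
  also have "\<dots> < \<infinity>"
    using assms(2)[of k] order.strict_trans[OF k ennreal_one_less_top]
    by (auto simp: ennreal_mult_less_top)
  finally show ?thesis .
qed

lemma H10_pair_finite:
  assumes "H10_pair \<Omega> u G"
  shows "l2sq u < \<infinity>" "l2sq G < \<infinity>"
proof -
  note [measurable] = H10_pair_measurable[OF assms]
  obtain \<phi> where \<phi>: "\<And>k. \<phi> k \<in> test_functions \<Omega>" "(\<lambda>k. l2sq (\<lambda>x. \<phi> k x - u x)) \<longlonglongrightarrow> 0"
    "(\<lambda>k. l2sq (\<lambda>x. grad (\<phi> k) x - G x)) \<longlonglongrightarrow> 0"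
    using H10_pairE[OF assms] by blast
  show "l2sq u < \<infinity>"
    by (intro l2sq_limit_finite[OF \<phi>(2)] l2sq_test_function[OF \<phi>(1)] test_function_measurable[OF \<phi>(1)]) measurable
  show "l2sq G < \<infinity>"
    by (intro l2sq_limit_finite[OF \<phi>(3)] l2sq_test_function[OF \<phi>(1)] test_function_measurable[OF \<phi>(1)]) measurable
qed

lemma H10_pair_flow_estimate:
  fixes u :: "'a::euclidean_space \<Rightarrow> real"
  assumes uG: "H10_pair \<Omega> u G" and "0 \<le> \<kappa>" "0 \<le> R"
    and R: "\<And>x \<sigma>. 0 \<le> \<sigma> \<Longrightarrow> \<sigma> \<le> 1 \<Longrightarrow> x + \<sigma> *\<^sub>R (\<kappa> *\<^sub>R x + h) \<in> \<Omega> \<Longrightarrow> norm (\<kappa> *\<^sub>R x + h) \<le> R"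
  shows "l2sq (\<lambda>x. u (x + (\<kappa> *\<^sub>R x + h)) - u x) \<le> 4 * ennreal (R\<^sup>2) * l2sq G"
proof -
  note [measurable] = H10_pair_measurable[OF uG]
  obtain \<phi> where \<phi>: "\<And>k. \<phi> k \<in> test_functions \<Omega>" "(\<lambda>k. l2sq (\<lambda>x. \<phi> k x - u x)) \<longlonglongrightarrow> 0"
    "(\<lambda>k. l2sq (\<lambda>x. grad (\<phi> k) x - G x)) \<longlonglongrightarrow> 0"
    using H10_pairE[OF uG] by blast
  note [measurable] = test_function_measurable[OF \<phi>(1)]
  define a where "a = (\<lambda>k. l2sq (\<lambda>x. \<phi> k x - u x))"
  define b where "b = (\<lambda>k. l2sq (\<lambda>x. grad (\<phi> k) x - G x))"
  \<comment> \<open>The map \<open>x \<mapsto> x + (\<kappa> *\<^sub>R x + h)\<close> expands volume, hence it does not increase the distance between \<open>\<phi> k\<close> and \<open>u\<close>.\<close>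
  have est: "l2sq (\<lambda>x. u (x + (\<kappa> *\<^sub>R x + h)) - u x) \<le>
     8 * a k + 4 * ennreal (R\<^sup>2) * b k + 4 * ennreal (R\<^sup>2) * l2sq G" for k
  proof -
    define y where "y = (\<lambda>x. x + (\<kappa> *\<^sub>R x + h))"
    have [measurable]: "y \<in> borel_measurable borel"
      by (simp add: y_def)
    have y: "y = (\<lambda>x. h + (1 + \<kappa>) *\<^sub>R x)"
      by (simp add: y_def algebra_simps)
    have "l2sq (\<lambda>x. u (y x) - u x) =
        l2sq (\<lambda>x. (\<phi> k (y x) - \<phi> k x) - ((\<phi> k (y x) - u (y x)) - (\<phi> k x - u x)))"
      by (intro arg_cong[where f = l2sq] ext) linarith
    also have "\<dots> \<le> 2 * l2sq (\<lambda>x. \<phi> k (y x) - \<phi> k x) +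
        2 * l2sq (\<lambda>x. (\<phi> k (y x) - u (y x)) - (\<phi> k x - u x))"
      by (rule l2sq_diff) measurable
    also have "\<dots> \<le> 2 * (ennreal (R\<^sup>2) * l2sq (grad (\<phi> k))) +
        2 * (2 * l2sq (\<lambda>x. \<phi> k (y x) - u (y x)) + 2 * a k)"
    proof (intro add_mono mult_left_mono)
      have K: "x \<in> \<Omega>" if "grad (\<phi> k) x \<noteq> 0" for x
        using grad_test_function_eq_0[OF \<phi>(1)] that by auto
      show "l2sq (\<lambda>x. \<phi> k (y x) - \<phi> k x) \<le> ennreal (R\<^sup>2) * l2sq (grad (\<phi> k))"
        unfolding y_def
      proof (rule test_function_flow_estimate)
        show "\<phi> k \<in> test_functions UNIV"
          using \<phi>(1) test_functions_mono by blast
        fix x \<sigma>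
        assume "0 \<le> \<sigma>" "\<sigma> \<le> 1" "grad (\<phi> k) (x + \<sigma> *\<^sub>R (\<kappa> *\<^sub>R x + h)) \<noteq> 0"
        then show "norm (\<kappa> *\<^sub>R x + h) \<le> R"
          by (intro R[OF _ _ K])
      qed fact+
      show "l2sq (\<lambda>x. (\<phi> k (y x) - u (y x)) - (\<phi> k x - u x))
          \<le> 2 * l2sq (\<lambda>x. \<phi> k (y x) - u (y x)) + 2 * a k"
        unfolding a_def by (rule l2sq_diff) measurable
    qed auto
    also have "\<dots> \<le> 2 * (ennreal (R\<^sup>2) * (2 * b k + 2 * l2sq G)) + 2 * (2 * a k + 2 * a k)"
    proof (intro add_mono mult_left_mono)
      have "l2sq (grad (\<phi> k)) = l2sq (\<lambda>x. (grad (\<phi> k) x - G x) + G x)"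
        by simp
      also have "\<dots> \<le> 2 * b k + 2 * l2sq G"
        unfolding b_def by (rule l2sq_add) measurable
      finally show "l2sq (grad (\<phi> k)) \<le> 2 * b k + 2 * l2sq G" .
      show "l2sq (\<lambda>x. \<phi> k (y x) - u (y x)) \<le> a k"
        unfolding a_def y using \<open>0 \<le> \<kappa>\<close> by (intro l2sq_affine_le) auto
    qed auto
    also have "\<dots> = 8 * a k + 4 * ennreal (R\<^sup>2) * b k + 4 * ennreal (R\<^sup>2) * l2sq G"
    proof -
      have "a k * 4 + a k * 4 = a k * 8"
        by (simp flip: distrib_left)
      then show ?thesis
        by (simp add: algebra_simps)
    qed
    finally show ?thesis
      by (simp add: y_def)
  qed
  have "(\<lambda>k. 8 * a k + 4 * ennreal (R\<^sup>2) * b k + 4 * ennreal (R\<^sup>2) * l2sq G)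
      \<longlonglongrightarrow> 8 * 0 + 4 * ennreal (R\<^sup>2) * 0 + 4 * ennreal (R\<^sup>2) * l2sq G"
    using \<phi>(2,3) unfolding a_def b_def
    by (intro tendsto_add ennreal_tendsto_cmult tendsto_const) (auto simp: ennreal_mult_less_top)
  then show ?thesis
    using est by (intro LIMSEQ_le_const) auto
qed

section \<open>Borel representatives\<close>

text \<open>
  The Lebesgue measure is complete, so a function that agrees almost everywhere with a
  Borel function is measurable. This covers \<open>weak_gradient\<close>, about which nothing is known
  beyond almost everywhere equalities.
\<close>

lemma lebesgue_measurable_AE_eq_borel:
  fixes f :: "'a::euclidean_space \<Rightarrow> 'b::topological_space"
  assumes g: "g \<in> borel_measurable borel" and ae: "AE x in lborel. f x = g x"
  shows "f \<in> borel_measurable lebesgue"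
proof (rule measurableI)
  fix A :: "'b set"
  assume "A \<in> sets borel"
  with g have "g -` A \<in> sets borel"
    using measurable_sets[OF g, of A] by simp
  then have A: "g -` A \<in> sets lebesgue"
    by auto
  have "AE x in lebesgue. f x = g x"
    using ae by (rule AE_completion)
  then have "AE x in lebesgue. x \<in> g -` A \<longleftrightarrow> x \<in> f -` A"
    by eventually_elim auto
  then show "f -` A \<inter> space lebesgue \<in> sets lebesgue"
    using completion.in_sets_AE[OF _ A, of "f -` A"] by simp
qed simp

lemma
  fixes f :: "'a::euclidean_space \<Rightarrow> 'b::{banach, second_countable_topology}"
  assumes g: "g \<in> borel_measurable borel" and ae: "AE x in lborel. f x = g x"
  shows lebesgue_integral_AE_eq_borel: "(LINT x|lebesgue. f x) = (LINT x|lborel. g x)"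
    and lebesgue_integrable_AE_eq_borel: "integrable lebesgue f \<longleftrightarrow> integrable lborel g"
proof -
  have f: "f \<in> borel_measurable lebesgue"
    using assms by (rule lebesgue_measurable_AE_eq_borel)
  have g': "g \<in> borel_measurable lebesgue"
    using g by (auto intro: measurable_completion)
  have ae': "AE x in lebesgue. f x = g x"
    using ae by (rule AE_completion)
  have "(LINT x|lebesgue. f x) = (LINT x|lebesgue. g x)"
    using f g' ae' by (rule integral_cong_AE)
  then show "(LINT x|lebesgue. f x) = (LINT x|lborel. g x)"
    using g by (simp add: integral_completion)
  have "integrable lebesgue f \<longleftrightarrow> integrable lebesgue g"
    using f g' ae' by (rule integrable_cong_AE)
  then show "integrable lebesgue f \<longleftrightarrow> integrable lborel g"
    using g by (simp add: integrable_completion)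
qed

lemma lebesgue_ex_borel_representative:
  fixes f :: "'a::euclidean_space \<Rightarrow> 'b::euclidean_space"
  assumes "f \<in> borel_measurable lebesgue"
  obtains g where "g \<in> borel_measurable borel" "AE x in lborel. f x = g x"
proof -
  have "\<exists>g\<in>borel_measurable lborel. AE x in lborel. f x \<bullet> b = g x" for b
    using assms by (intro completion_ex_borel_measurable_real) auto
  then obtain G where G: "\<And>b. G b \<in> borel_measurable borel" "\<And>b. AE x in lborel. f x \<bullet> b = G b x"
    by (metis measurable_lborel2)
  let ?g = "\<lambda>x. \<Sum>b\<in>Basis. G b x *\<^sub>R b"
  have "AE x in lborel. \<forall>b\<in>Basis. f x \<bullet> b = G b x"
    using G(2) by (intro AE_finite_allI) auto
  then have "AE x in lborel. f x = ?g x"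
  proof eventually_elim
    case (elim x)
    have "f x = (\<Sum>b\<in>Basis. (f x \<bullet> b) *\<^sub>R b)"
      by (simp add: euclidean_representation)
    also have "\<dots> = ?g x"
      using elim by (intro sum.cong) auto
    finally show ?case .
  qed
  moreover have "?g \<in> borel_measurable borel"
    using G(1) by measurable
  ultimately show thesis
    using that by blast
qed

section \<open>Integration by parts\<close>

text \<open>
  Difference quotients of \<open>\<eta>\<close> have integral \<open>0\<close> by translation invariance, and they converge
  boundedly to the derivative.
\<close>

lemma integral_grad_compact_support:
  fixes \<eta> :: "'a::euclidean_space \<Rightarrow> real"
  assumes \<eta>: "Ck (Suc 0) \<eta>" and K: "compact K" "\<And>x. x \<notin> K \<Longrightarrow> \<eta> x = 0"
    "\<And>x. x \<notin> K \<Longrightarrow> grad \<eta> x = 0"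
  shows "(LINT x|lborel. grad \<eta> x) = 0"
proof (rule euclidean_eqI)
  fix v :: 'a
  assume v: "v \<in> Basis"
  have cont: "continuous_on UNIV \<eta>" "continuous_on UNIV (grad \<eta>)"
    using Ck_Suc_imp_Ck[OF \<eta>] continuous_on_grad[OF \<eta>] by auto
  have [measurable]: "\<eta> \<in> borel_measurable borel" "grad \<eta> \<in> borel_measurable borel"
    using cont by (auto intro: borel_measurable_continuous_onI)
  note int = integrable_continuous_compact_support[OF cont(1) K(1,2)]
    integrable_continuous_compact_support[OF cont(2) K(1,3)]
  obtain M where M: "0 \<le> M" "\<And>x. norm (grad \<eta> x) \<le> M"
    using bounded_continuous_compact_support[OF cont(2) K(1,3)] by blast
  obtain r where r: "\<And>x. x \<in> K \<Longrightarrow> norm x \<le> r"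
    using compact_imp_bounded[OF K(1)] by (auto simp: bounded_iff)
  have lip: "\<bar>\<eta> x - \<eta> y\<bar> \<le> M * norm (x - y)" for x y
  proof -
    have "norm (\<eta> x - \<eta> y) \<le> M * norm (x - y)"
    proof (rule differentiable_bound[OF convex_UNIV])
      show "(\<eta> has_derivative (\<lambda>h. grad \<eta> z \<bullet> h)) (at z)" for z
        by (rule Ck_grad_has_derivative[OF \<eta>])
      show "onorm (\<lambda>h. grad \<eta> z \<bullet> h) \<le> M" for z
      proof (rule onorm_le)
        fix h
        have "norm (grad \<eta> z \<bullet> h) \<le> norm (grad \<eta> z) * norm h"
          using Cauchy_Schwarz_ineq2[of "grad \<eta> z" h] by simp
        also have "\<dots> \<le> M * norm h"
          using M by (intro mult_right_mono) auto
        finally show "norm (grad \<eta> z \<bullet> h) \<le> M * norm h" .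
      qed
    qed auto
    then show ?thesis by simp
  qed
  define t where "t = (\<lambda>k. inverse (real (Suc k)))"
  have t: "0 < t k" "t k \<le> 1" for k
    by (auto simp: t_def field_simps)
  have t0: "t \<longlonglongrightarrow> 0"
    unfolding t_def by (rule LIMSEQ_inverse_real_of_nat)
  define q where "q = (\<lambda>k x. (\<eta> (t k *\<^sub>R v + x) - \<eta> x) / t k)"
  have "(\<lambda>k. LINT x|lborel. q k x) \<longlonglongrightarrow> (LINT x|lborel. grad \<eta> x \<bullet> v)"
  proof (rule integral_dominated_convergence)
    show "integrable lborel (\<lambda>x. M * indicator (cball (0::'a) (r + 1)) x)"
      using emeasure_lborel_cball_finite[of "0::'a" "r + 1"]
      by (intro integrable_mult_right integrable_real_indicator) (auto simp: less_top)
    show "AE x in lborel. norm (q k x) \<le> M * indicator (cball 0 (r + 1)) x" for k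
    proof (rule AE_I2)
      fix x
      show "norm (q k x) \<le> M * indicator (cball 0 (r + 1)) x"
      proof (cases "x \<in> cball 0 (r + 1)")
        case True
        have "\<bar>\<eta> (t k *\<^sub>R v + x) - \<eta> x\<bar> \<le> M * t k"
          using lip[of "t k *\<^sub>R v + x" x] t[of k] v by simp
        then show ?thesis
          using True t[of k] by (simp add: q_def field_simps)
      next
        case False
        then have x: "norm x > r + 1"
          by simp
        then have "norm (t k *\<^sub>R v + x) > r"
          using norm_diff_ineq[of x "t k *\<^sub>R v"] t[of k] v by (simp add: add.commute)
        then have "\<eta> (t k *\<^sub>R v + x) = 0" "\<eta> x = 0"
          using x r K(2) by force+
        then show ?thesis
          using False by (simp add: q_def)
      qed
    qed
    show "AE x in lborel. (\<lambda>k. q k x) \<longlonglongrightarrow> grad \<eta> x \<bullet> v"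
    proof (rule AE_I2)
      fix x
      have "((\<lambda>s. \<eta> (x + s *\<^sub>R v)) has_derivative (\<lambda>s. grad \<eta> x \<bullet> (s *\<^sub>R v))) (at 0)"
      proof -
        have "((\<lambda>s. x + s *\<^sub>R v) has_derivative (\<lambda>s. s *\<^sub>R v)) (at 0)"
          by (auto intro!: derivative_eq_intros)
        moreover have "(\<eta> has_derivative (\<lambda>h. grad \<eta> x \<bullet> h)) (at (x + 0 *\<^sub>R v))"
          using Ck_grad_has_derivative[OF \<eta>, of x] by simp
        ultimately show ?thesis
          using has_derivative_compose by blast
      qed
      then have "((\<lambda>s. \<eta> (x + s *\<^sub>R v)) has_real_derivative (grad \<eta> x \<bullet> v)) (at 0)"
        by (simp add: has_field_derivative_def mult.commute[of _ "grad \<eta> x \<bullet> v"])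
      then have "((\<lambda>s. (\<eta> (x + s *\<^sub>R v) - \<eta> x) / s) \<longlongrightarrow> grad \<eta> x \<bullet> v) (at 0)"
        by (simp add: DERIV_def)
      moreover have "filterlim t (at 0) sequentially"
        using t0 t by (auto simp: filterlim_at less_imp_neq[symmetric])
      ultimately have "((\<lambda>k. (\<eta> (x + t k *\<^sub>R v) - \<eta> x) / t k) \<longlongrightarrow> grad \<eta> x \<bullet> v) sequentially"
        by (rule filterlim_compose)
      then show "(\<lambda>k. q k x) \<longlonglongrightarrow> grad \<eta> x \<bullet> v"
        by (simp add: q_def add.commute)
    qed
  qed (auto simp: q_def)
  moreover have "(LINT x|lborel. q k x) = 0" for k
    using int(1) lborel_integrable_affine[OF int(1), of 1 "t k *\<^sub>R v"]
      lborel_integral_affine[of \<eta> 1 "t k *\<^sub>R v"] by (simp add: q_def)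
  ultimately have "(LINT x|lborel. grad \<eta> x \<bullet> v) = 0"
    by (simp add: LIMSEQ_const_iff)
  then show "(LINT x|lborel. grad \<eta> x) \<bullet> v = 0 \<bullet> v"
    using int(2) by simp
qed

lemma test_function_integration_by_parts:
  assumes \<phi>: "\<phi> \<in> test_functions UNIV" and \<psi>: "\<psi> \<in> test_functions UNIV"
  shows "(LINT x|lborel. \<phi> x *\<^sub>R grad \<psi> x) = - (LINT x|lborel. \<psi> x *\<^sub>R grad \<phi> x)"
proof -
  obtain K where K: "compact K" "\<And>x. x \<notin> K \<Longrightarrow> \<phi> x = 0" "\<And>x. x \<notin> K \<Longrightarrow> grad \<phi> x = 0"
    using test_function_support[OF \<phi>] by metis
  note cont = test_function_continuous[OF \<phi>] test_function_continuous[OF \<psi>]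
  have g: "grad (\<lambda>x. \<phi> x * \<psi> x) x = \<phi> x *\<^sub>R grad \<psi> x + \<psi> x *\<^sub>R grad \<phi> x" for x
  proof (rule grad_eqI)
    have "((\<lambda>x. \<phi> x * \<psi> x) has_derivative
        (\<lambda>h. \<phi> x * (grad \<psi> x \<bullet> h) + (grad \<phi> x \<bullet> h) * \<psi> x)) (at x)"
      by (intro has_derivative_mult Ck_grad_has_derivative test_function_Ck[OF \<phi>] test_function_Ck[OF \<psi>])
    then show "((\<lambda>x. \<phi> x * \<psi> x) has_derivative
        (\<lambda>h. (\<phi> x *\<^sub>R grad \<psi> x + \<psi> x *\<^sub>R grad \<phi> x) \<bullet> h)) (at x)"
      by (simp add: inner_add_left mult.commute)
  qed
  have "integrable lborel (\<lambda>x. \<phi> x *\<^sub>R grad \<psi> x)" "integrable lborel (\<lambda>x. \<psi> x *\<^sub>R grad \<phi> x)"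
    by (intro integrable_continuous_compact_support[OF _ K(1)], auto intro!: continuous_intros cont simp: K)+
  moreover have "(LINT x|lborel. grad (\<lambda>x. \<phi> x * \<psi> x) x) = 0"
    by (rule integral_grad_compact_support[OF _ K(1)])
      (auto simp: g K intro!: Ck_mult test_function_Ck[OF \<phi>] test_function_Ck[OF \<psi>] simp del: Ck.simps)
  ultimately show ?thesis
    by (simp add: g eq_neg_iff_add_eq_0)
qed

section \<open>Weak gradients\<close>

text \<open>
  In each coordinate, \<open>flat (j * (z - l)) * flat (j * (r - z))\<close> increases to the indicator of
  the interval from \<open>l\<close> to \<open>r\<close> as \<open>j\<close> grows.
\<close>

lemma box_bump_test_functions:
  fixes a b :: "'a::euclidean_space"
  obtains \<phi> :: "nat \<Rightarrow> 'a \<Rightarrow> real" where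
    "\<And>j \<Omega>. cbox a b \<subseteq> \<Omega> \<Longrightarrow> \<phi> j \<in> test_functions \<Omega>"
    "\<And>x j. 0 \<le> \<phi> j x" "\<And>x j. \<phi> j x \<le> indicator (box a b) x"
    "\<And>x. (\<lambda>j. \<phi> j x) \<longlonglongrightarrow> indicator (box a b) x"
proof
  define \<phi> where "\<phi> = (\<lambda>j x. \<Prod>i\<in>Basis.
      flat (x \<bullet> (real j *\<^sub>R i) + - real j * (a \<bullet> i)) *
      flat (x \<bullet> (- real j *\<^sub>R i) + real j * (b \<bullet> i)))"
  have eq: "\<phi> j x = (\<Prod>i\<in>Basis. flat (real j * (x \<bullet> i - a \<bullet> i)) * flat (real j * (b \<bullet> i - x \<bullet> i)))" for j x
    by (simp add: \<phi>_def algebra_simps)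
  show nonneg: "0 \<le> \<phi> j x" for x j
    unfolding \<phi>_def by (intro prod_nonneg mult_nonneg_nonneg flat_nonneg ballI)
  have zero: "\<phi> j x = 0" if "x \<notin> box a b" for j x
  proof -
    from that obtain i where i: "i \<in> Basis" "x \<bullet> i \<le> a \<bullet> i \<or> b \<bullet> i \<le> x \<bullet> i"
      by (auto simp: mem_box not_less)
    then have "flat (real j * (x \<bullet> i - a \<bullet> i)) * flat (real j * (b \<bullet> i - x \<bullet> i)) = 0"
      by (auto simp: flat_eq_0 mult_nonneg_nonpos)
    with i(1) show ?thesis
      unfolding eq by (intro prod_zero) auto
  qed
  show "\<phi> j x \<le> indicator (box a b) x" for j x
  proof (cases "x \<in> box a b")
    case True
    have "\<phi> j x \<le> 1"
      unfolding \<phi>_def by (intro prod_le_1 conjI mult_nonneg_nonneg flat_nonneg mult_le_one flat_le_1)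
    with True show ?thesis by simp
  qed (simp add: zero)
  show "(\<lambda>j. \<phi> j x) \<longlonglongrightarrow> indicator (box a b) x" for x
  proof (cases "x \<in> box a b")
    case True
    have lim: "(\<lambda>j. flat (real j * z)) \<longlonglongrightarrow> 1" if "0 < z" for z
    proof -
      have "(\<lambda>j. exp (- (inverse (real j) * (1 / z)))) \<longlonglongrightarrow> exp (- (0 * (1 / z)))"
        by (intro tendsto_intros lim_inverse_n)
      then have "(\<lambda>j. exp (- (inverse (real j) * (1 / z)))) \<longlonglongrightarrow> 1"
        by simp
      then show ?thesis
      proof (rule Lim_transform_eventually)
        show "\<forall>\<^sub>F j in sequentially. exp (- (inverse (real j) * (1 / z))) = flat (real j * z)"
          using eventually_gt_at_top[of 0]
        proof eventually_elim
          case (elim j)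
          then have "real j * z > 0"
            using that by simp
          then show ?case
            by (simp add: flat_def field_simps)
        qed
      qed
    qed
    have "(\<lambda>j. \<phi> j x) \<longlonglongrightarrow> (\<Prod>i\<in>(Basis::'a set). 1 * 1)"
      unfolding eq using True by (intro tendsto_prod tendsto_mult lim) (auto simp: mem_box)
    then show ?thesis
      using True by simp
  qed (simp add: zero)
  show "\<phi> j \<in> test_functions \<Omega>" if "cbox a b \<subseteq> \<Omega>" for j \<Omega>
  proof -
    have "closure {x. \<phi> j x \<noteq> 0} \<subseteq> cbox a b"
      using zero box_subset_cbox by (intro closure_minimal) blast+
    moreover from this have "compact (closure {x. \<phi> j x \<noteq> 0})"
      using bounded_subset[OF bounded_cbox] by (simp add: compact_eq_bounded_closed)
    moreover have "Ck k (\<phi> j)" for k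
      unfolding \<phi>_def by (intro Ck_prod Ck_mult Ck_compose_real[OF Ck_flat Ck_inner])
    ultimately show ?thesis
      using that by (auto simp: test_functions_def)
  qed
qed

text \<open>
  Boxes are closed under intersection and generate the Borel sets, so the integral over
  every Borel set vanishes.
\<close>

lemma AE_zero_if_box_integrals_zero:
  fixes h :: "'a::euclidean_space \<Rightarrow> 'b::{banach, second_countable_topology}"
  assumes h: "integrable lborel h" and box: "\<And>a b. (LINT x:box a b|lborel. h x) = 0"
  shows "AE x in lborel. h x = 0"
proof (rule sigma_finite_measure.density_zero[OF sigma_finite_lborel h])
  let ?G = "range (\<lambda>(a, b). box a b :: 'a set)"
  have si: "set_integrable lborel A h" if "A \<in> sets borel" for A
    using h that unfolding set_integrable_def by (intro integrable_mult_indicator) auto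
  have total: "(LINT x|lborel. h x) = 0"
  proof -
    have "(\<lambda>n. LINT x:box (- real n *\<^sub>R One) (real n *\<^sub>R One)|lborel. h x)
        \<longlonglongrightarrow> (LINT x:(\<Union>n. box (- real n *\<^sub>R One) (real n *\<^sub>R One))|lborel. h x)"
      using h by (intro set_integral_cont_up si)
        (auto simp: incseq_def intro!: subset_box_imp)
    then show ?thesis
      using box by (simp add: UN_box_eq_UNIV set_lebesgue_integral_def LIMSEQ_const_iff)
  qed
  fix A :: "'a set"
  assume "A \<in> sets lborel"
  then have A: "A \<in> sigma_sets UNIV ?G"
    by (simp add: borel_eq_box)
  have "Int_stable ?G"
    by (auto simp: Int_stable_def box_Int_box)
  moreover have "?G \<subseteq> Pow UNIV"
    by simp
  ultimately show "(LINT x:A|lborel. h x) = 0"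
    using A
  proof (induction rule: sigma_sets_induct_disjoint)
    case (basic A)
    then show ?case using box by auto
  next
    case empty
    then show ?case by (simp add: set_lebesgue_integral_def)
  next
    case (compl A)
    then have [measurable]: "A \<in> sets borel"
      by (simp add: borel_eq_box)
    have "(LINT x:UNIV|lborel. h x) = (LINT x:A|lborel. h x) + (LINT x:UNIV - A|lborel. h x)"
      using set_integral_Un[of A "UNIV - A" lborel h] si by auto
    then show ?case
      using compl total by (simp add: set_lebesgue_integral_def)
  next
    case (union A)
    then have [measurable]: "A i \<in> sets borel" for i
      by (auto simp: borel_eq_box)
    have "(LINT x:(\<Union>i. A i)|lborel. h x) = (\<Sum>i. LINT x:A i|lborel. h x)"
      using union(1) by (intro lebesgue_integral_countable_add si) (auto simp: disjoint_family_on_def)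
    then show ?case
      using union by simp
  qed
qed

lemma AE_lborel_not_in_cbox_boundary: "AE x in lborel. x \<notin> cbox a b - box a b"
proof -
  have "AE x in lebesgue. x \<notin> cbox a b - box a b"
    using negligible_frontier_interval[of a b]
    by (intro AE_not_in) (simp add: negligible_iff_null_sets)
  then show ?thesis
    by (simp add: AE_completion_iff)
qed

text \<open>
  The difference of two weak gradients is annihilated by all test functions, hence by the
  indicators of boxes whose closure lies in \<open>\<Omega>\<close>. Such boxes cover \<open>\<Omega>\<close> countably often, and
  their boundaries are null sets.
\<close>

lemma weak_gradient_unique:
  fixes \<Omega> :: "'a::euclidean_space set"
  assumes "open \<Omega>" and g1: "has_weak_gradient \<Omega> u g1" and g2: "has_weak_gradient \<Omega> u g2"
  shows "AE x in lborel. x \<in> \<Omega> \<longrightarrow> g1 x = g2 x"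
proof -
  have cb: "AE x in lborel. x \<in> cbox a b \<longrightarrow> g1 x = g2 x" if sub: "cbox a b \<subseteq> \<Omega>" for a b
  proof -
    have gi: "set_integrable lebesgue (cbox a b) g1" "set_integrable lebesgue (cbox a b) g2"
      using g1 g2 sub by (auto simp: has_weak_gradient_def locally_integrable_on_def)
    have sb: "box a b \<subseteq> cbox a b" by (rule box_subset_cbox)
    define f where "f = (\<lambda>x. indicator (cbox a b) x *\<^sub>R g1 x - indicator (cbox a b) x *\<^sub>R g2 x)"
    have f: "integrable lebesgue f"
      using gi unfolding f_def set_integrable_def by (intro Bochner_Integration.integrable_diff)
    obtain h where h: "h \<in> borel_measurable borel" and fh: "AE x in lborel. f x = h x"
      by (rule lebesgue_ex_borel_representative[OF borel_measurable_integrable[OF f]])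
    have ih: "integrable lborel h"
      using f lebesgue_integrable_AE_eq_borel[OF h fh] by simp
    have "AE x in lborel. indicator (box a b) x *\<^sub>R h x = 0"
    proof (rule AE_zero_if_box_integrals_zero)
      show "integrable lborel (\<lambda>x. indicator (box a b) x *\<^sub>R h x)"
        using ih by (intro integrable_mult_indicator) auto
    next
      fix c d
      define c' where "c' = (\<Sum>i\<in>Basis. max (c \<bullet> i) (a \<bullet> i) *\<^sub>R i)"
      define d' where "d' = (\<Sum>i\<in>Basis. min (d \<bullet> i) (b \<bullet> i) *\<^sub>R i)"
      have box': "box c d \<inter> box a b = box c' d'"
        by (simp add: box_Int_box c'_def d'_def)
      have cbox': "cbox c' d' \<subseteq> cbox a b"
        by (auto simp: mem_box c'_def d'_def)
      have sb': "box c' d' \<subseteq> cbox a b"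
        using cbox' box_subset_cbox by blast
      obtain \<phi> :: "nat \<Rightarrow> 'a \<Rightarrow> real" where \<phi>: "\<And>j. \<phi> j \<in> test_functions \<Omega>"
        "\<And>x j. 0 \<le> \<phi> j x" "\<And>x j. \<phi> j x \<le> indicator (box c' d') x"
        "\<And>x. (\<lambda>j. \<phi> j x) \<longlonglongrightarrow> indicator (box c' d') x"
        using box_bump_test_functions[of c' d'] cbox' sub by (metis subset_trans)
      have [measurable]: "\<phi> j \<in> borel_measurable lebesgue" for j
        using test_function_measurable[OF \<phi>(1)] by (auto intro: measurable_completion)
      have \<phi>_le: "\<phi> j x \<le> 1" for j x
        using \<phi>(3)[of j x] by (rule order_trans) (auto simp: indicator_def)
      have \<phi>_0: "\<phi> j x = 0" if "x \<notin> cbox a b" for j x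
      proof -
        have "x \<notin> box c' d'"
          using that sb' by blast
        then show ?thesis
          using \<phi>(2)[of j x] \<phi>(3)[of j x] by simp
      qed
      have zero: "(LINT x|lebesgue. \<phi> j x *\<^sub>R f x) = 0" for j
      proof -
        have int: "integrable lebesgue (\<lambda>x. \<phi> j x *\<^sub>R (indicator (cbox a b) x *\<^sub>R g x))"
          if "set_integrable lebesgue (cbox a b) g" for g :: "'a \<Rightarrow> 'a"
        proof (rule Bochner_Integration.integrable_bound)
          show "integrable lebesgue (\<lambda>x. indicator (cbox a b) x *\<^sub>R g x)"
            using that by (simp add: set_integrable_def)
          then have [measurable]: "(\<lambda>x. indicator (cbox a b) x *\<^sub>R g x) \<in> borel_measurable lebesgue"
            by auto
          show "(\<lambda>x. \<phi> j x *\<^sub>R (indicator (cbox a b) x *\<^sub>R g x)) \<in> borel_measurable lebesgue"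
            by measurable
          show "AE x in lebesgue. norm (\<phi> j x *\<^sub>R (indicator (cbox a b) x *\<^sub>R g x))
              \<le> norm (indicator (cbox a b) x *\<^sub>R g x)"
            using \<phi>(2) \<phi>_le by (intro AE_I2) (auto intro!: mult_right_mono mult_left_le_one_le)
        qed
        have eq: "indicator \<Omega> x * \<phi> j x = \<phi> j x * indicator (cbox a b) x" for x
          using \<phi>_0 sub by (auto simp: indicator_def)
        have "(LINT x:\<Omega>|lebesgue. \<phi> j x *\<^sub>R g1 x) = (LINT x:\<Omega>|lebesgue. \<phi> j x *\<^sub>R g2 x)"
          using g1 g2 \<phi>(1)[of j] unfolding has_weak_gradient_def by (metis neg_equal_iff_equal)
        then show ?thesis
          using int[OF gi(1)] int[OF gi(2)]
          by (simp add: set_lebesgue_integral_def eq f_def scaleR_diff_right)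
      qed
      have "(\<lambda>j. LINT x|lebesgue. \<phi> j x *\<^sub>R f x) \<longlonglongrightarrow> (LINT x|lebesgue. indicator (box c' d') x *\<^sub>R f x)"
      proof (rule integral_dominated_convergence)
        show "integrable lebesgue (\<lambda>x. norm (f x))"
          using f by simp
        show "AE x in lebesgue. (\<lambda>j. \<phi> j x *\<^sub>R f x) \<longlonglongrightarrow> indicator (box c' d') x *\<^sub>R f x"
          using \<phi>(4) by (intro AE_I2 tendsto_scaleR tendsto_const) auto
        show "AE x in lebesgue. norm (\<phi> j x *\<^sub>R f x) \<le> norm (f x)" for j
          using \<phi>(2) \<phi>_le by (intro AE_I2) (auto intro: mult_left_le_one_le)
        have [measurable]: "f \<in> borel_measurable lebesgue"
          using f by auto
        have [measurable]: "box c' d' \<in> sets lebesgue"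
          by simp
        show "(\<lambda>x. indicator (box c' d') x *\<^sub>R f x) \<in> borel_measurable lebesgue"
          "(\<lambda>x. \<phi> j x *\<^sub>R f x) \<in> borel_measurable lebesgue" for j
          by measurable
      qed
      then have "(LINT x|lebesgue. indicator (box c' d') x *\<^sub>R f x) = 0"
        by (simp add: zero LIMSEQ_const_iff)
      also have "(LINT x|lebesgue. indicator (box c' d') x *\<^sub>R f x) = (LINT x|lborel. indicator (box c' d') x *\<^sub>R h x)"
        using h fh by (intro lebesgue_integral_AE_eq_borel) auto
      also have "\<dots> = (LINT x:box c d|lborel. indicator (box a b) x *\<^sub>R h x)"
        unfolding box'[symmetric] by (simp add: set_lebesgue_integral_def indicator_inter_arith)
      finally show "(LINT x:box c d|lborel. indicator (box a b) x *\<^sub>R h x) = 0" .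
    qed
    then show ?thesis
      using fh AE_lborel_not_in_cbox_boundary[of a b]
    proof eventually_elim
      case (elim x)
      then show ?case
        by (auto simp: f_def indicator_def split: if_splits)
    qed
  qed
  obtain \<D> where D: "countable \<D>" "\<D> \<subseteq> Pow \<Omega>" "\<And>X. X \<in> \<D> \<Longrightarrow> \<exists>a b. X = cbox a b" "\<Union>\<D> = \<Omega>"
    using open_countable_Union_open_cbox[OF assms(1)] by metis
  have "AE x in lborel. \<forall>X\<in>\<D>. x \<in> X \<longrightarrow> g1 x = g2 x"
  proof (rule AE_ball_countable'[OF _ D(1)])
    fix X assume "X \<in> \<D>"
    with D(2,3) cb show "AE x in lborel. x \<in> X \<longrightarrow> g1 x = g2 x"
      by (metis PowD subsetD)
  qed
  then show ?thesis
    by eventually_elim (use D(4) in blast)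
qed

lemma l2sq_Cauchy_Schwarz:
  fixes f :: "'a::euclidean_space \<Rightarrow> real" and g :: "'a \<Rightarrow> 'b::euclidean_space"
  assumes [measurable]: "f \<in> borel_measurable borel" "g \<in> borel_measurable borel"
    and fin: "l2sq f < \<infinity>" "l2sq g < \<infinity>"
  shows "integrable lborel (\<lambda>x. f x *\<^sub>R g x)"
    and "ennreal ((norm (LINT x|lborel. f x *\<^sub>R g x))\<^sup>2) \<le> l2sq f * l2sq g"
proof -
  have "(\<integral>\<^sup>+x. ennreal (norm (f x *\<^sub>R g x)) \<partial>lborel)\<^sup>2 =
      (\<integral>\<^sup>+x. ennreal (norm (f x)) * ennreal (norm (g x)) \<partial>lborel)\<^sup>2"
    by (simp add: ennreal_mult)
  also have "\<dots> \<le> (\<integral>\<^sup>+x. (ennreal (norm (f x)))\<^sup>2 \<partial>lborel) * (\<integral>\<^sup>+x. (ennreal (norm (g x)))\<^sup>2 \<partial>lborel)"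
    by (intro Cauchy_Schwarz_nn_integral) auto
  also have "\<dots> = l2sq f * l2sq g"
    by (simp add: l2sq_def ennreal_power)
  finally have CS: "(\<integral>\<^sup>+x. ennreal (norm (f x *\<^sub>R g x)) \<partial>lborel)\<^sup>2 \<le> l2sq f * l2sq g" .
  also have "\<dots> < \<infinity>"
    using fin by (simp add: ennreal_mult_less_top)
  finally have "(\<integral>\<^sup>+x. ennreal (norm (f x *\<^sub>R g x)) \<partial>lborel) < \<infinity>"
    by (simp add: power_less_top_ennreal)
  then show i: "integrable lborel (\<lambda>x. f x *\<^sub>R g x)"
    by (intro integrableI_bounded) auto
  have "ennreal ((norm (LINT x|lborel. f x *\<^sub>R g x))\<^sup>2) = (ennreal (norm (LINT x|lborel. f x *\<^sub>R g x)))\<^sup>2"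
    by (simp add: ennreal_power)
  also have "\<dots> \<le> (\<integral>\<^sup>+x. ennreal (norm (f x *\<^sub>R g x)) \<partial>lborel)\<^sup>2"
    using i by (intro power_mono integral_norm_bound_ennreal) auto
  also note CS
  finally show "ennreal ((norm (LINT x|lborel. f x *\<^sub>R g x))\<^sup>2) \<le> l2sq f * l2sq g" .
qed

lemma H10_pair_integration_by_parts:
  assumes uG: "H10_pair \<Omega> u G" and \<psi>: "\<psi> \<in> test_functions UNIV"
  shows "(LINT x|lborel. u x *\<^sub>R grad \<psi> x) = - (LINT x|lborel. \<psi> x *\<^sub>R G x)"
proof -
  note [measurable] = H10_pair_measurable[OF uG] test_function_measurable[OF \<psi>]
  note fin = H10_pair_finite[OF uG] l2sq_test_function[OF \<psi>]
  obtain \<phi> where \<phi>: "\<And>k. \<phi> k \<in> test_functions \<Omega>" "(\<lambda>k. l2sq (\<lambda>x. \<phi> k x - u x)) \<longlonglongrightarrow> 0"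
    "(\<lambda>k. l2sq (\<lambda>x. grad (\<phi> k) x - G x)) \<longlonglongrightarrow> 0"
    using H10_pairE[OF uG] by blast
  note [measurable] = test_function_measurable[OF \<phi>(1)]
  define D where "D = (LINT x|lborel. u x *\<^sub>R grad \<psi> x) + (LINT x|lborel. \<psi> x *\<^sub>R G x)"
  have est: "ennreal ((norm D)\<^sup>2) \<le> 2 * (l2sq (grad \<psi>) * l2sq (\<lambda>x. \<phi> k x - u x)) +
      2 * (l2sq \<psi> * l2sq (\<lambda>x. grad (\<phi> k) x - G x))" for k
  proof -
    note fk = l2sq_test_function[OF \<phi>(1)[of k]]
    have "\<phi> k \<in> test_functions UNIV"
      using \<phi>(1) test_functions_mono by blast
    note ibp = test_function_integration_by_parts[OF this \<psi>]
    have fd: "l2sq (\<lambda>x. \<phi> k x - u x) < \<infinity>" "l2sq (\<lambda>x. grad (\<phi> k) x - G x) < \<infinity>"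
      using fin fk by (auto intro!: le_less_trans[OF l2sq_diff] simp: ennreal_mult_less_top)
    let ?A = "LINT x|lborel. (\<phi> k x - u x) *\<^sub>R grad \<psi> x"
    let ?B = "LINT x|lborel. \<psi> x *\<^sub>R (grad (\<phi> k) x - G x)"
    have "?A = (LINT x|lborel. \<phi> k x *\<^sub>R grad \<psi> x) - (LINT x|lborel. u x *\<^sub>R grad \<psi> x)"
      unfolding scaleR_diff_left
      by (intro Bochner_Integration.integral_diff l2sq_Cauchy_Schwarz(1) fin fk) measurable
    moreover have "?B = (LINT x|lborel. \<psi> x *\<^sub>R grad (\<phi> k) x) - (LINT x|lborel. \<psi> x *\<^sub>R G x)"
      unfolding scaleR_diff_right
      by (intro Bochner_Integration.integral_diff l2sq_Cauchy_Schwarz(1) fin fk) measurable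
    ultimately have "D = - (?A + ?B)"
      using ibp by (simp add: D_def)
    then have "(norm D)\<^sup>2 \<le> 2 * (norm ?A)\<^sup>2 + 2 * (norm ?B)\<^sup>2"
      using norm_add_sq_le[of ?A ?B] by (simp only: norm_minus_cancel)
    then have "ennreal ((norm D)\<^sup>2) \<le> ennreal (2 * (norm ?A)\<^sup>2 + 2 * (norm ?B)\<^sup>2)"
      by (rule ennreal_leI)
    also have "\<dots> = 2 * ennreal ((norm ?A)\<^sup>2) + 2 * ennreal ((norm ?B)\<^sup>2)"
      by (simp add: ennreal_mult)
    also have "\<dots> \<le> 2 * (l2sq (grad \<psi>) * l2sq (\<lambda>x. \<phi> k x - u x)) +
      2 * (l2sq \<psi> * l2sq (\<lambda>x. grad (\<phi> k) x - G x))"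
      using l2sq_Cauchy_Schwarz(2)[of "\<lambda>x. \<phi> k x - u x" "grad \<psi>"]
        l2sq_Cauchy_Schwarz(2)[of \<psi> "\<lambda>x. grad (\<phi> k) x - G x"] fd fin
      by (intro add_mono mult_left_mono) (auto simp: mult.commute)
    finally show ?thesis .
  qed
  have "(\<lambda>k. 2 * (l2sq (grad \<psi>) * l2sq (\<lambda>x. \<phi> k x - u x)) +
      2 * (l2sq \<psi> * l2sq (\<lambda>x. grad (\<phi> k) x - G x)))
    \<longlonglongrightarrow> 2 * (l2sq (grad \<psi>) * 0) + 2 * (l2sq \<psi> * 0)"
    using \<phi>(2,3) fin
    by (intro tendsto_add ennreal_tendsto_cmult) auto
  then have "ennreal ((norm D)\<^sup>2) \<le> 2 * (l2sq (grad \<psi>) * 0) + 2 * (l2sq \<psi> * 0)"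
    using est by (intro LIMSEQ_le_const) auto
  then show ?thesis
    by (simp add: D_def eq_neg_iff_add_eq_0)
qed

lemma l2sq_imp_locally_integrable:
  fixes f :: "'a::euclidean_space \<Rightarrow> 'b::euclidean_space"
  assumes [measurable]: "f \<in> borel_measurable borel" and fin: "l2sq f < \<infinity>"
    and ae: "AE x in lborel. f' x = f x"
  shows "locally_integrable_on \<Omega> f'"
  unfolding locally_integrable_on_def
proof (intro allI impI)
  fix K :: "'a set"
  assume K: "compact K \<and> K \<subseteq> \<Omega>"
  then have [measurable]: "K \<in> sets borel"
    by (auto intro: borel_compact)
  have "integrable lborel (\<lambda>x. indicator K x *\<^sub>R f x)"
  proof (rule Bochner_Integration.integrable_bound)
    show "integrable lborel (\<lambda>x. indicator K x + (norm (f x))\<^sup>2)"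
      using K l2sq_integral(1)[OF assms(1,2)] emeasure_bounded_finite[of K] compact_imp_bounded[of K]
      by (intro Bochner_Integration.integrable_add integrable_real_indicator) auto
    show "AE x in lborel. norm (indicator K x *\<^sub>R f x) \<le> norm (indicator K x + (norm (f x))\<^sup>2)"
    proof (rule AE_I2)
      fix x
      have "norm (f x) \<le> 1 + (norm (f x))\<^sup>2"
        using zero_le_power2[of "norm (f x) - 1"] norm_ge_zero[of "f x"]
        unfolding power2_diff by (smt (verit) power_one)
      then show "norm (indicator K x *\<^sub>R f x) \<le> norm (indicator K x + (norm (f x))\<^sup>2)"
        by (auto simp: indicator_def)
    qed
  qed simp
  moreover have "AE x in lborel. indicator K x *\<^sub>R f' x = indicator K x *\<^sub>R f x"
    using ae by eventually_elim simp
  ultimately show "set_integrable lebesgue K f'"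
    unfolding set_integrable_def
    by (subst lebesgue_integrable_AE_eq_borel[where g = "\<lambda>x. indicator K x *\<^sub>R f x"]) auto
qed

text \<open>
  The domain \<open>\<Omega>'\<close> is arbitrary: it will be both \<open>\<Omega>\<close>, as needed for \<open>H10\<close>, and the whole
  space, as needed for \<open>local_form\<close>.
\<close>

lemma H10_pair_has_weak_gradient:
  assumes uG: "H10_pair \<Omega> u G" and ae: "AE x in lborel. u' x = u x"
  shows "has_weak_gradient \<Omega>' u' G"
  unfolding has_weak_gradient_def
proof (intro conjI ballI)
  note [measurable] = H10_pair_measurable[OF uG]
  note fin = H10_pair_finite[OF uG]
  show "locally_integrable_on \<Omega>' u'"
    using ae fin by (intro l2sq_imp_locally_integrable[where f = u]) auto
  show "locally_integrable_on \<Omega>' G"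
    using fin by (intro l2sq_imp_locally_integrable[where f = G]) auto
  fix \<psi> :: "'a \<Rightarrow> real"
  assume \<psi>: "\<psi> \<in> test_functions \<Omega>'"
  then have \<psi>': "\<psi> \<in> test_functions UNIV"
    using test_functions_mono by blast
  note [measurable] = test_function_measurable[OF \<psi>]
  have "(LINT x:\<Omega>'|lebesgue. u' x *\<^sub>R grad \<psi> x) = (LINT x|lebesgue. u' x *\<^sub>R grad \<psi> x)"
    unfolding set_lebesgue_integral_def using grad_test_function_eq_0[OF \<psi>]
    by (intro Bochner_Integration.integral_cong) (auto simp: indicator_def)
  also have "\<dots> = (LINT x|lborel. u x *\<^sub>R grad \<psi> x)"
    using ae by (intro lebesgue_integral_AE_eq_borel) auto
  also have "\<dots> = - (LINT x|lborel. \<psi> x *\<^sub>R G x)"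
    by (rule H10_pair_integration_by_parts[OF uG \<psi>'])
  also have "(LINT x|lborel. \<psi> x *\<^sub>R G x) = (LINT x|lebesgue. \<psi> x *\<^sub>R G x)"
    by (intro lebesgue_integral_AE_eq_borel[symmetric]) auto
  also have "\<dots> = (LINT x:\<Omega>'|lebesgue. \<psi> x *\<^sub>R G x)"
    unfolding set_lebesgue_integral_def using test_function_eq_0[OF \<psi>]
    by (intro Bochner_Integration.integral_cong) (auto simp: indicator_def)
  finally show "(LINT x:\<Omega>'|lebesgue. u' x *\<^sub>R grad \<psi> x) = - (LINT x:\<Omega>'|lebesgue. \<psi> x *\<^sub>R G x)" .
qed

lemma weak_gradient_eq:
  assumes "open \<Omega>'" "has_weak_gradient \<Omega>' u g"
  shows "AE x in lborel. x \<in> \<Omega>' \<longrightarrow> weak_gradient \<Omega>' u x = g x"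
proof (rule weak_gradient_unique[OF assms(1) _ assms(2)])
  show "has_weak_gradient \<Omega>' u (weak_gradient \<Omega>' u)"
    unfolding weak_gradient_def using assms(2) by (rule someI[where P = "has_weak_gradient \<Omega>' u"])
qed

lemma l2sq_limit_zero_outside:
  fixes f :: "nat \<Rightarrow> 'a::euclidean_space \<Rightarrow> 'b::euclidean_space"
  assumes "(\<lambda>k. l2sq (\<lambda>x. f k x - g x)) \<longlonglongrightarrow> 0" "\<And>k x. x \<notin> \<Omega> \<Longrightarrow> f k x = 0"
    and [measurable]: "g \<in> borel_measurable borel" "\<Omega> \<in> sets borel"
  shows "AE x in lborel. x \<notin> \<Omega> \<longrightarrow> g x = 0"
proof -
  have "l2sq (\<lambda>x. indicator (- \<Omega>) x *\<^sub>R g x) \<le> l2sq (\<lambda>x. f k x - g x)" for k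
    using assms(2) by (intro l2sq_mono_AE AE_I2) (auto simp: indicator_def)
  then have "l2sq (\<lambda>x. indicator (- \<Omega>) x *\<^sub>R g x) \<le> 0"
    using assms(1) by (intro LIMSEQ_le_const) auto
  then have "AE x in lborel. ennreal ((norm (indicator (- \<Omega>) x *\<^sub>R g x))\<^sup>2) = 0"
    unfolding l2sq_def by (subst nn_integral_0_iff_AE[symmetric]) auto
  then show ?thesis
    by eventually_elim (auto simp: indicator_def split: if_splits)
qed

lemma H10_pair_zero_outside:
  assumes uG: "H10_pair \<Omega> u G" and "open \<Omega>"
  shows "AE x in lborel. x \<notin> \<Omega> \<longrightarrow> u x = 0" "AE x in lborel. x \<notin> \<Omega> \<longrightarrow> G x = 0"
proof -
  note [measurable] = H10_pair_measurable[OF uG]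
  have [measurable]: "\<Omega> \<in> sets borel"
    using \<open>open \<Omega>\<close> by simp
  obtain \<phi> where \<phi>: "\<And>k. \<phi> k \<in> test_functions \<Omega>" "(\<lambda>k. l2sq (\<lambda>x. \<phi> k x - u x)) \<longlonglongrightarrow> 0"
    "(\<lambda>k. l2sq (\<lambda>x. grad (\<phi> k) x - G x)) \<longlonglongrightarrow> 0"
    using H10_pairE[OF uG] by blast
  show "AE x in lborel. x \<notin> \<Omega> \<longrightarrow> u x = 0" "AE x in lborel. x \<notin> \<Omega> \<longrightarrow> G x = 0"
    using l2sq_limit_zero_outside[OF \<phi>(2)] l2sq_limit_zero_outside[OF \<phi>(3)]
      test_function_eq_0[OF \<phi>(1)] grad_test_function_eq_0[OF \<phi>(1)] by auto
qed


section \<open>The function space of the problem\<close>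

lemma
  fixes f :: "'a::euclidean_space \<Rightarrow> 'b::euclidean_space"
  assumes [measurable]: "f \<in> borel_measurable borel" "\<Omega> \<in> sets borel"
    and fin: "l2sq f < \<infinity>" and ae: "AE x in lborel. x \<in> \<Omega> \<longrightarrow> f' x = f x"
  shows l2sq_imp_L2: "f' \<in> L2 \<Omega>"
    and set_integral_le_l2sq: "(LINT x:\<Omega>|lebesgue. (norm (f' x))\<^sup>2) \<le> enn2real (l2sq f)"
proof -
  have ae1: "AE x in lborel. indicator \<Omega> x *\<^sub>R f' x = indicator \<Omega> x *\<^sub>R f x"
    using ae by eventually_elim (auto simp: indicator_def)
  have ae2: "AE x in lborel. indicator \<Omega> x *\<^sub>R (norm (f' x))\<^sup>2 = indicator \<Omega> x *\<^sub>R (norm (f x))\<^sup>2"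
    using ae by eventually_elim (auto simp: indicator_def)
  note int = l2sq_integral[OF assms(1) fin]
  have int': "integrable lborel (\<lambda>x. indicator \<Omega> x *\<^sub>R (norm (f x))\<^sup>2)"
    using int(1) by (intro integrable_mult_indicator) auto
  have "(\<lambda>x. indicator \<Omega> x *\<^sub>R f' x) \<in> borel_measurable lebesgue"
    using ae1 by (rule lebesgue_measurable_AE_eq_borel[rotated]) measurable
  moreover have "integrable lebesgue (\<lambda>x. indicator \<Omega> x *\<^sub>R (norm (f' x))\<^sup>2)"
    using int' by (subst lebesgue_integrable_AE_eq_borel[OF _ ae2]) auto
  ultimately show "f' \<in> L2 \<Omega>"
    by (simp add: L2_def set_borel_measurable_def set_integrable_def)
  have "(LINT x:\<Omega>|lebesgue. (norm (f' x))\<^sup>2) = (LINT x|lborel. indicator \<Omega> x *\<^sub>R (norm (f x))\<^sup>2)"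
    unfolding set_lebesgue_integral_def by (rule lebesgue_integral_AE_eq_borel[OF _ ae2]) measurable
  also have "\<dots> \<le> (LINT x|lborel. (norm (f x))\<^sup>2)"
    using int int' by (intro integral_mono) (auto simp: indicator_def)
  also have "\<dots> = enn2real (l2sq f)"
    by (simp add: int(2))
  finally show "(LINT x:\<Omega>|lebesgue. (norm (f' x))\<^sup>2) \<le> enn2real (l2sq f)" .
qed

lemma H10_pair_in_H1:
  assumes "H10_pair \<Omega> u G" "\<Omega>' \<in> sets borel"
  shows "u \<in> H1 \<Omega>'"
proof -
  have "u \<in> L2 \<Omega>'" "G \<in> L2 \<Omega>'"
    using l2sq_imp_L2[OF H10_pair_measurable(1)[OF assms(1)] assms(2) H10_pair_finite(1)[OF assms(1)]]
      l2sq_imp_L2[OF H10_pair_measurable(2)[OF assms(1)] assms(2) H10_pair_finite(2)[OF assms(1)]]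
    by auto
  then show ?thesis
    using H10_pair_has_weak_gradient[OF assms(1), of u] by (auto simp: H1_def)
qed

lemma H10_pair_in_X12:
  assumes uG: "H10_pair \<Omega> u G" and "open \<Omega>"
  shows "u \<in> X12 \<Omega>"
proof -
  note [measurable] = H10_pair_measurable[OF uG]
  note fin = H10_pair_finite[OF uG]
  have [measurable]: "\<Omega> \<in> sets borel"
    using \<open>open \<Omega>\<close> by simp
  obtain \<phi> where \<phi>: "\<And>k. \<phi> k \<in> test_functions \<Omega>" "(\<lambda>k. l2sq (\<lambda>x. \<phi> k x - u x)) \<longlonglongrightarrow> 0"
    "(\<lambda>k. l2sq (\<lambda>x. grad (\<phi> k) x - G x)) \<longlonglongrightarrow> 0"
    using H10_pairE[OF uG] by blast
  note [measurable] = test_function_measurable[OF \<phi>(1)]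
  have wg: "AE x in lborel. x \<in> \<Omega> \<longrightarrow> weak_gradient \<Omega> u x = G x"
    using H10_pair_has_weak_gradient[OF uG] by (intro weak_gradient_eq \<open>open \<Omega>\<close>) auto
  have fd: "l2sq (\<lambda>x. \<phi> k x - u x) < \<infinity>" "l2sq (\<lambda>x. grad (\<phi> k) x - G x) < \<infinity>" for k
    using fin l2sq_test_function[OF \<phi>(1)[of k]]
    by (auto intro!: le_less_trans[OF l2sq_diff] simp: ennreal_mult_less_top)
  have "(\<lambda>k. (LINT x:\<Omega>|lebesgue. (\<phi> k x - u x)\<^sup>2) +
      (LINT x:\<Omega>|lebesgue. (norm (grad (\<phi> k) x - weak_gradient \<Omega> u x))\<^sup>2)) \<longlonglongrightarrow> 0"
  proof (rule tendsto_sandwich)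
    show "\<forall>\<^sub>F k in sequentially. 0 \<le> (LINT x:\<Omega>|lebesgue. (\<phi> k x - u x)\<^sup>2) +
        (LINT x:\<Omega>|lebesgue. (norm (grad (\<phi> k) x - weak_gradient \<Omega> u x))\<^sup>2)"
      by (intro always_eventually allI add_nonneg_nonneg)
        (auto simp: set_lebesgue_integral_def intro!: Bochner_Integration.integral_nonneg)
    show "\<forall>\<^sub>F k in sequentially. (LINT x:\<Omega>|lebesgue. (\<phi> k x - u x)\<^sup>2) +
        (LINT x:\<Omega>|lebesgue. (norm (grad (\<phi> k) x - weak_gradient \<Omega> u x))\<^sup>2) \<le>
        enn2real (l2sq (\<lambda>x. \<phi> k x - u x)) + enn2real (l2sq (\<lambda>x. grad (\<phi> k) x - G x))"
    proof (intro always_eventually allI add_mono)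
      fix k
      show "(LINT x:\<Omega>|lebesgue. (\<phi> k x - u x)\<^sup>2) \<le> enn2real (l2sq (\<lambda>x. \<phi> k x - u x))"
        using set_integral_le_l2sq[of "\<lambda>x. \<phi> k x - u x" \<Omega> "\<lambda>x. \<phi> k x - u x"] fd by simp
      show "(LINT x:\<Omega>|lebesgue. (norm (grad (\<phi> k) x - weak_gradient \<Omega> u x))\<^sup>2)
          \<le> enn2real (l2sq (\<lambda>x. grad (\<phi> k) x - G x))"
        by (rule set_integral_le_l2sq) (use fd wg in auto)
    qed
    have "(\<lambda>k. enn2real (l2sq (\<lambda>x. \<phi> k x - u x)) + enn2real (l2sq (\<lambda>x. grad (\<phi> k) x - G x)))
        \<longlonglongrightarrow> enn2real 0 + enn2real 0"
      using \<phi>(2,3) by (intro tendsto_add tendsto_enn2real) auto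
    then show "(\<lambda>k. enn2real (l2sq (\<lambda>x. \<phi> k x - u x)) + enn2real (l2sq (\<lambda>x. grad (\<phi> k) x - G x)))
        \<longlonglongrightarrow> 0"
      by simp
  qed simp
  then have "u \<in> H10 \<Omega>"
    using \<phi>(1) H10_pair_in_H1[OF uG, of \<Omega>] by (auto simp: H10_def)
  moreover have "AE x in lebesgue. x \<notin> \<Omega> \<longrightarrow> u x = 0"
    using H10_pair_zero_outside[OF uG \<open>open \<Omega>\<close>] by (intro AE_completion) auto
  ultimately show ?thesis
    using H10_pair_in_H1[OF uG, of UNIV] by (simp add: X12_def)
qed

text \<open>
  The approximating test functions are those in the definition of \<open>H10\<close>. Their distance to
  \<open>u\<close> is given there by Lebesgue integrals, which carry information only because the
  integrands are integrable; for the gradient this uses that \<open>weak_gradient \<Omega> u\<close> agrees with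
  the square integrable weak gradient that \<open>H1\<close> provides. Extending both functions by \<open>0\<close>
  turns integrals over \<open>\<Omega>\<close> into integrals over the whole space.
\<close>

lemma X12_imp_H10_pair:
  assumes u: "u \<in> X12 \<Omega>" and "open \<Omega>"
  obtains u\<^sub>0 G where "H10_pair \<Omega> u\<^sub>0 G" "AE x in lborel. u x = u\<^sub>0 x"
proof -
  have [measurable]: "\<Omega> \<in> sets borel"
    using \<open>open \<Omega>\<close> by simp
  have "u \<in> borel_measurable lebesgue"
    using u by (simp add: X12_def H1_def L2_def set_borel_measurable_def)
  then obtain u\<^sub>1 where [measurable]: "u\<^sub>1 \<in> borel_measurable borel" and u1: "AE x in lborel. u x = u\<^sub>1 x"
    using lebesgue_ex_borel_representative by blast
  define u\<^sub>0 where "u\<^sub>0 = (\<lambda>x. indicator \<Omega> x *\<^sub>R u\<^sub>1 x)"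
  have [measurable]: "u\<^sub>0 \<in> borel_measurable borel"
    by (simp add: u\<^sub>0_def)
  have "AE x in lborel. x \<notin> \<Omega> \<longrightarrow> u x = 0"
    using u by (simp add: X12_def AE_completion_iff)
  with u1 have u0: "AE x in lborel. u x = u\<^sub>0 x"
    by eventually_elim (auto simp: u\<^sub>0_def indicator_def)
  from u have "u \<in> H10 \<Omega>"
    by (simp add: X12_def)
  then obtain g \<phi> where uL2: "u \<in> L2 \<Omega>" and g: "g \<in> L2 \<Omega>" "has_weak_gradient \<Omega> u g"
    and \<phi>: "\<And>k. \<phi> k \<in> test_functions \<Omega>"
    and lim: "(\<lambda>k. (LINT x:\<Omega>|lebesgue. (\<phi> k x - u x)\<^sup>2) +
      (LINT x:\<Omega>|lebesgue. (norm (grad (\<phi> k) x - weak_gradient \<Omega> u x))\<^sup>2)) \<longlonglongrightarrow> 0"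
    by (auto simp: H10_def H1_def)
  note [measurable] = test_function_measurable[OF \<phi>]
  have "(\<lambda>x. indicator \<Omega> x *\<^sub>R g x) \<in> borel_measurable lebesgue"
    using g(1) by (simp add: L2_def set_borel_measurable_def)
  then obtain G\<^sub>1 where [measurable]: "G\<^sub>1 \<in> borel_measurable borel"
    and G1: "AE x in lborel. indicator \<Omega> x *\<^sub>R g x = G\<^sub>1 x"
    by (rule lebesgue_ex_borel_representative)
  define G where "G = (\<lambda>x. indicator \<Omega> x *\<^sub>R G\<^sub>1 x)"
  have [measurable]: "G \<in> borel_measurable borel"
    by (simp add: G_def)
  have wg: "AE x in lborel. x \<in> \<Omega> \<longrightarrow> weak_gradient \<Omega> u x = g x"
    using g(2) by (rule weak_gradient_eq[OF \<open>open \<Omega>\<close>])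
  have G: "AE x in lborel. x \<in> \<Omega> \<longrightarrow> weak_gradient \<Omega> u x = G x"
    using wg G1 by eventually_elim (auto simp: G_def)
  have fin_u: "l2sq u\<^sub>0 < \<infinity>"
  proof (rule l2sq_integrable)
    have "integrable lebesgue (\<lambda>x. indicator \<Omega> x *\<^sub>R (norm (u x))\<^sup>2)"
      using uL2 by (simp add: L2_def set_integrable_def)
    moreover have "AE x in lborel. indicator \<Omega> x *\<^sub>R (norm (u x))\<^sup>2 = (norm (u\<^sub>0 x))\<^sup>2"
      using u0 by eventually_elim (auto simp: u\<^sub>0_def indicator_def)
    ultimately show "integrable lborel (\<lambda>x. (norm (u\<^sub>0 x))\<^sup>2)"
      using lebesgue_integrable_AE_eq_borel[of "\<lambda>x. (norm (u\<^sub>0 x))\<^sup>2"] by simp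
  qed
  have fin_G: "l2sq G < \<infinity>"
  proof (rule l2sq_integrable)
    have "integrable lebesgue (\<lambda>x. indicator \<Omega> x *\<^sub>R (norm (g x))\<^sup>2)"
      using g by (simp add: L2_def set_integrable_def)
    moreover have "AE x in lborel. indicator \<Omega> x *\<^sub>R (norm (g x))\<^sup>2 = (norm (G x))\<^sup>2"
      using G1 by eventually_elim (auto simp: G_def indicator_def)
    ultimately show "integrable lborel (\<lambda>x. (norm (G x))\<^sup>2)"
      using lebesgue_integrable_AE_eq_borel[of "\<lambda>x. (norm (G x))\<^sup>2"] by simp
  qed
  have fd: "l2sq (\<lambda>x. \<phi> k x - u\<^sub>0 x) < \<infinity>" "l2sq (\<lambda>x. grad (\<phi> k) x - G x) < \<infinity>" for k
    using fin_u fin_G l2sq_test_function[OF \<phi>[of k]]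
    by (auto intro!: le_less_trans[OF l2sq_diff] simp: ennreal_mult_less_top)
  define A where "A = (\<lambda>k. LINT x:\<Omega>|lebesgue. (\<phi> k x - u x)\<^sup>2)"
  define B where "B = (\<lambda>k. LINT x:\<Omega>|lebesgue. (norm (grad (\<phi> k) x - weak_gradient \<Omega> u x))\<^sup>2)"
  have limAB: "(\<lambda>k. A k + B k) \<longlonglongrightarrow> 0"
    using lim by (simp add: A_def B_def)
  have AB_nonneg: "0 \<le> A k" "0 \<le> B k" for k
    by (auto simp: A_def B_def set_lebesgue_integral_def intro!: Bochner_Integration.integral_nonneg)
  have A: "l2sq (\<lambda>x. \<phi> k x - u\<^sub>0 x) = ennreal (A k)" for k
  proof -
    have "AE x in lborel. indicator \<Omega> x *\<^sub>R (\<phi> k x - u x)\<^sup>2 = (norm (\<phi> k x - u\<^sub>0 x))\<^sup>2"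
      using u0 by eventually_elim
        (use test_function_eq_0[OF \<phi>[of k]] in \<open>auto simp: u\<^sub>0_def indicator_def\<close>)
    then have "A k = (LINT x|lborel. (norm (\<phi> k x - u\<^sub>0 x))\<^sup>2)"
      unfolding A_def set_lebesgue_integral_def
      by (intro lebesgue_integral_AE_eq_borel) auto
    then show ?thesis
      using l2sq_integral(2)[OF _ fd(1)[of k]] by simp
  qed
  have B: "l2sq (\<lambda>x. grad (\<phi> k) x - G x) = ennreal (B k)" for k
  proof -
    have "AE x in lborel. indicator \<Omega> x *\<^sub>R (norm (grad (\<phi> k) x - weak_gradient \<Omega> u x))\<^sup>2
        = (norm (grad (\<phi> k) x - G x))\<^sup>2"
      using G by eventually_elim
        (use grad_test_function_eq_0[OF \<phi>[of k]] in \<open>auto simp: G_def indicator_def\<close>)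
    then have "B k = (LINT x|lborel. (norm (grad (\<phi> k) x - G x))\<^sup>2)"
      unfolding B_def set_lebesgue_integral_def
      by (intro lebesgue_integral_AE_eq_borel) auto
    then show ?thesis
      using l2sq_integral(2)[OF _ fd(2)[of k]] by simp
  qed
  have "A \<longlonglongrightarrow> 0"
    by (rule tendsto_sandwich[OF _ _ tendsto_const limAB]) (use AB_nonneg in auto)
  moreover have "B \<longlonglongrightarrow> 0"
    by (rule tendsto_sandwich[OF _ _ tendsto_const limAB]) (use AB_nonneg in auto)
  ultimately have "(\<lambda>k. l2sq (\<lambda>x. \<phi> k x - u\<^sub>0 x)) \<longlonglongrightarrow> 0" "(\<lambda>k. l2sq (\<lambda>x. grad (\<phi> k) x - G x)) \<longlonglongrightarrow> 0"
    unfolding A B using tendsto_ennrealI[of _ 0] by auto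
  then have "H10_pair \<Omega> u\<^sub>0 G"
    using \<phi> by (auto simp: H10_pair_def)
  with u0 show thesis
    using that by blast
qed

lemma H10_pair_cong_AE:
  assumes uG: "H10_pair \<Omega> u G" and "AE x in lborel. u x = u' x" "AE x in lborel. G x = G' x"
    and "u' \<in> borel_measurable borel" "G' \<in> borel_measurable borel"
  shows "H10_pair \<Omega> u' G'"
proof -
  have "l2sq (\<lambda>x. \<phi> x - u x) = l2sq (\<lambda>x. \<phi> x - u' x)" for \<phi>
    by (intro l2sq_cong_AE) (use assms(2) in eventually_elim, simp)
  moreover have "l2sq (\<lambda>x. \<phi> x - G x) = l2sq (\<lambda>x. \<phi> x - G' x)" for \<phi>
    by (intro l2sq_cong_AE) (use assms(3) in eventually_elim, simp)
  ultimately show ?thesis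
    using assms unfolding H10_pair_def by auto
qed

section \<open>Dilations and compositions\<close>

lemma test_function_affine:
  fixes \<phi> :: "'a::euclidean_space \<Rightarrow> real"
  assumes \<phi>: "\<phi> \<in> test_functions \<Omega>" and t: "t \<noteq> 0"
    and sub: "\<And>x. c + t *\<^sub>R x \<in> \<Omega> \<Longrightarrow> x \<in> \<Omega>'"
  shows "(\<lambda>x. \<phi> (c + t *\<^sub>R x)) \<in> test_functions \<Omega>'"
    and "grad (\<lambda>x. \<phi> (c + t *\<^sub>R x)) x = t *\<^sub>R grad \<phi> (c + t *\<^sub>R x)"
proof -
  obtain K where K: "compact K" "K \<subseteq> \<Omega>" "\<And>x. x \<notin> K \<Longrightarrow> \<phi> x = 0"
    using test_function_support[OF \<phi>] by metis
  let ?K = "(\<lambda>y. (1 / t) *\<^sub>R (y - c)) ` K"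
  have inv: "c + t *\<^sub>R x \<in> K \<longleftrightarrow> x \<in> ?K" for x
    using t by (auto simp: image_iff intro!: bexI[of _ "c + t *\<^sub>R x"])
  have "compact ?K"
    by (intro compact_continuous_image K continuous_intros)
  moreover have "{x. \<phi> (c + t *\<^sub>R x) \<noteq> 0} \<subseteq> ?K"
    using K(3) inv by blast
  ultimately have "closure {x. \<phi> (c + t *\<^sub>R x) \<noteq> 0} \<subseteq> ?K" "bounded {x. \<phi> (c + t *\<^sub>R x) \<noteq> 0}"
    using compact_imp_closed[of ?K] compact_imp_bounded[of ?K] bounded_subset
    by (simp_all only: closure_minimal, blast)
  moreover have "?K \<subseteq> \<Omega>'"
    using inv sub K(2) by blast
  ultimately show "(\<lambda>x. \<phi> (c + t *\<^sub>R x)) \<in> test_functions \<Omega>'"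
    using test_function_Ck[OF \<phi>] by (auto simp: test_functions_def intro!: Ck_affine)
  show "grad (\<lambda>x. \<phi> (c + t *\<^sub>R x)) x = t *\<^sub>R grad \<phi> (c + t *\<^sub>R x)"
  proof (rule grad_eqI)
    have "((\<lambda>x. c + t *\<^sub>R x) has_derivative (\<lambda>h. t *\<^sub>R h)) (at x)"
      by (auto intro!: derivative_eq_intros)
    from has_derivative_compose[OF this Ck_grad_has_derivative[OF test_function_Ck[OF \<phi>]]]
    show "((\<lambda>x. \<phi> (c + t *\<^sub>R x)) has_derivative (\<lambda>h. (t *\<^sub>R grad \<phi> (c + t *\<^sub>R x)) \<bullet> h)) (at x)"
      by simp
  qed
qed

lemma H10_pair_affine:
  fixes u :: "'a::euclidean_space \<Rightarrow> real"
  assumes uG: "H10_pair \<Omega> u G" and t: "1 \<le> t"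
    and sub: "\<And>x. c + t *\<^sub>R x \<in> \<Omega> \<Longrightarrow> x \<in> \<Omega>'"
  shows "H10_pair \<Omega>' (\<lambda>x. u (c + t *\<^sub>R x)) (\<lambda>x. t *\<^sub>R G (c + t *\<^sub>R x))"
proof -
  note [measurable] = H10_pair_measurable[OF uG]
  obtain \<phi> where \<phi>: "\<And>k. \<phi> k \<in> test_functions \<Omega>" "(\<lambda>k. l2sq (\<lambda>x. \<phi> k x - u x)) \<longlonglongrightarrow> 0"
    "(\<lambda>k. l2sq (\<lambda>x. grad (\<phi> k) x - G x)) \<longlonglongrightarrow> 0"
    using H10_pairE[OF uG] by blast
  note [measurable] = test_function_measurable[OF \<phi>(1)]
  have t0: "t \<noteq> 0"
    using t by simp
  note test = test_function_affine(1)[OF \<phi>(1) t0 sub]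
  have grad: "grad (\<lambda>x. \<phi> k (c + t *\<^sub>R x)) x = t *\<^sub>R grad (\<phi> k) (c + t *\<^sub>R x)" for k x
    by (rule test_function_affine(2)[OF \<phi>(1) t0 sub])
  have "(\<lambda>k. l2sq (\<lambda>x. \<phi> k (c + t *\<^sub>R x) - u (c + t *\<^sub>R x))) \<longlonglongrightarrow> 0"
    by (rule tendsto_sandwich[OF _ _ tendsto_const \<phi>(2)])
      (auto intro!: always_eventually l2sq_affine_le[where f = "\<lambda>x. \<phi> _ x - u x"] t)
  moreover have "(\<lambda>k. l2sq (\<lambda>x. grad (\<lambda>x. \<phi> k (c + t *\<^sub>R x)) x - t *\<^sub>R G (c + t *\<^sub>R x))) \<longlonglongrightarrow> 0"
  proof (rule tendsto_sandwich[OF _ _ tendsto_const])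
    show "(\<lambda>k. ennreal (t\<^sup>2) * l2sq (\<lambda>x. grad (\<phi> k) x - G x)) \<longlonglongrightarrow> 0"
      using ennreal_tendsto_cmult[OF _ \<phi>(3), of "ennreal (t\<^sup>2)"] by simp
    have "l2sq (\<lambda>x. grad (\<lambda>x. \<phi> k (c + t *\<^sub>R x)) x - t *\<^sub>R G (c + t *\<^sub>R x))
        \<le> ennreal (t\<^sup>2) * l2sq (\<lambda>x. grad (\<phi> k) x - G x)" for k
    proof -
      have "l2sq (\<lambda>x. grad (\<lambda>x. \<phi> k (c + t *\<^sub>R x)) x - t *\<^sub>R G (c + t *\<^sub>R x))
          = l2sq (\<lambda>x. t *\<^sub>R (grad (\<phi> k) (c + t *\<^sub>R x) - G (c + t *\<^sub>R x)))"
        by (simp only: grad scaleR_diff_right)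
      also have "\<dots> = ennreal (t\<^sup>2) * l2sq (\<lambda>x. grad (\<phi> k) (c + t *\<^sub>R x) - G (c + t *\<^sub>R x))"
        by (rule l2sq_scaleR) measurable
      also have "\<dots> \<le> ennreal (t\<^sup>2) * l2sq (\<lambda>x. grad (\<phi> k) x - G x)"
        by (intro mult_left_mono l2sq_affine_le[where f = "\<lambda>x. grad (\<phi> k) x - G x"] t) auto
      finally show ?thesis .
    qed
    then show "\<forall>\<^sub>F k in sequentially. l2sq (\<lambda>x. grad (\<lambda>x. \<phi> k (c + t *\<^sub>R x)) x - t *\<^sub>R G (c + t *\<^sub>R x))
        \<le> ennreal (t\<^sup>2) * l2sq (\<lambda>x. grad (\<phi> k) x - G x)"
      by (intro always_eventually allI)
  qed auto
  ultimately show ?thesis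
    unfolding H10_pair_def using test
    by (auto intro!: exI[of _ "\<lambda>k x. \<phi> k (c + t *\<^sub>R x)"])
qed

lemma l2sq_AE_convergent_subsequence:
  fixes f :: "nat \<Rightarrow> 'a::euclidean_space \<Rightarrow> 'b::euclidean_space"
  assumes "(\<lambda>k. l2sq (f k)) \<longlonglongrightarrow> 0" "\<And>k. l2sq (f k) < \<infinity>"
    and [measurable]: "\<And>k. f k \<in> borel_measurable borel"
  obtains r :: "nat \<Rightarrow> nat" where "strict_mono r" "AE x in lborel. (\<lambda>k. f (r k) x) \<longlonglongrightarrow> 0"
proof -
  have int: "integrable lborel (\<lambda>x. (norm (f k x))\<^sup>2)" for k
    using assms by (intro l2sq_integral) auto
  have "(\<lambda>k. enn2real (l2sq (f k))) \<longlonglongrightarrow> enn2real 0"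
    using assms(1) by (intro tendsto_enn2real) auto
  moreover have "enn2real (l2sq (f k)) = (\<integral>x. norm ((norm (f k x))\<^sup>2) \<partial>lborel)" for k
    using l2sq_integral(2)[OF assms(3,2)] by simp
  ultimately have "(\<lambda>k. \<integral>x. norm ((norm (f k x))\<^sup>2) \<partial>lborel) \<longlonglongrightarrow> 0"
    by simp
  from tendsto_L1_AE_subseq[OF int this]
  obtain r :: "nat \<Rightarrow> nat" where r: "strict_mono r" "AE x in lborel. (\<lambda>n. (norm (f (r n) x))\<^sup>2) \<longlonglongrightarrow> 0"
    by auto
  from r(2) have "AE x in lborel. (\<lambda>n. f (r n) x) \<longlonglongrightarrow> 0"
    by eventually_elim (simp add: tendsto_norm_zero_iff)
  with r(1) show thesis
    using that by blast
qed

text \<open>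
  The chain rule for smooth \<open>\<theta>\<close> with bounded derivative. Smoothness and \<open>\<theta> 0 = 0\<close> keep the
  composition with a test function a test function. In the gradients,
  \<open>(\<theta>' (\<phi> k x) - \<theta>' (u x)) *\<^sub>R G x\<close> converges to \<open>0\<close> by dominated convergence along a
  subsequence for which \<open>\<phi> k\<close> converges almost everywhere.
\<close>

lemma H10_pair_compose:
  fixes u :: "'a::euclidean_space \<Rightarrow> real"
  assumes uG: "H10_pair \<Omega> u G"
    and \<theta>: "\<And>k. Ck k \<theta>" "\<theta> 0 = 0" "\<And>z. (\<theta> has_real_derivative \<theta>' z) (at z)" "\<And>z. \<bar>\<theta>' z\<bar> \<le> 1"
  shows "H10_pair \<Omega> (\<lambda>x. \<theta> (u x)) (\<lambda>x. \<theta>' (u x) *\<^sub>R G x)"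
proof -
  have \<theta>'_cont: "continuous_on UNIV \<theta>'"
    using \<theta>(1)[of "Suc 0"] by (simp add: frechet_derivative_real[OF \<theta>(3)])
  then have \<theta>'_isCont: "isCont \<theta>' z" for z
    by (simp add: continuous_on_eq_continuous_at)
  have [measurable]: "\<theta> \<in> borel_measurable borel" "\<theta>' \<in> borel_measurable borel"
    using \<theta>(1)[of 0] \<theta>'_cont by (auto intro: borel_measurable_continuous_onI)
  note [measurable] = H10_pair_measurable[OF uG]
  note fin = H10_pair_finite[OF uG]
  obtain \<phi>\<^sub>0 where \<phi>\<^sub>0: "\<And>k. \<phi>\<^sub>0 k \<in> test_functions \<Omega>" "(\<lambda>k. l2sq (\<lambda>x. \<phi>\<^sub>0 k x - u x)) \<longlonglongrightarrow> 0"
    "(\<lambda>k. l2sq (\<lambda>x. grad (\<phi>\<^sub>0 k) x - G x)) \<longlonglongrightarrow> 0"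
    using H10_pairE[OF uG] by blast
  have fd: "l2sq (\<lambda>x. \<phi>\<^sub>0 k x - u x) < \<infinity>" for k
    using fin l2sq_test_function[OF \<phi>\<^sub>0(1)[of k]] test_function_measurable[OF \<phi>\<^sub>0(1)]
    by (auto intro!: le_less_trans[OF l2sq_diff] simp: ennreal_mult_less_top)
  obtain r :: "nat \<Rightarrow> nat" where r: "strict_mono r" "AE x in lborel. (\<lambda>k. \<phi>\<^sub>0 (r k) x - u x) \<longlonglongrightarrow> 0"
    using l2sq_AE_convergent_subsequence[OF \<phi>\<^sub>0(2) fd] test_function_measurable[OF \<phi>\<^sub>0(1)] by auto
  define \<phi> where "\<phi> = (\<lambda>k. \<phi>\<^sub>0 (r k))"
  have \<phi>: "\<And>k. \<phi> k \<in> test_functions \<Omega>" "(\<lambda>k. l2sq (\<lambda>x. \<phi> k x - u x)) \<longlonglongrightarrow> 0"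
    "(\<lambda>k. l2sq (\<lambda>x. grad (\<phi> k) x - G x)) \<longlonglongrightarrow> 0"
    using \<phi>\<^sub>0 LIMSEQ_subseq_LIMSEQ[OF \<phi>\<^sub>0(2) r(1)] LIMSEQ_subseq_LIMSEQ[OF \<phi>\<^sub>0(3) r(1)]
    by (auto simp: \<phi>_def comp_def)
  have ae: "AE x in lborel. (\<lambda>k. \<phi> k x) \<longlonglongrightarrow> u x"
    using r(2) by eventually_elim (simp add: \<phi>_def LIM_zero_iff)
  note [measurable] = test_function_measurable[OF \<phi>(1)]
  have grad: "grad (\<lambda>x. \<theta> (\<phi> k x)) x = \<theta>' (\<phi> k x) *\<^sub>R grad (\<phi> k) x" for k x
  proof (rule grad_eqI)
    have "(\<phi> k has_derivative (\<lambda>h. grad (\<phi> k) x \<bullet> h)) (at x)"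
      by (rule Ck_grad_has_derivative[OF test_function_Ck[OF \<phi>(1)]])
    moreover have "(\<theta> has_derivative (\<lambda>h. \<theta>' (\<phi> k x) * h)) (at (\<phi> k x))"
      using \<theta>(3) by (simp add: has_field_derivative_def)
    ultimately have "((\<lambda>x. \<theta> (\<phi> k x)) has_derivative (\<lambda>h. \<theta>' (\<phi> k x) * (grad (\<phi> k) x \<bullet> h))) (at x)"
      by (rule has_derivative_compose)
    then show "((\<lambda>x. \<theta> (\<phi> k x)) has_derivative (\<lambda>h. (\<theta>' (\<phi> k x) *\<^sub>R grad (\<phi> k) x) \<bullet> h)) (at x)"
      by simp
  qed
  have test: "(\<lambda>x. \<theta> (\<phi> k x)) \<in> test_functions \<Omega>" for k
  proof -
    have "{x. \<theta> (\<phi> k x) \<noteq> 0} \<subseteq> {x. \<phi> k x \<noteq> 0}"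
      using \<theta>(2) by auto
    then have "closure {x. \<theta> (\<phi> k x) \<noteq> 0} \<subseteq> closure {x. \<phi> k x \<noteq> 0}"
      by (rule closure_mono)
    moreover have "Ck j (\<lambda>x. \<theta> (\<phi> k x))" for j
      by (rule Ck_compose_real[OF \<theta>(1) test_function_Ck[OF \<phi>(1)]])
    ultimately show ?thesis
      using \<phi>(1)[of k]
      by (auto simp: test_functions_def compact_eq_bounded_closed intro: bounded_subset)
  qed
  have lip: "\<bar>\<theta> y - \<theta> z\<bar> \<le> \<bar>y - z\<bar>" for y z
    using field_differentiable_bound[of UNIV \<theta> \<theta>' 1 y z] \<theta>(3,4)
    by (auto intro: has_field_derivative_at_within)
  have "(\<lambda>k. l2sq (\<lambda>x. \<theta> (\<phi> k x) - \<theta> (u x))) \<longlonglongrightarrow> 0"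
    by (rule tendsto_sandwich[OF _ _ tendsto_const \<phi>(2)])
      (auto intro!: always_eventually l2sq_mono_AE AE_I2 lip)
  moreover have "(\<lambda>k. l2sq (\<lambda>x. grad (\<lambda>x. \<theta> (\<phi> k x)) x - \<theta>' (u x) *\<^sub>R G x)) \<longlonglongrightarrow> 0"
  proof (rule tendsto_sandwich[OF _ _ tendsto_const])
    define e where "e = (\<lambda>k x. (\<theta>' (\<phi> k x) - \<theta>' (u x)) *\<^sub>R G x)"
    have [measurable]: "e k \<in> borel_measurable borel" for k
      by (simp add: e_def)
    have "(\<lambda>k. \<integral>\<^sup>+x. ennreal ((norm (e k x))\<^sup>2) \<partial>lborel) \<longlonglongrightarrow> (\<integral>\<^sup>+(x::'a). 0 \<partial>lborel)"
    proof (rule nn_integral_dominated_convergence)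
      show "AE x in lborel. ennreal ((norm (e k x))\<^sup>2) \<le> 4 * ennreal ((norm (G x))\<^sup>2)" for k
      proof (rule AE_I2)
        fix x
        have "\<bar>\<theta>' (\<phi> k x) - \<theta>' (u x)\<bar> \<le> 2"
          using \<theta>(4)[of "\<phi> k x"] \<theta>(4)[of "u x"] by linarith
        then have "norm (e k x) \<le> 2 * norm (G x)"
          by (simp add: e_def mult_right_mono)
        then have "(norm (e k x))\<^sup>2 \<le> (2 * norm (G x))\<^sup>2"
          by (intro power_mono) auto
        then have "ennreal ((norm (e k x))\<^sup>2) \<le> ennreal (4 * (norm (G x))\<^sup>2)"
          by (intro ennreal_leI) (simp add: power_mult_distrib)
        then show "ennreal ((norm (e k x))\<^sup>2) \<le> 4 * ennreal ((norm (G x))\<^sup>2)"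
          by (simp add: ennreal_mult)
      qed
      show "(\<integral>\<^sup>+x. 4 * ennreal ((norm (G x))\<^sup>2) \<partial>lborel) < \<infinity>"
        using fin(2) by (simp add: nn_integral_cmult l2sq_def[symmetric] ennreal_mult_less_top)
      show "AE x in lborel. (\<lambda>k. ennreal ((norm (e k x))\<^sup>2)) \<longlonglongrightarrow> 0"
        using ae
      proof eventually_elim
        case (elim x)
        have "(\<lambda>k. \<theta>' (\<phi> k x)) \<longlonglongrightarrow> \<theta>' (u x)"
          using elim \<theta>'_isCont by (rule isCont_tendsto_compose[rotated])
        then have "(\<lambda>k. e k x) \<longlonglongrightarrow> (\<theta>' (u x) - \<theta>' (u x)) *\<^sub>R G x"
          unfolding e_def by (intro tendsto_intros)
        then have "(\<lambda>k. (norm (e k x))\<^sup>2) \<longlonglongrightarrow> 0"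
          by (auto intro!: tendsto_eq_intros)
        then have "(\<lambda>k. ennreal ((norm (e k x))\<^sup>2)) \<longlonglongrightarrow> ennreal 0"
          by (rule tendsto_ennrealI)
        then show ?case
          by simp
      qed
    qed auto
    then have e0: "(\<lambda>k. l2sq (e k)) \<longlonglongrightarrow> 0"
      by (simp add: l2sq_def)
    then show "(\<lambda>k. 2 * l2sq (\<lambda>x. grad (\<phi> k) x - G x) + 2 * l2sq (e k)) \<longlonglongrightarrow> 0"
      using tendsto_add[OF ennreal_tendsto_cmult[OF _ \<phi>(3), of 2] ennreal_tendsto_cmult[OF _ e0, of 2]]
      by simp
    have "l2sq (\<lambda>x. grad (\<lambda>x. \<theta> (\<phi> k x)) x - \<theta>' (u x) *\<^sub>R G x)
        \<le> 2 * l2sq (\<lambda>x. grad (\<phi> k) x - G x) + 2 * l2sq (e k)" for k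
    proof -
      have "l2sq (\<lambda>x. grad (\<lambda>x. \<theta> (\<phi> k x)) x - \<theta>' (u x) *\<^sub>R G x)
          = l2sq (\<lambda>x. \<theta>' (\<phi> k x) *\<^sub>R (grad (\<phi> k) x - G x) + e k x)"
        by (simp add: grad e_def algebra_simps)
      also have "\<dots> \<le> 2 * l2sq (\<lambda>x. \<theta>' (\<phi> k x) *\<^sub>R (grad (\<phi> k) x - G x)) + 2 * l2sq (e k)"
        by (rule l2sq_add) measurable
      also have "\<dots> \<le> 2 * l2sq (\<lambda>x. grad (\<phi> k) x - G x) + 2 * l2sq (e k)"
        using \<theta>(4) by (intro add_mono mult_left_mono l2sq_mono_AE AE_I2) (auto intro: mult_left_le_one_le)
      finally show ?thesis .
    qed
    then show "\<forall>\<^sub>F k in sequentially. l2sq (\<lambda>x. grad (\<lambda>x. \<theta> (\<phi> k x)) x - \<theta>' (u x) *\<^sub>R G x)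
        \<le> 2 * l2sq (\<lambda>x. grad (\<phi> k) x - G x) + 2 * l2sq (e k)"
      by (intro always_eventually allI)
  qed auto
  ultimately show ?thesis
    unfolding H10_pair_def using test
    by (auto intro!: exI[of _ "\<lambda>k x. \<theta> (\<phi> k x)"])
qed

section \<open>A weak Sobolev inequality\<close>

lemma H10_pair_translation_estimate:
  assumes "H10_pair \<Omega> u G"
  shows "l2sq (\<lambda>x. u (x + h) - u x) \<le> 4 * ennreal ((norm h)\<^sup>2) * l2sq G"
  using H10_pair_flow_estimate[OF assms, of 0 "norm h" h] by simp

text \<open>
  If \<open>{l < g}\<close> fills at most half of every ball of radius \<open>r\<close>, then from a point with
  \<open>2 * l \<le> g\<close> at least half of the displacements \<open>h\<close> of length below \<open>r\<close> lead to a point where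
  \<open>g\<close> is smaller by \<open>l\<close> or more. Averaging the translation estimate over such \<open>h\<close> bounds the
  measure of these points. Choosing \<open>r\<close> by the measure of \<open>{l < g}\<close> yields a weak form
  of the Sobolev inequality.
\<close>

lemma weak_Sobolev:
  fixes g :: "'a::euclidean_space \<Rightarrow> real"
  assumes gG: "H10_pair \<Omega> g G" and "0 < r" "0 < l"
    and half: "2 * emeasure lborel {x. l < g x} \<le> emeasure lborel (ball (0::'a) r)"
  shows "ennreal (l\<^sup>2) * emeasure lborel {x. 2 * l \<le> g x} \<le> ennreal (8 * r\<^sup>2) * l2sq G"
proof -
  note [measurable] = H10_pair_measurable[OF gG]
  define B where "B = ball (0::'a) r"
  have [measurable]: "B \<in> sets borel" by (simp add: B_def)
  define \<beta> where "\<beta> = measure lborel B"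
  have B: "emeasure lborel B = ennreal \<beta>"
    unfolding \<beta>_def B_def using emeasure_lborel_ball_finite[of "0::'a" r]
    by (intro emeasure_eq_ennreal_measure) auto
  have \<beta>: "0 < \<beta>"
    using content_ball_pos[OF \<open>0 < r\<close>, of "0::'a"] by (simp add: \<beta>_def B_def)
  have fin: "emeasure lborel {x. l < g x} < \<infinity>"
  proof -
    have "emeasure lborel {x. l < g x} \<le> 2 * emeasure lborel {x. l < g x}"
      using mult_right_mono[of 1 2 "emeasure lborel {x. l < g x}"] by simp
    also have "\<dots> < \<infinity>"
      using half B by (simp add: B_def[symmetric] le_less_trans)
    finally show ?thesis .
  qed
  define \<mu> where "\<mu> = measure lborel {x. l < g x}"
  have \<mu>: "emeasure lborel {x. l < g x} = ennreal \<mu>"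
    unfolding \<mu>_def using fin by (intro emeasure_eq_ennreal_measure) auto
  have \<mu>\<beta>: "2 * \<mu> \<le> \<beta>"
  proof -
    have "ennreal (2 * \<mu>) \<le> ennreal \<beta>"
      using half unfolding \<mu> B_def[symmetric] B by (simp add: ennreal_mult' \<mu>_def)
    then show ?thesis using \<beta> by (simp add: ennreal_le_iff)
  qed
  \<comment> \<open>At least half of the ball consists of displacements along which \<open>g\<close> drops by \<open>l\<close>.\<close>
  have pt: "ennreal (l\<^sup>2 * (\<beta> / 2)) * indicator {x. 2 * l \<le> g x} x \<le>
      (\<integral>\<^sup>+h. ennreal ((g (x + h) - g x)\<^sup>2) * indicator B h \<partial>lborel)" for x
  proof (cases "2 * l \<le> g x")
    case True
    have em: "emeasure lborel {h. l < g (x + h)} = ennreal \<mu>"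
    proof -
      have "emeasure lborel {h. l < g (x + h)} = (\<integral>\<^sup>+h. indicator {y. l < g y} (x + 1 *\<^sub>R h) \<partial>lborel)"
      proof -
        have "(\<lambda>h. indicator {y. l < g y} (x + 1 *\<^sub>R h)) = (indicator {h. l < g (x + h)} :: _ \<Rightarrow> ennreal)"
          by (auto simp: indicator_def)
        then show ?thesis
          by simp
      qed
      also have "\<dots> = (\<integral>\<^sup>+y. indicator {y. l < g y} y \<partial>lborel)"
        by (subst nn_integral_affine[of _ 1 x]) auto
      also have "\<dots> = ennreal \<mu>"
        using \<mu> by simp
      finally show ?thesis .
    qed
    have "ennreal \<beta> \<le> emeasure lborel (B - {h. l < g (x + h)}) + ennreal \<mu>"
      unfolding B[symmetric] em[symmetric]
      by (rule order_trans[OF emeasure_mono emeasure_subadditive]) auto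
    then have "ennreal (\<beta> - \<mu>) \<le> emeasure lborel (B - {h. l < g (x + h)})"
      by (simp add: ennreal_minus[symmetric] \<mu>_def ennreal_minus_le_iff add.commute)
    then have half': "ennreal (\<beta> / 2) \<le> emeasure lborel (B - {h. l < g (x + h)})"
      by (rule order_trans[rotated]) (use \<mu>\<beta> in \<open>auto intro!: ennreal_leI\<close>)
    have "ennreal (l\<^sup>2 * (\<beta> / 2)) = ennreal (l\<^sup>2) * ennreal (\<beta> / 2)"
      by (rule ennreal_mult') auto
    also have "\<dots> \<le> ennreal (l\<^sup>2) * emeasure lborel (B - {h. l < g (x + h)})"
      using half' by (rule mult_left_mono) simp
    also have "\<dots> = (\<integral>\<^sup>+h. ennreal (l\<^sup>2) * indicator (B - {h. l < g (x + h)}) h \<partial>lborel)"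
      by (simp add: nn_integral_cmult_indicator)
    also have "\<dots> \<le> (\<integral>\<^sup>+h. ennreal ((g (x + h) - g x)\<^sup>2) * indicator B h \<partial>lborel)"
    proof (rule nn_integral_mono)
      fix h
      have "l\<^sup>2 \<le> (g (x + h) - g x)\<^sup>2" if "\<not> l < g (x + h)"
        using that True \<open>0 < l\<close> power_mono[of l "g x - g (x + h)" 2]
        by (simp add: power2_commute)
      then show "ennreal (l\<^sup>2) * indicator (B - {h. l < g (x + h)}) h
          \<le> ennreal ((g (x + h) - g x)\<^sup>2) * indicator B h"
        by (auto simp: indicator_def intro!: ennreal_leI)
    qed
    finally show ?thesis
      using True by simp
  qed simp
  have "ennreal (l\<^sup>2 * (\<beta> / 2)) * emeasure lborel {x. 2 * l \<le> g x} =
      (\<integral>\<^sup>+x. ennreal (l\<^sup>2 * (\<beta> / 2)) * indicator {x. 2 * l \<le> g x} x \<partial>lborel)"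
    by (simp add: nn_integral_cmult_indicator)
  also have "\<dots> \<le> (\<integral>\<^sup>+x. \<integral>\<^sup>+h. ennreal ((g (x + h) - g x)\<^sup>2) * indicator B h \<partial>lborel \<partial>lborel)"
    by (intro nn_integral_mono pt)
  also have "\<dots> = (\<integral>\<^sup>+h. \<integral>\<^sup>+x. ennreal ((g (x + h) - g x)\<^sup>2) * indicator B h \<partial>lborel \<partial>lborel)"
    by (rule lborel_pair.Fubini') measurable
  also have "\<dots> \<le> (\<integral>\<^sup>+h. 4 * ennreal (r\<^sup>2) * l2sq G * indicator B h \<partial>lborel)"
  proof (rule nn_integral_mono)
    fix h :: 'a
    show "(\<integral>\<^sup>+x. ennreal ((g (x + h) - g x)\<^sup>2) * indicator B h \<partial>lborel)
        \<le> 4 * ennreal (r\<^sup>2) * l2sq G * indicator B h"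
    proof (cases "h \<in> B")
      case True
      have "l2sq (\<lambda>x. g (x + h) - g x) \<le> 4 * ennreal ((norm h)\<^sup>2) * l2sq G"
        by (rule H10_pair_translation_estimate[OF gG])
      also have "\<dots> \<le> 4 * ennreal (r\<^sup>2) * l2sq G"
        using True by (intro mult_right_mono mult_left_mono ennreal_leI power_mono) (auto simp: B_def)
      finally show ?thesis
        using True by (simp add: l2sq_def)
    qed simp
  qed
  also have "\<dots> = 4 * ennreal (r\<^sup>2) * l2sq G * ennreal \<beta>"
    by (simp add: nn_integral_cmult_indicator B)
  finally have "ennreal (2 / \<beta>) * (ennreal (l\<^sup>2 * (\<beta> / 2)) * emeasure lborel {x. 2 * l \<le> g x})
      \<le> ennreal (2 / \<beta>) * (4 * ennreal (r\<^sup>2) * l2sq G * ennreal \<beta>)"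
    by (rule mult_left_mono) simp
  moreover have "ennreal (2 / \<beta>) * (ennreal (l\<^sup>2 * (\<beta> / 2)) * m) = ennreal (l\<^sup>2) * m" for m
    using \<beta> by (simp add: mult.assoc[symmetric] ennreal_mult[symmetric])
  moreover have "ennreal (2 / \<beta>) * (4 * ennreal (r\<^sup>2) * m * ennreal \<beta>) = ennreal (8 * r\<^sup>2) * m" for m
  proof -
    have "ennreal (2 / \<beta>) * (4 * ennreal (r\<^sup>2) * m * ennreal \<beta>) =
        (ennreal (2 / \<beta>) * ennreal \<beta> * 4 * ennreal (r\<^sup>2)) * m"
      by (simp add: mult_ac)
    also have "ennreal (2 / \<beta>) * ennreal \<beta> * 4 * ennreal (r\<^sup>2) = ennreal (8 * r\<^sup>2)"
      using \<beta> by (simp add: ennreal_mult[symmetric] flip: ennreal_numeral)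
    finally show ?thesis .
  qed
  ultimately show ?thesis
    by simp
qed

section \<open>The nonlocal form\<close>

lemma nn_integral_dyadic_majorant_finite:
  fixes f :: "'a::euclidean_space \<Rightarrow> ennreal" and c \<rho> :: "nat \<Rightarrow> real"
  assumes pt: "\<And>x. x \<in> S \<Longrightarrow> \<exists>j. x \<in> ball 0 (\<rho> j) \<and> f x \<le> ennreal (c j)"
    and nonneg: "\<And>j. 0 \<le> c j" "\<And>j. 0 \<le> \<rho> j"
    and sm: "summable (\<lambda>j. c j * \<rho> j ^ DIM('a))"
  shows "(\<integral>\<^sup>+x. f x * indicator S x \<partial>lborel) < \<infinity>"
proof -
  let ?\<omega> = "unit_ball_vol (real DIM('a))"
  have "(\<integral>\<^sup>+x. f x * indicator S x \<partial>lborel) \<le>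
      (\<integral>\<^sup>+x. (\<Sum>j. ennreal (c j) * indicator (ball (0::'a) (\<rho> j)) x) \<partial>lborel)"
  proof (rule nn_integral_mono)
    fix x
    show "f x * indicator S x \<le> (\<Sum>j. ennreal (c j) * indicator (ball (0::'a) (\<rho> j)) x)"
    proof (cases "x \<in> S")
      case True
      then obtain j where j: "x \<in> ball 0 (\<rho> j)" "f x \<le> ennreal (c j)"
        using pt by blast
      then have "f x * indicator S x \<le> (\<Sum>j\<in>{j}. ennreal (c j) * indicator (ball (0::'a) (\<rho> j)) x)"
        using True by simp
      also have "\<dots> \<le> (\<Sum>j. ennreal (c j) * indicator (ball (0::'a) (\<rho> j)) x)"
        by (intro sum_le_suminf summableI) auto
      finally show ?thesis .
    qed simp
  qed
  also have "\<dots> = (\<Sum>j. ennreal (c j) * emeasure lborel (ball (0::'a) (\<rho> j)))"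
  proof (subst nn_integral_suminf)
    show "(\<lambda>x. ennreal (c j) * indicator (ball (0::'a) (\<rho> j)) x) \<in> borel_measurable lborel" for j
      by (intro borel_measurable_times_ennreal borel_measurable_const borel_measurable_indicator) auto
  qed (simp add: nn_integral_cmult_indicator)
  also have "\<dots> = (\<Sum>j. ennreal (?\<omega> * (c j * \<rho> j ^ DIM('a))))"
    using nonneg by (intro suminf_cong) (simp add: emeasure_ball ennreal_mult[symmetric] mult_ac)
  also have "\<dots> = ennreal (\<Sum>j. ?\<omega> * (c j * \<rho> j ^ DIM('a)))"
    using nonneg sm by (intro suminf_ennreal2 summable_mult) auto
  also have "\<dots> < \<infinity>"
    by simp
  finally show ?thesis .
qed

lemma dyadic_bounds:
  fixes r :: real
  assumes "1 \<le> r"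
  obtains j :: nat where "2 powr j \<le> r" "r < 2 powr (real j + 1)"
proof
  define j where "j = nat \<lfloor>log 2 r\<rfloor>"
  have "0 \<le> log 2 r"
    using assms by simp
  then have j: "real j \<le> log 2 r" "log 2 r < real j + 1"
    unfolding j_def by linarith+
  then show "2 powr j \<le> r" "r < 2 powr (real j + 1)"
    using assms by (simp_all add: le_log_iff log_less_iff add.commute)
qed

text \<open>
  Dyadic shells: away from the origin the kernel decays faster than the volume grows since
  \<open>s > 0\<close>, and near the origin the factor \<open>(norm h)\<^sup>2\<close> compensates the singularity since \<open>s < 1\<close>.
\<close>

lemma nn_integral_fractional_kernel_finite:
  assumes s: "0 < s" "s < 1"
  shows "(\<integral>\<^sup>+h. ennreal (min 1 ((norm h)\<^sup>2) / norm (h::'a::euclidean_space) powr (real DIM('a) + 2 * s)) \<partial>lborel) < \<infinity>"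
proof -
  let ?n = "real DIM('a)"
  let ?f = "\<lambda>h::'a. ennreal (min 1 ((norm h)\<^sup>2) / norm h powr (?n + 2 * s))"
  let ?S = "{h::'a. 1 \<le> norm h}"
  have pw: "(2 powr z) ^ DIM('a) = 2 powr (z * ?n)" for z :: real
    by (simp add: powr_powr[symmetric] powr_realpow)
  have geo: "summable (\<lambda>j::nat. C * 2 powr (- e * real j))" if "0 < e" for C e :: real
  proof -
    have "2 powr (- e * real j) = (2 powr (- e)) ^ j" for j
      by (subst powr_realpow[symmetric]) (simp_all add: powr_powr)
    moreover have "2 powr (- e) < 1"
      using that by (simp add: powr_less_one)
    ultimately show ?thesis
      by (auto intro!: summable_mult summable_geometric)
  qed
  have outer: "(\<integral>\<^sup>+h. ?f h * indicator ?S h \<partial>lborel) < \<infinity>"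
  proof (rule nn_integral_dyadic_majorant_finite[where c = "\<lambda>j. 2 powr (- (real j * (?n + 2 * s)))"
        and \<rho> = "\<lambda>j. 2 powr (real j + 1)"])
    fix h :: 'a
    assume "h \<in> ?S"
    then have "1 \<le> norm h" by simp
    then obtain j :: nat where j: "2 powr j \<le> norm h" "norm h < 2 powr (real j + 1)"
      by (rule dyadic_bounds)
    have "min 1 ((norm h)\<^sup>2) / norm h powr (?n + 2 * s) \<le> 1 / (2 powr j) powr (?n + 2 * s)"
      using j s by (intro frac_le powr_mono2) auto
    also have "\<dots> = 2 powr (- (real j * (?n + 2 * s)))"
      by (simp add: powr_powr powr_minus divide_inverse)
    finally have "?f h \<le> ennreal (2 powr (- (real j * (?n + 2 * s))))"
      by (rule ennreal_leI)
    with j(2) show "\<exists>j. h \<in> ball 0 (2 powr (real j + 1)) \<and> ?f h \<le> ennreal (2 powr (- (real j * (?n + 2 * s))))"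
      by auto
  next
    have *: "(\<lambda>j. 2 powr (- (real j * (?n + 2 * s))) * (2 powr (real j + 1)) ^ DIM('a)) =
        (\<lambda>j. 2 powr ?n * 2 powr (- (2 * s) * real j))"
      unfolding pw powr_add[symmetric] by (simp add: algebra_simps)
    show "summable (\<lambda>j. 2 powr (- (real j * (?n + 2 * s))) * (2 powr (real j + 1)) ^ DIM('a))"
      unfolding * by (rule geo) (use s in simp)
  qed auto
  have inner: "(\<integral>\<^sup>+h. ?f h * indicator (- ?S) h \<partial>lborel) < \<infinity>"
  proof (rule nn_integral_dyadic_majorant_finite[where
        c = "\<lambda>j. 2 powr (- (2 * real j) + (real j + 1) * (?n + 2 * s))"
        and \<rho> = "\<lambda>j. 2 powr (1 - real j)"])
    fix h :: 'a
    assume "h \<in> - ?S"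
    show "\<exists>j. h \<in> ball 0 (2 powr (1 - real j)) \<and>
        ?f h \<le> ennreal (2 powr (- (2 * real j) + (real j + 1) * (?n + 2 * s)))"
    proof (cases "h = 0")
      case False
      with \<open>h \<in> - ?S\<close> have h: "0 < norm h" "1 \<le> 1 / norm h"
        by auto
      obtain j :: nat where j: "2 powr j \<le> 1 / norm h" "1 / norm h < 2 powr (real j + 1)"
        using h(2) by (rule dyadic_bounds)
      have up: "norm h \<le> 2 powr (- real j)"
        using j(1) h(1) by (simp add: powr_minus field_simps)
      have lo: "2 powr (- (real j + 1)) \<le> norm h"
        using j(2) h(1) unfolding powr_minus_divide by (simp add: field_simps)
      have "min 1 ((norm h)\<^sup>2) / norm h powr (?n + 2 * s) \<le>
          (2 powr (- real j))\<^sup>2 / (2 powr (- (real j + 1))) powr (?n + 2 * s)"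
        using up lo s by (intro frac_le powr_mono2 order_trans[OF min.cobounded2] power_mono) auto
      also have "\<dots> = 2 powr (- (2 * real j) + (real j + 1) * (?n + 2 * s))"
        by (simp add: powr_powr powr_realpow[symmetric] powr_diff[symmetric] algebra_simps)
      finally have "?f h \<le> ennreal (2 powr (- (2 * real j) + (real j + 1) * (?n + 2 * s)))"
        by (rule ennreal_leI)
      moreover have "2 powr (- real j) < 2 powr (1 - real j)"
        by (intro powr_less_mono) auto
      with up have "norm h < 2 powr (1 - real j)"
        by (rule le_less_trans)
      ultimately show ?thesis
        by auto
    qed (auto intro!: exI[of _ 0])
  next
    have *: "(\<lambda>j. 2 powr (- (2 * real j) + (real j + 1) * (?n + 2 * s)) * (2 powr (1 - real j)) ^ DIM('a)) =
        (\<lambda>j. 2 powr (2 * ?n + 2 * s) * 2 powr (- (2 - 2 * s) * real j))"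
      unfolding pw powr_add[symmetric] by (simp add: algebra_simps)
    show "summable (\<lambda>j. 2 powr (- (2 * real j) + (real j + 1) * (?n + 2 * s)) * (2 powr (1 - real j)) ^ DIM('a))"
      unfolding * by (rule geo) (use s in simp)
  qed auto
  have "(\<integral>\<^sup>+h. ?f h \<partial>lborel) = (\<integral>\<^sup>+h. ?f h * indicator ?S h + ?f h * indicator (- ?S) h \<partial>lborel)"
    by (intro nn_integral_cong) (auto simp: indicator_def)
  also have "\<dots> = (\<integral>\<^sup>+h. ?f h * indicator ?S h \<partial>lborel) + (\<integral>\<^sup>+h. ?f h * indicator (- ?S) h \<partial>lborel)"
    by (intro nn_integral_add) auto
  also have "\<dots> < \<infinity>"
    using outer inner by simp
  finally show ?thesis .
qed

definition gagliardo_kernel ::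
    "real \<Rightarrow> ('a::euclidean_space \<Rightarrow> real) \<Rightarrow> ('a \<Rightarrow> real) \<Rightarrow> 'a \<times> 'a \<Rightarrow> real" where
  "gagliardo_kernel s u v = (\<lambda>(x, y). (u x - u y) * (v x - v y) / norm (x - y) powr (real DIM('a) + 2 * s))"

lemma borel_measurable_fst_snd:
  "(fst :: 'a::euclidean_space \<times> 'b::euclidean_space \<Rightarrow> 'a) \<in> borel_measurable borel"
  "(snd :: 'a::euclidean_space \<times> 'b::euclidean_space \<Rightarrow> 'b) \<in> borel_measurable borel"
  by (auto intro!: borel_measurable_continuous_onI continuous_intros)

lemma gagliardo_kernel_measurable:
  fixes u v :: "'a::euclidean_space \<Rightarrow> real"
  assumes [measurable]: "u \<in> borel_measurable borel" "v \<in> borel_measurable borel"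
  shows "gagliardo_kernel s u v \<in> borel_measurable borel"
proof -
  note [measurable] = borel_measurable_fst_snd[where 'a='a and 'b='a]
  show ?thesis
    unfolding gagliardo_kernel_def split_beta by measurable
qed

lemma gagliardo_kernel_nonneg: "0 \<le> gagliardo_kernel s u u z"
  by (simp add: gagliardo_kernel_def split_beta)

text \<open>
  In the variables \<open>x\<close> and \<open>h = y - x\<close>, the inner integral over \<open>x\<close> is bounded by a constant
  times \<open>min 1 ((norm h)\<^sup>2)\<close>: for large \<open>h\<close> trivially, for small \<open>h\<close> by the translation estimate.
\<close>

lemma gagliardo_kernel_integrable:
  fixes u :: "'a::euclidean_space \<Rightarrow> real"
  assumes uG: "H10_pair \<Omega> u G" and s: "0 < s" "s < 1"
  shows "integrable lborel (gagliardo_kernel s u u)"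
proof (rule integrableI_nonneg)
  note [measurable] = H10_pair_measurable[OF uG]
  note fin = H10_pair_finite[OF uG]
  have [measurable]: "gagliardo_kernel s u u \<in> borel_measurable borel"
    by (rule gagliardo_kernel_measurable) measurable
  show "gagliardo_kernel s u u \<in> borel_measurable lborel" by measurable
  show "AE z in lborel. 0 \<le> gagliardo_kernel s u u z"
    by (simp add: gagliardo_kernel_nonneg)
  have pair: "(\<lambda>z. ennreal (gagliardo_kernel s u u z)) \<in> borel_measurable (lborel \<Otimes>\<^sub>M lborel)"
    unfolding lborel_prod by measurable
  let ?k = "\<lambda>h::'a. norm h powr (real DIM('a) + 2 * s)"
  let ?C = "4 * l2sq u + 4 * l2sq G"
  have shift: "l2sq (\<lambda>x. u (x + h) - u x) \<le> ?C * ennreal (min 1 ((norm h)\<^sup>2))" for h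
  proof (cases "(norm h)\<^sup>2 \<le> 1")
    case True
    have "l2sq (\<lambda>x. u (x + h) - u x) \<le> 4 * ennreal ((norm h)\<^sup>2) * l2sq G"
      by (rule H10_pair_translation_estimate[OF uG])
    also have "\<dots> = 4 * l2sq G * ennreal ((norm h)\<^sup>2)"
      by (simp add: mult_ac)
    also have "\<dots> \<le> ?C * ennreal ((norm h)\<^sup>2)"
      by (intro mult_right_mono) auto
    finally show ?thesis
      using True by (simp add: min_def)
  next
    case False
    have "l2sq (\<lambda>x. u (x + h) - u x) \<le> 2 * l2sq (\<lambda>x. u (x + h)) + 2 * l2sq u"
      by (rule l2sq_diff) measurable
    also have "\<dots> \<le> 2 * l2sq u + 2 * l2sq u"
      using l2sq_affine_le[of u 1 h] by (intro add_mono mult_left_mono) (auto simp: add.commute)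
    also have "\<dots> = 4 * l2sq u"
      by (simp flip: distrib_right)
    also have "\<dots> \<le> ?C"
      by simp
    finally show ?thesis
      using False by (simp add: min_def)
  qed
  have "(\<integral>\<^sup>+z. ennreal (gagliardo_kernel s u u z) \<partial>lborel) =
      (\<integral>\<^sup>+x. \<integral>\<^sup>+y. ennreal (gagliardo_kernel s u u (x, y)) \<partial>lborel \<partial>lborel)"
    unfolding lborel_prod[symmetric] by (rule lborel.nn_integral_fst[OF pair, symmetric])
  also have "\<dots> = (\<integral>\<^sup>+x. \<integral>\<^sup>+h. ennreal (gagliardo_kernel s u u (x, x + h)) \<partial>lborel \<partial>lborel)"
  proof (rule nn_integral_cong)
    fix x
    have "(\<lambda>y. ennreal (gagliardo_kernel s u u (x, y))) \<in> borel_measurable borel"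
      by measurable
    from nn_integral_affine[OF this, of 1 x]
    show "(\<integral>\<^sup>+y. ennreal (gagliardo_kernel s u u (x, y)) \<partial>lborel) =
        (\<integral>\<^sup>+h. ennreal (gagliardo_kernel s u u (x, x + h)) \<partial>lborel)"
      by simp
  qed
  also have "\<dots> = (\<integral>\<^sup>+h. \<integral>\<^sup>+x. ennreal (gagliardo_kernel s u u (x, x + h)) \<partial>lborel \<partial>lborel)"
    by (rule lborel_pair.Fubini') measurable
  also have "\<dots> \<le> (\<integral>\<^sup>+h. ?C * ennreal (min 1 ((norm h)\<^sup>2) / ?k h) \<partial>lborel)"
  proof (rule nn_integral_mono)
    fix h :: 'a
    have "(\<integral>\<^sup>+x. ennreal (gagliardo_kernel s u u (x, x + h)) \<partial>lborel) =
        (\<integral>\<^sup>+x. ennreal (1 / ?k h) * ennreal ((norm (u (x + h) - u x))\<^sup>2) \<partial>lborel)"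
    proof (rule nn_integral_cong)
      fix x
      have "(u x - u (x + h)) * (u x - u (x + h)) = (norm (u (x + h) - u x))\<^sup>2"
        by (simp add: power2_eq_square algebra_simps)
      then have "gagliardo_kernel s u u (x, x + h) = 1 / ?k h * (norm (u (x + h) - u x))\<^sup>2"
        by (simp add: gagliardo_kernel_def)
      then show "ennreal (gagliardo_kernel s u u (x, x + h)) = ennreal (1 / ?k h) * ennreal ((norm (u (x + h) - u x))\<^sup>2)"
        by (simp only: ennreal_mult zero_le_divide_1_iff powr_ge_zero zero_le_power2)
    qed
    also have "\<dots> = ennreal (1 / ?k h) * l2sq (\<lambda>x. u (x + h) - u x)"
      by (simp add: nn_integral_cmult l2sq_def)
    also have "\<dots> \<le> ennreal (1 / ?k h) * (?C * ennreal (min 1 ((norm h)\<^sup>2)))"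
      by (intro mult_left_mono shift) auto
    also have "\<dots> = ?C * ennreal (min 1 ((norm h)\<^sup>2) / ?k h)"
    proof -
      have "ennreal (min 1 ((norm h)\<^sup>2) / ?k h) = ennreal (1 / ?k h) * ennreal (min 1 ((norm h)\<^sup>2))"
        by (subst ennreal_mult[symmetric]) auto
      then show ?thesis
        by (simp add: mult_ac)
    qed
    finally show "(\<integral>\<^sup>+x. ennreal (gagliardo_kernel s u u (x, x + h)) \<partial>lborel)
        \<le> ?C * ennreal (min 1 ((norm h)\<^sup>2) / ?k h)" .
  qed
  also have "\<dots> = ?C * (\<integral>\<^sup>+h. ennreal (min 1 ((norm h)\<^sup>2) / ?k h) \<partial>lborel)"
    by (rule nn_integral_cmult) measurable
  also have "\<dots> < \<infinity>"
    using fin nn_integral_fractional_kernel_finite[OF s, where 'a='a]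
    by (simp add: ennreal_mult_less_top)
  finally show "(\<integral>\<^sup>+z. ennreal (gagliardo_kernel s u u z) \<partial>lborel) < \<infinity>" .
qed

lemma gagliardo_kernel_scaling:
  fixes u :: "'a::euclidean_space \<Rightarrow> real" and c :: 'a
  assumes [measurable]: "u \<in> borel_measurable borel" and t: "0 < t"
  defines "v \<equiv> (\<lambda>x. u (c + t *\<^sub>R x))"
  shows "(LINT z|lborel. gagliardo_kernel s v v z) =
    t powr (2 * s - real DIM('a)) * (LINT z|lborel. gagliardo_kernel s u u z)"
proof -
  let ?n = "real DIM('a)"
  have [measurable]: "gagliardo_kernel s u u \<in> borel_measurable borel"
    by (rule gagliardo_kernel_measurable) measurable
  have eq: "gagliardo_kernel s v v z = t powr (?n + 2 * s) * gagliardo_kernel s u u ((c, c) + t *\<^sub>R z)" for z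
  proof (cases z)
    case (Pair x y)
    have "norm (t *\<^sub>R x - t *\<^sub>R y) = t * norm (x - y)"
      using t by (simp flip: scaleR_diff_right)
    then show ?thesis
      using t by (simp add: Pair gagliardo_kernel_def v_def powr_mult)
  qed
  have "(LINT z|lborel. gagliardo_kernel s u u z) =
      t ^ DIM('a \<times> 'a) * (LINT z|lborel. gagliardo_kernel s u u ((c, c) + t *\<^sub>R z))"
    using lborel_integral_affine[of "gagliardo_kernel s u u" t "(c, c)"] t by simp
  then have "t powr (2 * s - ?n) * (LINT z|lborel. gagliardo_kernel s u u z) =
      (t powr (2 * s - ?n) * t powr (2 * ?n)) * (LINT z|lborel. gagliardo_kernel s u u ((c, c) + t *\<^sub>R z))"
    using t by (simp add: powr_realpow[symmetric])
  also have "t powr (2 * s - ?n) * t powr (2 * ?n) = t powr (?n + 2 * s)"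
    by (simp add: powr_add[symmetric] algebra_simps)
  finally show ?thesis
    by (simp add: eq)
qed

text \<open>
  The Cauchy-Schwarz inequality in the form with a free parameter. Pointwise domination by
  an integrable nonnegative function suffices, because the Lebesgue integral of a function
  that is not integrable is \<open>0\<close>.
\<close>

lemma gagliardo_kernel_mixed_le:
  assumes "integrable lborel (gagliardo_kernel s u u)" "integrable lborel (gagliardo_kernel s v v)" "0 < c"
  shows "(LINT z|lborel. gagliardo_kernel s u v z) \<le>
    (c * (LINT z|lborel. gagliardo_kernel s u u z) + (LINT z|lborel. gagliardo_kernel s v v z) / c) / 2"
proof -
  have "gagliardo_kernel s u v z \<le> (c * gagliardo_kernel s u u z + gagliardo_kernel s v v z / c) / 2" for z
  proof (cases z)
    case (Pair x y)
    define A where "A = u x - u y"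
    define B where "B = v x - v y"
    define k where "k = norm (x - y) powr (real DIM('a) + 2 * s)"
    have "0 \<le> (c * A - B)\<^sup>2 / c"
      using assms(3) by simp
    then have "A * B \<le> (c * (A * A) + B * B / c) / 2"
      using assms(3) by (simp add: power2_eq_square field_simps)
    then have "A * B / k \<le> (c * (A * A) + B * B / c) / 2 / k"
      by (rule divide_right_mono) (simp add: k_def)
    also have "\<dots> = (c * (A * A / k) + B * B / k / c) / 2"
      by (simp add: add_divide_distrib mult_ac)
    finally show ?thesis
      by (simp add: Pair gagliardo_kernel_def A_def B_def k_def)
  qed
  moreover have "0 \<le> (c * gagliardo_kernel s u u z + gagliardo_kernel s v v z / c) / 2" for z
    using assms(3) gagliardo_kernel_nonneg[of s u z] gagliardo_kernel_nonneg[of s v z] by simp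
  ultimately have "(LINT z|lborel. gagliardo_kernel s u v z) \<le>
      (LINT z|lborel. (c * gagliardo_kernel s u u z + gagliardo_kernel s v v z / c) / 2)"
    using assms by (intro integral_mono') auto
  also have "\<dots> = (c * (LINT z|lborel. gagliardo_kernel s u u z) + (LINT z|lborel. gagliardo_kernel s v v z) / c) / 2"
    using assms by simp
  finally show ?thesis .
qed

lemma AE_lborel_fst_snd:
  fixes P :: "'a::euclidean_space \<Rightarrow> bool"
  assumes "AE x in lborel. P x"
  shows "AE z in lborel. P (fst z) \<and> P (snd (z :: 'a \<times> 'a))"
proof -
  note [measurable] = borel_measurable_fst_snd[where 'a='a and 'b='a]
  obtain N where N: "{x \<in> space lborel. \<not> P x} \<subseteq> N" "emeasure lborel N = 0" "N \<in> sets lborel"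
    using assms by (rule AE_E)
  then have [measurable]: "N \<in> sets borel" by simp
  have ae: "AE x in lborel. x \<notin> N"
    using N by (intro AE_not_in) auto
  have "AE z in lborel \<Otimes>\<^sub>M lborel. fst z \<notin> N \<and> snd z \<notin> N"
  proof (rule lborel_pair.AE_pair_measure)
    show "{z \<in> space (lborel \<Otimes>\<^sub>M lborel). fst z \<notin> N \<and> snd z \<notin> N} \<in> sets (lborel \<Otimes>\<^sub>M lborel)"
      by measurable
    show "AE x in lborel. AE y in lborel. fst (x, y) \<notin> N \<and> snd (x, y) \<notin> N"
      using ae by eventually_elim (use ae in auto)
  qed
  then have "AE z in (lborel :: ('a \<times> 'a) measure). fst z \<notin> N \<and> snd z \<notin> N"
    by (simp only: lborel_prod)
  then show ?thesis
    by eventually_elim (use N(1) in auto)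
qed

lemma nonlocal_form_eq:
  assumes "AE x in lborel. u x = u' x" "AE x in lborel. v x = v' x"
    and [measurable]: "u' \<in> borel_measurable borel" "v' \<in> borel_measurable borel"
  shows "nonlocal_form s u v = (LINT z|lborel. gagliardo_kernel s u' v' z)"
proof -
  have "nonlocal_form s u v = (LINT z|lebesgue. gagliardo_kernel s u v z)"
    by (simp add: nonlocal_form_def gagliardo_kernel_def)
  also have "\<dots> = (LINT z|lborel. gagliardo_kernel s u' v' z)"
  proof (rule lebesgue_integral_AE_eq_borel)
    show "gagliardo_kernel s u' v' \<in> borel_measurable borel"
      by (rule gagliardo_kernel_measurable) measurable
    show "AE z in lborel. gagliardo_kernel s u v z = gagliardo_kernel s u' v' z"
      using AE_lborel_fst_snd[OF assms(1)] AE_lborel_fst_snd[OF assms(2)]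
      by eventually_elim (simp add: gagliardo_kernel_def split_beta)
  qed
  finally show ?thesis .
qed

text \<open>
  Vanishing of the double integral makes \<open>u\<close> constant almost everywhere, and the complement
  of a bounded set, where \<open>u = 0\<close>, is not a null set.
\<close>

lemma gagliardo_zero_imp_zero:
  fixes u :: "'a::euclidean_space \<Rightarrow> real"
  assumes [measurable]: "u \<in> borel_measurable borel"
    and int: "integrable lborel (gagliardo_kernel s u u)"
    and zero: "(LINT z|lborel. gagliardo_kernel s u u z) \<le> 0"
    and bd: "bounded \<Omega>" and out: "\<And>x. x \<notin> \<Omega> \<Longrightarrow> u x = 0"
  shows "AE x in lborel. u x = 0"
proof -
  have "(LINT z|lborel. gagliardo_kernel s u u z) = 0"
    using zero by (intro antisym Bochner_Integration.integral_nonneg gagliardo_kernel_nonneg)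
  then have "AE z in lborel. gagliardo_kernel s u u z = 0"
    using int by (subst (asm) integral_nonneg_eq_0_iff_AE) (auto simp: gagliardo_kernel_nonneg)
  then have "AE z in lborel \<Otimes>\<^sub>M lborel. gagliardo_kernel s u u z = 0"
    by (simp only: lborel_prod)
  then have "AE x in lborel. AE y in lborel. gagliardo_kernel s u u (x, y) = 0"
    by (rule lborel_pair.AE_pair)
  then show ?thesis
  proof eventually_elim
    case (elim x)
    have "\<exists>y. y \<notin> \<Omega> \<and> y \<noteq> x \<and> gagliardo_kernel s u u (x, y) = 0"
    proof (rule ccontr)
      assume "\<not> ?thesis"
      with elim have "AE y in lborel. y \<in> insert x \<Omega>"
        by (auto elim: eventually_mono)
      then obtain N where N: "{y. y \<notin> insert x \<Omega>} \<subseteq> N" "emeasure lborel N = 0" "N \<in> sets lborel"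
        by (auto elim!: AE_E)
      obtain r where r: "insert x \<Omega> \<subseteq> ball 0 r" "0 < r"
        using bounded_subset_ballD[of "insert x \<Omega>" 0] bd by auto
      obtain b :: 'a where b: "b \<in> Basis" using nonempty_Basis by blast
      \<comment> \<open>A ball of positive volume outside \<open>insert x \<Omega>\<close>.\<close>
      have "ball ((2 * r) *\<^sub>R b) r \<subseteq> N"
      proof
        fix y
        assume "y \<in> ball ((2 * r) *\<^sub>R b) r"
        then have "dist ((2 * r) *\<^sub>R b) y < r" by simp
        moreover have "norm ((2 * r) *\<^sub>R b) = 2 * r"
          using b r by simp
        ultimately have "r \<le> norm y"
          using norm_triangle_ineq2[of "(2 * r) *\<^sub>R b" y] by (simp add: dist_norm)
        with r(1) have "y \<notin> insert x \<Omega>"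
          by (auto simp: subset_iff)
        with N(1) show "y \<in> N" by blast
      qed
      then have "emeasure lborel (ball ((2 * r) *\<^sub>R b) r) = 0"
        using N emeasure_mono[of "ball ((2 * r) *\<^sub>R b) r" N lborel] by simp
      moreover have "0 < measure lborel (ball ((2 * r) *\<^sub>R b) r)"
        using r content_ball_pos by auto
      ultimately show False
        by (simp add: measure_def)
    qed
    then obtain y where y: "y \<notin> \<Omega>" "y \<noteq> x" "gagliardo_kernel s u u (x, y) = 0"
      by blast
    then show "u x = 0"
      using out[OF y(1)] by (simp add: gagliardo_kernel_def)
  qed
qed

section \<open>Higher integrability of solutions\<close>

text \<open>
  The recursion with equality has the characteristic roots \<open>x\<close> and \<open>1 - x\<close>. If
  \<open>B (Suc j) - x * B j\<close> were positive once, it would from then on shrink at most by the factor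
  \<open>1 - x > 1 / 2\<close> in each step, which the assumed decay \<open>C / 2 ^ j\<close> excludes.
\<close>

lemma second_order_decay:
  fixes B :: "nat \<Rightarrow> real"
  assumes x: "0 < x" "x < 1 / 2" and nonneg: "\<And>j. 0 \<le> B j"
    and rec: "\<And>j. B (Suc j) \<le> B (Suc (Suc j)) + x * (1 - x) * B j"
    and dec: "\<And>j. B j \<le> C / 2 ^ j"
  shows "B j \<le> x ^ j * B 0"
proof -
  define d where "d = (\<lambda>j. B (Suc j) - x * B j)"
  have d_rec: "(1 - x) * d j \<le> d (Suc j)" for j
    using rec[of j] by (simp add: d_def algebra_simps)
  have d_grow: "(1 - x) ^ k * d j \<le> d (j + k)" for j k
  proof (induction k)
    case (Suc k)
    have "(1 - x) * ((1 - x) ^ k * d j) \<le> (1 - x) * d (j + k)"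
      using x by (intro mult_left_mono Suc) auto
    also have "\<dots> \<le> d (j + Suc k)"
      using d_rec[of "j + k"] by simp
    finally show ?case by (simp add: mult.assoc)
  qed simp
  have "d j \<le> 0" for j
  proof (rule ccontr)
    assume "\<not> d j \<le> 0"
    then have dj: "0 < d j" by simp
    have C: "0 \<le> C"
      using order_trans[OF nonneg[of 0] dec[of 0]] by simp
    have "1 < 2 * (1 - x)"
      using x by simp
    then obtain k where k: "C / d j < (2 * (1 - x)) ^ k"
      using real_arch_pow by blast
    have "(1 - x) ^ k * d j \<le> B (Suc (j + k))"
      using d_grow[of k j] x nonneg[of "j + k"] by (simp add: d_def) (smt (verit) mult_nonneg_nonneg)
    also have "\<dots> \<le> C / 2 ^ Suc (j + k)"
      by (rule dec)
    also have "\<dots> \<le> C / 2 ^ k"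
      using C by (intro divide_left_mono power_increasing) auto
    finally have "2 ^ k * ((1 - x) ^ k * d j) \<le> C"
      by (simp add: field_simps)
    then have "(2 * (1 - x)) ^ k * d j \<le> C"
      by (simp only: power_mult_distrib mult.assoc)
    with k dj show False
      by (simp add: field_simps)
  qed
  then have step: "B (Suc j) \<le> x * B j" for j
    by (simp add: d_def)
  show ?thesis
  proof (induction j)
    case (Suc j)
    have "B (Suc j) \<le> x * B j"
      by (rule step)
    also have "\<dots> \<le> x * (x ^ j * B 0)"
      using x by (intro mult_left_mono Suc) auto
    finally show ?case
      by (simp add: mult.assoc)
  qed simp
qed

text \<open>
  The weak equation for a Borel representative: a nonnegative function that vanishes
  identically outside \<open>\<Omega>\<close>, with integrals over the whole space.
\<close>

locale brezis_nirenberg_solution =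
  fixes \<Omega> :: "'a::euclidean_space set" and s lam p q :: real
    and u :: "'a \<Rightarrow> real" and G :: "'a \<Rightarrow> 'a"
  assumes dim: "3 \<le> DIM('a)" and s: "0 < s" "s < 1" and lam: "lam \<le> 0"
    and q_eq: "q = 2 * real DIM('a) / (real DIM('a) - 2)"
    and p: "1 \<le> p" "p < q - 1"
    and \<Omega>: "open \<Omega>" "bounded \<Omega>"
    and uG: "H10_pair \<Omega> u G" and u_nonneg: "0 \<le> u x" and u_outside: "x \<notin> \<Omega> \<Longrightarrow> u x = 0"
    and weak: "H10_pair \<Omega> v H \<Longrightarrow>
      (LINT x|lborel. G x \<bullet> H x) + (LINT z|lborel. gagliardo_kernel s u v z) =
      (LINT x|lborel. (u x powr (q - 1) + lam * u x powr p) * v x)"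
begin

lemma q_gt: "2 < q" "p + 1 < q"
  using dim p by (auto simp: q_eq field_simps)

lemma u_measurable [measurable]: "u \<in> borel_measurable borel"
  and G_measurable [measurable]: "G \<in> borel_measurable borel"
  using H10_pair_measurable[OF uG] by auto

lemma \<Omega>_measurable [measurable]: "\<Omega> \<in> sets borel"
  using \<Omega> by simp

lemma integrable_indicator_\<Omega>: "integrable lborel (indicator \<Omega> :: 'a \<Rightarrow> real)"
  using emeasure_bounded_finite[OF \<Omega>(2)] by (intro integrable_real_indicator) (auto simp: less_top)

lemma integrable_norm_G: "integrable lborel (\<lambda>x. (norm (G x))\<^sup>2)"
  using l2sq_integral(1)[OF _ H10_pair_finite(2)[OF uG]] by simp

lemma kernel_integrable: "integrable lborel (gagliardo_kernel s u u)"
  by (rule gagliardo_kernel_integrable[OF uG s])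

lemma power_split: "0 < r \<Longrightarrow> (u x powr r) * u x = u x powr (r + 1)"
  using u_nonneg[of x] by (cases "u x = 0") (auto simp: powr_add)

lemma energy_identity:
  "(LINT x|lborel. (norm (G x))\<^sup>2) + (LINT z|lborel. gagliardo_kernel s u u z) =
     (LINT x|lborel. u x powr q + lam * u x powr (p + 1))"
proof -
  have "(u x powr (q - 1) + lam * u x powr p) * u x = u x powr q + lam * u x powr (p + 1)" for x
    using power_split[of "q - 1" x] power_split[of p x] q_gt p by (simp add: algebra_simps)
  then show ?thesis
    using weak[OF uG] by (simp add: power2_norm_eq_inner)
qed

text \<open>
  Integrability comes from the equation tested with \<open>u\<close>. If the right-hand side were not integrable, its Lebesgue integral would be \<open>0\<close> by
  convention, so both energies and with them \<open>u\<close> would vanish. The term with \<open>lam\<close> is of lower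
  order and is absorbed up to a constant on the bounded set \<open>\<Omega>\<close>.
\<close>

lemma integrable_u_powr_q: "integrable lborel (\<lambda>x. u x powr q)"
proof -
  define w where "w = (\<lambda>x. u x powr q + lam * u x powr (p + 1))"
  have [measurable]: "w \<in> borel_measurable borel"
    by (simp add: w_def)
  have w: "integrable lborel w"
  proof (rule ccontr)
    assume n: "\<not> integrable lborel w"
    then have "(LINT x|lborel. w x) = 0"
      by (rule not_integrable_integral_eq)
    moreover have "0 \<le> (LINT x|lborel. (norm (G x))\<^sup>2)"
      by simp
    ultimately have "(LINT z|lborel. gagliardo_kernel s u u z) \<le> 0"
      using energy_identity unfolding w_def by linarith
    then have "AE x in lborel. u x = 0"
      using kernel_integrable \<Omega> u_outside by (intro gagliardo_zero_imp_zero[where \<Omega> = \<Omega>]) auto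
    then have "AE x in lborel. w x = 0"
      by eventually_elim (simp add: w_def)
    then have "integrable lborel w \<longleftrightarrow> integrable lborel (\<lambda>x::'a. 0 :: real)"
      by (intro integrable_cong_AE) auto
    with n show False by simp
  qed
  \<comment> \<open>Above the height \<open>U\<close>, half of the critical power dominates the subcritical term.\<close>
  define U where "U = (2 * \<bar>lam\<bar>) powr (1 / (q - (p + 1)))"
  define C where "C = \<bar>lam\<bar> * U powr (p + 1)"
  have C: "0 \<le> C" by (simp add: C_def)
  have absorb: "\<bar>lam\<bar> * z powr (p + 1) \<le> z powr q / 2 + C" if "0 \<le> z" for z
  proof (cases "z \<le> U")
    case True
    then have "\<bar>lam\<bar> * z powr (p + 1) \<le> C"
      unfolding C_def using that p by (intro mult_left_mono powr_mono2) auto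
    then show ?thesis
      using powr_ge_zero[of z q] by linarith
  next
    case False
    moreover have "0 \<le> U"
      by (simp add: U_def)
    ultimately have zU: "U \<le> z" "0 < z"
      by linarith+
    have "2 * \<bar>lam\<bar> = U powr (q - (p + 1))"
      using q_gt by (simp add: U_def powr_powr)
    also have "\<dots> \<le> z powr (q - (p + 1))"
      using zU q_gt by (intro powr_mono2) (auto simp: U_def)
    finally have "2 * \<bar>lam\<bar> * z powr (p + 1) \<le> z powr (q - (p + 1)) * z powr (p + 1)"
      by (intro mult_right_mono) auto
    also have "\<dots> = z powr q"
      using zU by (simp add: powr_add[symmetric])
    finally show ?thesis
      using C by linarith
  qed
  show ?thesis
  proof (rule Bochner_Integration.integrable_bound)
    show "integrable lborel (\<lambda>x. 2 * \<bar>w x\<bar> + 2 * C * indicator \<Omega> x)"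
      using w integrable_indicator_\<Omega> by (intro Bochner_Integration.integrable_add integrable_mult_right integrable_abs)
    show "AE x in lborel. norm (u x powr q) \<le> norm (2 * \<bar>w x\<bar> + 2 * C * indicator \<Omega> x)"
    proof (rule AE_I2)
      fix x
      have "\<bar>lam\<bar> = - lam" using lam by simp
      then have "u x powr q / 2 - C \<le> w x"
        using absorb[OF u_nonneg[of x]] by (simp add: w_def)
      then have "u x powr q \<le> 2 * \<bar>w x\<bar> + 2 * C * indicator \<Omega> x" if "x \<in> \<Omega>"
        using that by simp
      moreover have "u x powr q \<le> 2 * \<bar>w x\<bar> + 2 * C * indicator \<Omega> x" if "x \<notin> \<Omega>"
        using u_outside[OF that] by (simp add: that)
      ultimately show "norm (u x powr q) \<le> norm (2 * \<bar>w x\<bar> + 2 * C * indicator \<Omega> x)"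
        by fastforce
    qed
  qed simp
qed

lemma integrable_u_powr:
  assumes "0 < r" "r \<le> q"
  shows "integrable lborel (\<lambda>x. u x powr r)"
proof (rule Bochner_Integration.integrable_bound)
  show "integrable lborel (\<lambda>x. indicator \<Omega> x + u x powr q)"
    using integrable_u_powr_q integrable_indicator_\<Omega> by simp
  show "AE x in lborel. norm (u x powr r) \<le> norm (indicator \<Omega> x + u x powr q)"
  proof (rule AE_I2)
    fix x
    consider "x \<notin> \<Omega>" | "x \<in> \<Omega>" "u x \<le> 1" | "1 \<le> u x" by linarith
    then have "u x powr r \<le> indicator \<Omega> x + u x powr q"
    proof cases
      case 2
      then have "u x powr r \<le> 1"
        using powr_mono2[of r "u x" 1] u_nonneg[of x] assms by simp
      with 2 show ?thesis
        by (simp add: add_increasing2)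
    next
      case 3
      then show ?thesis
        using assms by (intro order_trans[OF powr_mono[of r q]]) auto
    qed (simp add: u_outside)
    then show "norm (u x powr r) \<le> norm (indicator \<Omega> x + u x powr q)"
      by simp
  qed
qed simp

definition tail :: "real \<Rightarrow> real" where
  "tail k = (LINT x|lborel. u x powr (q - 1) * indicator {x. k \<le> u x} x)"

lemma integrable_tail: "integrable lborel (\<lambda>x. u x powr (q - 1) * indicator {x. k \<le> u x} x)"
  using integrable_mult_indicator[of "{x. k \<le> u x}" lborel "\<lambda>x. u x powr (q - 1)"]
    integrable_u_powr[of "q - 1"] q_gt by (simp add: mult.commute)

lemma integrable_tail_q: "integrable lborel (\<lambda>x. u x powr q * indicator {x. k \<le> u x} x)"
  using integrable_mult_indicator[of "{x. k \<le> u x}" lborel "\<lambda>x. u x powr q"]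
    integrable_u_powr_q by (simp add: mult.commute)

text \<open>
  The truncation \<open>\<theta>\<close> vanishes up to \<open>k\<close>, is at most \<open>k\<close>, and has slope between \<open>0\<close> and \<open>1\<close>. As
  it is nondecreasing, the nonlocal form of \<open>u\<close> and \<open>\<theta> u\<close> is nonnegative, and the square of
  its slope is at most its slope.
\<close>

lemma truncated_energy:
  assumes k: "0 < k"
  obtains H where "H10_pair \<Omega> (\<lambda>x. k * flat (u x / k - 1)) H" "l2sq H \<le> ennreal (k * tail k)"
proof -
  define \<theta> where "\<theta> = (\<lambda>z. k * flat (z / k - 1))"
  define \<theta>' where "\<theta>' = (\<lambda>z. flat (z / k - 1) / (z / k - 1)\<^sup>2)"
  have \<theta>': "0 \<le> \<theta>' z" "\<theta>' z \<le> 1" for z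
    by (auto simp: \<theta>'_def flat_nonneg flat_derivative_le_1)
  have \<theta>: "0 \<le> \<theta> z" "\<theta> z \<le> k" "z \<le> k \<Longrightarrow> \<theta> z = 0" for z
    using k by (auto simp: \<theta>_def flat_nonneg flat_le_1 flat_eq_0 mult_left_le)
  have \<theta>_mono: "\<theta> y \<le> \<theta> z" if "y \<le> z" for y z
    using that k by (auto simp: \<theta>_def intro!: mult_left_mono flat_mono divide_right_mono)
  have pair: "H10_pair \<Omega> (\<lambda>x. \<theta> (u x)) (\<lambda>x. \<theta>' (u x) *\<^sub>R G x)"
  proof (rule H10_pair_compose[OF uG])
    show "Ck j \<theta>" for j
    proof -
      have "Ck j (\<lambda>z::real. k * flat (z \<bullet> (1 / k) + (-1)))"
        by (intro Ck_mult Ck_const Ck_compose_real[OF Ck_flat Ck_inner])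
      then show ?thesis by (simp add: \<theta>_def)
    qed
    show "(\<theta> has_real_derivative \<theta>' z) (at z)" for z
    proof -
      have "((\<lambda>z. z / k - 1) has_real_derivative 1 / k) (at z)"
        using k by (auto intro!: derivative_eq_intros)
      from DERIV_chain2[OF flat_has_derivative this]
      have "(\<theta> has_real_derivative k * (\<theta>' z * (1 / k))) (at z)"
        unfolding \<theta>_def \<theta>'_def by (rule DERIV_cmult)
      with k show ?thesis by simp
    qed
    show "\<theta> 0 = 0" "\<bar>\<theta>' z\<bar> \<le> 1" for z
      using \<theta>(3)[of 0] \<theta>'[of z] k by auto
  qed
  note [measurable] = H10_pair_measurable[OF pair]
  have [measurable]: "\<theta>' \<in> borel_measurable borel"
    unfolding \<theta>'_def flat_def by measurable
  have int1: "integrable lborel (\<lambda>x. \<theta>' (u x) * (norm (G x))\<^sup>2)"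
    by (rule Bochner_Integration.integrable_bound[OF integrable_norm_G])
      (auto simp: abs_mult \<theta>' intro!: mult_left_le_one_le)
  have int2: "integrable lborel (\<lambda>x. (norm (\<theta>' (u x) *\<^sub>R G x))\<^sup>2)"
    using H10_pair_finite(2)[OF pair] by (intro l2sq_integral) auto
  have "(LINT x|lborel. (norm (\<theta>' (u x) *\<^sub>R G x))\<^sup>2) \<le> (LINT x|lborel. \<theta>' (u x) * (norm (G x))\<^sup>2)"
  proof (rule integral_mono[OF int2 int1])
    fix x
    have "(\<theta>' (u x))\<^sup>2 \<le> \<theta>' (u x)"
      using \<theta>'[of "u x"] by (simp add: power2_eq_square mult_left_le)
    then show "(norm (\<theta>' (u x) *\<^sub>R G x))\<^sup>2 \<le> \<theta>' (u x) * (norm (G x))\<^sup>2"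
      by (simp add: power_mult_distrib mult_right_mono)
  qed
  also have "\<dots> = (LINT x|lborel. G x \<bullet> (\<theta>' (u x) *\<^sub>R G x))"
    by (simp add: power2_norm_eq_inner)
  also have "\<dots> \<le> (LINT x|lborel. G x \<bullet> (\<theta>' (u x) *\<^sub>R G x)) + (LINT z|lborel. gagliardo_kernel s u (\<lambda>x. \<theta> (u x)) z)"
  proof -
    have "0 \<le> gagliardo_kernel s u (\<lambda>x. \<theta> (u x)) z" for z
    proof -
      have "0 \<le> (u x - u y) * (\<theta> (u x) - \<theta> (u y))" for x y
        using \<theta>_mono[of "u x" "u y"] \<theta>_mono[of "u y" "u x"]
        by (cases "u x \<le> u y") (auto intro: mult_nonpos_nonpos mult_nonneg_nonneg)
      then show ?thesis
        by (auto simp: gagliardo_kernel_def split: prod.split)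
    qed
    then show ?thesis
      by simp
  qed
  also have "\<dots> = (LINT x|lborel. (u x powr (q - 1) + lam * u x powr p) * \<theta> (u x))"
    by (rule weak[OF pair])
  also have "\<dots> \<le> (LINT x|lborel. k * (u x powr (q - 1) * indicator {x. k \<le> u x} x))"
  proof (rule integral_mono')
    show "integrable lborel (\<lambda>x. k * (u x powr (q - 1) * indicator {x. k \<le> u x} x))"
      using integrable_tail by simp
    fix x
    show "0 \<le> k * (u x powr (q - 1) * indicator {x. k \<le> u x} x)"
      using k by simp
    have "(u x powr (q - 1) + lam * u x powr p) * \<theta> (u x) \<le> u x powr (q - 1) * \<theta> (u x)"
      using \<theta>(1) lam by (intro mult_right_mono) (auto simp: mult_nonpos_nonneg)
    also have "\<dots> \<le> u x powr (q - 1) * (k * indicator {x. k \<le> u x} x)"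
      using \<theta> by (intro mult_left_mono) (auto simp: indicator_def)
    finally show "(u x powr (q - 1) + lam * u x powr p) * \<theta> (u x)
        \<le> k * (u x powr (q - 1) * indicator {x. k \<le> u x} x)"
      by (simp add: mult_ac)
  qed
  also have "\<dots> = k * tail k"
    by (simp add: tail_def)
  finally have "l2sq (\<lambda>x. \<theta>' (u x) *\<^sub>R G x) \<le> ennreal (k * tail k)"
    by (simp only: l2sq_integrable(1)[OF int2] ennreal_leI)
  with pair show thesis
    using that by (simp add: \<theta>_def)
qed

text \<open>
  The weak Sobolev inequality for the truncation at height \<open>k\<close> and level \<open>k / 6\<close>, which is
  exceeded only where \<open>k \<le> u\<close>, while \<open>2 * k \<le> u\<close> forces a value of at least \<open>k / 3\<close>. The critical
  exponent enters in \<open>2 * q / n = q - 2\<close>, which makes all powers of \<open>k\<close> combine to \<open>q - 1\<close>.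
\<close>

lemma level_set_estimate:
  assumes k: "0 < k" and \<eta>: "0 < \<eta>"
    and tail_q: "(LINT x|lborel. u x powr q * indicator {x. k \<le> u x} x) \<le> \<eta>"
  shows "k powr (q - 1) * measure lborel {x. 2 * k \<le> u x} \<le>
    288 * (2 * \<eta> / unit_ball_vol DIM('a)) powr (2 / DIM('a)) * tail k"
proof -
  let ?n = "real DIM('a)" and ?\<omega> = "unit_ball_vol DIM('a)"
  have n: "0 < ?n" by simp
  have \<omega>: "0 < ?\<omega>" by simp
  note \<omega>0 = less_imp_neq[OF \<omega>, THEN not_sym]
  obtain H where H: "H10_pair \<Omega> (\<lambda>x. k * flat (u x / k - 1)) H" "l2sq H \<le> ennreal (k * tail k)"
    by (rule truncated_energy[OF k])
  have level: "emeasure lborel {x. k \<le> u x} \<le> ennreal (\<eta> / k powr q)"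
  proof -
    have "ennreal (k powr q) * emeasure lborel {x. k \<le> u x} =
        (\<integral>\<^sup>+x. ennreal (k powr q) * indicator {x. k \<le> u x} x \<partial>lborel)"
      by (simp add: nn_integral_cmult_indicator)
    also have "\<dots> \<le> (\<integral>\<^sup>+x. ennreal (u x powr q * indicator {x. k \<le> u x} x) \<partial>lborel)"
      using k q_gt by (intro nn_integral_mono) (auto simp: indicator_def intro!: ennreal_leI powr_mono2)
    also have "\<dots> = ennreal (LINT x|lborel. u x powr q * indicator {x. k \<le> u x} x)"
      by (intro nn_integral_eq_integral integrable_tail_q) auto
    also have "\<dots> \<le> ennreal \<eta>"
      by (intro ennreal_leI tail_q)
    finally have "ennreal (1 / k powr q) * (ennreal (k powr q) * emeasure lborel {x. k \<le> u x}) \<le> ennreal (1 / k powr q) * ennreal \<eta>"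
      by (rule mult_left_mono) simp
    then show ?thesis
      using k \<eta> by (simp add: mult.assoc[symmetric] ennreal_mult[symmetric])
  qed
  \<comment> \<open>The radius for which twice the bound \<open>\<eta> / k powr q\<close> for the measure of \<open>{k \<le> u}\<close> is the volume of the ball.\<close>
  define r where "r = (2 * \<eta> / (?\<omega> * k powr q)) powr (1 / ?n)"
  have r: "0 < r"
    using \<eta> k \<omega>0 by (simp add: r_def)
  have rn: "r ^ DIM('a) = 2 * \<eta> / (?\<omega> * k powr q)"
    unfolding r_def using \<eta> k \<omega> n by (subst powr_realpow[symmetric]) (auto simp: powr_powr \<omega>0)
  have r2: "r\<^sup>2 = (2 * \<eta> / ?\<omega>) powr (2 / ?n) * k powr (2 - q)"
  proof -
    have "r\<^sup>2 = (2 * \<eta> / (?\<omega> * k powr q)) powr (2 / ?n)"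
      unfolding r_def using \<eta> k \<omega> by (subst powr_realpow[symmetric]) (auto simp: powr_powr \<omega>0)
    also have "2 * \<eta> / (?\<omega> * k powr q) = (2 * \<eta> / ?\<omega>) * k powr (- q)"
      by (simp add: powr_minus divide_inverse)
    also have "\<dots> powr (2 / ?n) = (2 * \<eta> / ?\<omega>) powr (2 / ?n) * k powr (- q * (2 / ?n))"
      using \<eta> \<omega> by (subst powr_mult) (auto simp: powr_powr)
    also have "- q * (2 / ?n) = 2 - q"
      using dim by (simp add: q_eq field_simps)
    finally show ?thesis .
  qed
  have "emeasure lborel {x. k / 6 < k * flat (u x / k - 1)} \<le> emeasure lborel {x. k \<le> u x}"
  proof (intro emeasure_mono subsetI CollectI)
    fix x
    assume "x \<in> {x. k / 6 < k * flat (u x / k - 1)}"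
    then have "flat (u x / k - 1) \<noteq> 0"
      using k by auto
    then show "k \<le> u x"
      using k by (simp add: flat_pos_iff field_simps)
  qed simp
  then have "2 * emeasure lborel {x. k / 6 < k * flat (u x / k - 1)} \<le> 2 * ennreal (\<eta> / k powr q)"
    using level by (intro mult_left_mono) auto
  also have "\<dots> = emeasure lborel (ball (0::'a) r)"
    using r \<omega>0 k \<eta> by (simp add: emeasure_ball rn ennreal_mult[symmetric] flip: ennreal_numeral)
  finally have half: "2 * emeasure lborel {x. k / 6 < k * flat (u x / k - 1)} \<le> emeasure lborel (ball (0::'a) r)" .
  have "emeasure lborel {x. 2 * k \<le> u x} \<le> emeasure lborel {x. 2 * (k / 6) \<le> k * flat (u x / k - 1)}"
  proof (rule emeasure_mono)
    show "{x. 2 * k \<le> u x} \<subseteq> {x. 2 * (k / 6) \<le> k * flat (u x / k - 1)}"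
    proof
      fix x
      assume "x \<in> {x. 2 * k \<le> u x}"
      then have "1 \<le> u x / k - 1"
        using k by (simp add: field_simps)
      then have "k * (1 / 3) \<le> k * flat (u x / k - 1)"
        using k by (intro mult_left_mono flat_ge) auto
      then show "x \<in> {x. 2 * (k / 6) \<le> k * flat (u x / k - 1)}"
        by simp
    qed
    show "{x. 2 * (k / 6) \<le> k * flat (u x / k - 1)} \<in> sets lborel"
      using H10_pair_measurable(1)[OF H(1)] by measurable
  qed
  then have "ennreal (k\<^sup>2 / 36) * emeasure lborel {x. 2 * k \<le> u x} \<le>
      ennreal ((k / 6)\<^sup>2) * emeasure lborel {x. 2 * (k / 6) \<le> k * flat (u x / k - 1)}"
    by (simp add: power_divide mult_left_mono)
  also have "\<dots> \<le> ennreal (8 * r\<^sup>2) * l2sq H"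
    using r k half by (intro weak_Sobolev[OF H(1)]) auto
  also have "\<dots> \<le> ennreal (8 * r\<^sup>2) * ennreal (k * tail k)"
    by (intro mult_left_mono H(2)) auto
  finally have le: "ennreal (k\<^sup>2 / 36) * emeasure lborel {x. 2 * k \<le> u x} \<le> ennreal (8 * r\<^sup>2) * ennreal (k * tail k)" .
  have tail0: "0 \<le> tail k"
    by (simp add: tail_def)
  have "emeasure lborel {x. 2 * k \<le> u x} \<le> emeasure lborel {x. k \<le> u x}"
    using k by (intro emeasure_mono) auto
  also have "\<dots> < \<infinity>"
    using level by (auto intro: le_less_trans)
  finally have "emeasure lborel {x. 2 * k \<le> u x} = ennreal (measure lborel {x. 2 * k \<le> u x})"
    by (intro emeasure_eq_ennreal_measure) auto
  with le have "ennreal (k\<^sup>2 / 36 * measure lborel {x. 2 * k \<le> u x}) \<le> ennreal (8 * r\<^sup>2 * (k * tail k))"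
    using k tail0 by (simp add: ennreal_mult[symmetric])
  then have "k\<^sup>2 / 36 * measure lborel {x. 2 * k \<le> u x} \<le> 8 * r\<^sup>2 * (k * tail k)"
    using k tail0 by (subst (asm) ennreal_le_iff) auto
  then have "k * measure lborel {x. 2 * k \<le> u x} \<le> 288 * r\<^sup>2 * tail k"
    using k by (simp add: power2_eq_square field_simps)
  then have "k powr (q - 2) * (k * measure lborel {x. 2 * k \<le> u x}) \<le> k powr (q - 2) * (288 * r\<^sup>2 * tail k)"
    by (rule mult_left_mono) simp
  also have "\<dots> = 288 * (k powr (q - 2) * r\<^sup>2) * tail k"
    by (simp only: mult_ac)
  also have "k powr (q - 2) * r\<^sup>2 = (2 * \<eta> / ?\<omega>) powr (2 / ?n)"
    using k powr_add[of k "q - 2" "2 - q"] by (simp add: r2)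
  also have "k powr (q - 2) * (k * measure lborel {x. 2 * k \<le> u x}) =
      k powr (q - 1) * measure lborel {x. 2 * k \<le> u x}"
    using k powr_add[of k "q - 2" 1] by simp
  finally show ?thesis .
qed

lemma integral_above_level_tendsto_0:
  fixes f :: "'a \<Rightarrow> real"
  assumes f: "integrable lborel f"
  shows "(\<lambda>j. LINT x|lborel. f x * indicator {real j..} (u x)) \<longlonglongrightarrow> 0"
proof -
  have [measurable]: "f \<in> borel_measurable borel"
    using f by auto
  have "(\<lambda>j. LINT x|lborel. f x * indicator {real j..} (u x)) \<longlonglongrightarrow> (LINT (x::'a)|lborel. 0)"
  proof (rule integral_dominated_convergence[where w = "\<lambda>x. norm (f x)"])
    show "AE x in lborel. (\<lambda>j. f x * indicator {real j..} (u x)) \<longlonglongrightarrow> 0"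
    proof (rule AE_I2)
      fix x
      obtain m where m: "u x < real m"
        using reals_Archimedean2 by blast
      have "\<forall>\<^sub>F j in sequentially. f x * indicator {real j..} (u x) = 0"
        using eventually_ge_at_top[of m] by eventually_elim (use m in auto)
      then show "(\<lambda>j. f x * indicator {real j..} (u x)) \<longlonglongrightarrow> 0"
        by (rule tendsto_eventually)
    qed
  qed (use f in \<open>auto simp: indicator_def\<close>)
  then show ?thesis by simp
qed

lemma small_level_sets:
  assumes \<delta>: "0 < \<delta>"
  obtains K where "0 < K"
    "\<And>k. K \<le> k \<Longrightarrow> k powr (q - 1) * measure lborel {x. 2 * k \<le> u x} \<le> \<delta> * tail k"
proof -
  let ?n = "real DIM('a)" and ?\<omega> = "unit_ball_vol DIM('a)"
  have \<omega>: "0 < ?\<omega>" by simp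
  note \<omega>0 = less_imp_neq[OF \<omega>, THEN not_sym]
  define \<eta> where "\<eta> = ?\<omega> / 2 * (\<delta> / 288) powr (?n / 2)"
  have \<eta>: "0 < \<eta>"
    using \<delta> \<omega> by (simp add: \<eta>_def)
  have "(2 * \<eta> / ?\<omega>) powr (2 / ?n) = \<delta> / 288"
    using \<delta> \<omega>0 by (simp add: \<eta>_def powr_powr)
  then have c: "288 * (2 * \<eta> / ?\<omega>) powr (2 / ?n) = \<delta>"
    by simp
  have "\<forall>\<^sub>F j in sequentially. (LINT x|lborel. u x powr q * indicator {x. real j \<le> u x} x) < \<eta>"
    using order_tendstoD(2)[OF integral_above_level_tendsto_0[OF integrable_u_powr_q] \<eta>]
    by (simp add: indicator_def)
  with eventually_gt_at_top[of 0] have "\<forall>\<^sub>F j in sequentially. 0 < j \<and> (LINT x|lborel. u x powr q * indicator {x. real j \<le> u x} x) < \<eta>"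
    by eventually_elim simp
  then obtain j :: nat where j: "0 < j" "(LINT x|lborel. u x powr q * indicator {x. real j \<le> u x} x) < \<eta>"
    by (auto simp: eventually_sequentially)
  show thesis
  proof (rule that[of "real j"])
    fix k
    assume k: "real j \<le> k"
    have "(LINT x|lborel. u x powr q * indicator {x. k \<le> u x} x) \<le>
        (LINT x|lborel. u x powr q * indicator {x. real j \<le> u x} x)"
      using k by (intro integral_mono integrable_tail_q) (auto simp: indicator_def)
    with j have "(LINT x|lborel. u x powr q * indicator {x. k \<le> u x} x) \<le> \<eta>"
      by simp
    then show "k powr (q - 1) * measure lborel {x. 2 * k \<le> u x} \<le> \<delta> * tail k"
      using level_set_estimate[of k \<eta>] k j \<eta> c by simp
  qed (use j in simp)
qed

lemma tail_nonneg: "0 \<le> tail k"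
  by (simp add: tail_def)

lemma tail_le: "0 < k \<Longrightarrow> tail k \<le> (LINT x|lborel. u x powr q) / k"
proof -
  assume k: "0 < k"
  have "tail k \<le> (LINT x|lborel. u x powr q / k)"
    unfolding tail_def
  proof (intro integral_mono integrable_tail)
    show "integrable lborel (\<lambda>x. u x powr q / k)"
      using integrable_u_powr_q by simp
    fix x
    show "u x powr (q - 1) * indicator {x. k \<le> u x} x \<le> u x powr q / k"
    proof (cases "k \<le> u x")
      case True
      then have "u x powr (q - 1) * k \<le> u x powr (q - 1) * u x"
        by (intro mult_left_mono) auto
      also have "\<dots> = u x powr q"
        using power_split[of "q - 1" x] q_gt by simp
      finally show ?thesis
        using True k by (simp add: field_simps)
    qed (use k in simp)
  qed
  then show ?thesis by simp
qed

lemma measure_level_finite: "0 < k \<Longrightarrow> emeasure lborel {x. k \<le> u x} < \<infinity>"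
proof -
  assume "0 < k"
  then have "{x. k \<le> u x} \<subseteq> \<Omega>"
    using u_outside by force
  then have "emeasure lborel {x. k \<le> u x} \<le> emeasure lborel \<Omega>"
    by (intro emeasure_mono) auto
  also have "\<dots> < \<infinity>"
    using emeasure_bounded_finite[OF \<Omega>(2)] .
  finally show ?thesis .
qed

lemma tail_step:
  assumes k: "0 < k"
  shows "tail (2 * k) \<le> tail (4 * k) + (4 * k) powr (q - 1) * measure lborel {x. 2 * k \<le> u x}"
proof -
  have i: "integrable lborel (\<lambda>x. (4 * k) powr (q - 1) * indicator {x. 2 * k \<le> u x} x)"
    using measure_level_finite[of "2 * k"] k
    by (intro integrable_mult_right integrable_real_indicator) auto
  have "tail (2 * k) \<le> (LINT x|lborel. u x powr (q - 1) * indicator {x. 4 * k \<le> u x} x +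
      (4 * k) powr (q - 1) * indicator {x. 2 * k \<le> u x} x)"
    unfolding tail_def
  proof (intro integral_mono integrable_tail Bochner_Integration.integrable_add i)
    fix x
    have "u x powr (q - 1) \<le> (4 * k) powr (q - 1)" if "u x \<le> 4 * k"
      using that u_nonneg[of x] q_gt by (intro powr_mono2) auto
    then show "u x powr (q - 1) * indicator {x. 2 * k \<le> u x} x \<le>
        u x powr (q - 1) * indicator {x. 4 * k \<le> u x} x + (4 * k) powr (q - 1) * indicator {x. 2 * k \<le> u x} x"
      by (auto simp: indicator_def)
  qed
  also have "\<dots> = tail (4 * k) + (4 * k) powr (q - 1) * measure lborel {x. 2 * k \<le> u x}"
    using i integrable_tail[of "4 * k"] by (simp add: tail_def)
  finally show ?thesis .
qed

text \<open>
  The rate \<open>x\<close> of decay of the dyadic tails is chosen such that it beats the growth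
  \<open>2 powr (q - 1)\<close> of the weights by a factor \<open>4\<close>.
\<close>

lemma integrable_u_powr_2q: "integrable lborel (\<lambda>x. u x powr (2 * (q - 1)))"
proof -
  define x where "x = 2 powr (- (q - 1)) / 4"
  have x: "0 < x" "x < 1 / 2"
  proof -
    have "2 powr (- (q - 1)) < 2 powr (0 :: real)"
      using q_gt by (intro powr_less_mono) auto
    then show "0 < x" "x < 1 / 2"
      by (auto simp: x_def)
  qed
  \<comment> \<open>The factor \<open>4 powr (q - 1)\<close> is lost between \<open>k\<close> and the height \<open>4 * k\<close> in \<open>tail_step\<close>.\<close>
  define \<delta> where "\<delta> = x * (1 - x) / 4 powr (q - 1)"
  have "0 < \<delta>"
    using x by (simp add: \<delta>_def)
  then obtain K where K: "0 < K" and level: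
    "\<And>k. K \<le> k \<Longrightarrow> k powr (q - 1) * measure lborel {x. 2 * k \<le> u x} \<le> \<delta> * tail k"
    by (rule small_level_sets) blast
  define B where "B = (\<lambda>j. tail (K * 2 ^ j))"
  have decay: "B j \<le> x ^ j * B 0" for j
  proof (rule second_order_decay[OF x])
    show "0 \<le> B j" for j
      by (simp add: B_def tail_nonneg)
    show "B j \<le> (LINT x|lborel. u x powr q) / K / 2 ^ j" for j
      using tail_le[of "K * 2 ^ j"] K by (simp add: B_def)
    show "B (Suc j) \<le> B (Suc (Suc j)) + x * (1 - x) * B j" for j
    proof -
      define k where "k = K * 2 ^ j"
      have k: "K \<le> k" "0 < k"
        using K by (auto simp: k_def)
      have "(4 * k) powr (q - 1) * measure lborel {x. 2 * k \<le> u x} =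
          4 powr (q - 1) * (k powr (q - 1) * measure lborel {x. 2 * k \<le> u x})"
        using k by (simp add: powr_mult)
      also have "\<dots> \<le> 4 powr (q - 1) * (\<delta> * tail k)"
        by (intro mult_left_mono level k) auto
      also have "\<dots> = x * (1 - x) * tail k"
        by (simp add: \<delta>_def)
      finally have "tail (2 * k) \<le> tail (4 * k) + x * (1 - x) * tail k"
        using tail_step[OF k(2)] by linarith
      then show ?thesis
        by (simp add: B_def k_def mult_ac)
    qed
  qed
  define c where "c = (\<lambda>j. (K * 2 ^ Suc j) powr (q - 1))"
  have cB: "c j * B j \<le> (2 * K) powr (q - 1) * B 0 * (1 / 4) ^ j" for j
  proof -
    have c_eq: "c j = (2 * K) powr (q - 1) * (2 powr (q - 1)) ^ j"
    proof -
      have "c j = ((2 * K) * 2 ^ j) powr (q - 1)"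
        by (simp add: c_def mult_ac)
      also have "\<dots> = (2 * K) powr (q - 1) * (2 ^ j) powr (q - 1)"
        using K by (subst powr_mult) auto
      also have "(2 ^ j) powr (q - 1) = (2 powr (q - 1)) ^ j"
        by (simp add: powr_powr powr_realpow[symmetric] mult.commute)
      finally show ?thesis .
    qed
    have "c j * B j \<le> c j * (x ^ j * B 0)"
      by (intro mult_left_mono decay) (simp add: c_def)
    also have "\<dots> = (2 * K) powr (q - 1) * B 0 * ((2 powr (q - 1)) ^ j * x ^ j)"
      by (simp only: c_eq mult_ac)
    also have "(2 powr (q - 1)) ^ j * x ^ j = (1 / 4) ^ j"
    proof -
      have "2 powr (q - 1) * x = 1 / 4"
        by (simp add: x_def powr_add[symmetric])
      then show ?thesis
        by (simp only: power_mult_distrib[symmetric])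
    qed
    finally show ?thesis .
  qed
  have pt: "ennreal (u y powr (2 * (q - 1))) \<le> ennreal (K powr (q - 1) * u y powr (q - 1)) +
      (\<Sum>j. ennreal (c j * (u y powr (q - 1) * indicator {y. K * 2 ^ j \<le> u y} y)))" for y
  proof -
    have split: "u y powr (2 * (q - 1)) = u y powr (q - 1) * u y powr (q - 1)"
      by (simp add: powr_add[symmetric])
    show ?thesis
    proof (cases "u y \<le> K")
      case True
      then have "u y powr (2 * (q - 1)) \<le> K powr (q - 1) * u y powr (q - 1)"
        unfolding split using u_nonneg[of y] q_gt by (intro mult_right_mono powr_mono2) auto
      then show ?thesis
        by (intro add_increasing2 ennreal_leI) auto
    next
      case False
      then have "1 \<le> u y / K"
        using K by simp
      then obtain j :: nat where j: "2 powr j \<le> u y / K" "u y / K < 2 powr (real j + 1)"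
        by (rule dyadic_bounds)
      have j1: "K * 2 ^ j \<le> u y"
        using j(1) K by (simp add: powr_realpow field_simps)
      have j2: "u y \<le> K * 2 ^ Suc j"
        using j(2) K by (simp add: powr_add powr_realpow field_simps)
      have "u y powr (2 * (q - 1)) \<le> c j * u y powr (q - 1)"
        unfolding split c_def using j2 u_nonneg[of y] q_gt by (intro mult_right_mono powr_mono2) auto
      then have "ennreal (u y powr (2 * (q - 1))) \<le>
          (\<Sum>j\<in>{j}. ennreal (c j * (u y powr (q - 1) * indicator {y. K * 2 ^ j \<le> u y} y)))"
        using j1 by (auto intro: ennreal_leI)
      also have "\<dots> \<le> (\<Sum>j. ennreal (c j * (u y powr (q - 1) * indicator {y. K * 2 ^ j \<le> u y} y)))"
        by (intro sum_le_suminf summableI) auto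
      finally show ?thesis
        by (rule add_increasing[rotated]) simp
    qed
  qed
  have "(\<integral>\<^sup>+y. ennreal (u y powr (2 * (q - 1))) \<partial>lborel) \<le>
      (\<integral>\<^sup>+y. ennreal (K powr (q - 1) * u y powr (q - 1)) +
        (\<Sum>j. ennreal (c j * (u y powr (q - 1) * indicator {y. K * 2 ^ j \<le> u y} y))) \<partial>lborel)"
    by (intro nn_integral_mono pt)
  also have "\<dots> = (\<integral>\<^sup>+y. ennreal (K powr (q - 1) * u y powr (q - 1)) \<partial>lborel) +
      (\<Sum>j. \<integral>\<^sup>+y. ennreal (c j * (u y powr (q - 1) * indicator {y. K * 2 ^ j \<le> u y} y)) \<partial>lborel)"
    by (subst nn_integral_add) (auto simp: nn_integral_suminf)
  also have "(\<integral>\<^sup>+y. ennreal (K powr (q - 1) * u y powr (q - 1)) \<partial>lborel) =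
      ennreal (LINT y|lborel. K powr (q - 1) * u y powr (q - 1))"
    using integrable_u_powr[of "q - 1"] q_gt by (intro nn_integral_eq_integral) auto
  also have "(\<Sum>j. \<integral>\<^sup>+y. ennreal (c j * (u y powr (q - 1) * indicator {y. K * 2 ^ j \<le> u y} y)) \<partial>lborel) =
      (\<Sum>j. ennreal (c j * B j))"
  proof (rule suminf_cong)
    fix j
    have "(\<integral>\<^sup>+y. ennreal (c j * (u y powr (q - 1) * indicator {y. K * 2 ^ j \<le> u y} y)) \<partial>lborel) =
        ennreal (LINT y|lborel. c j * (u y powr (q - 1) * indicator {y. K * 2 ^ j \<le> u y} y))"
      by (intro nn_integral_eq_integral integrable_mult_right integrable_tail) (auto simp: c_def)
    then show "(\<integral>\<^sup>+y. ennreal (c j * (u y powr (q - 1) * indicator {y. K * 2 ^ j \<le> u y} y)) \<partial>lborel) =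
        ennreal (c j * B j)"
      by (simp add: B_def tail_def)
  qed
  also have "ennreal (LINT y|lborel. K powr (q - 1) * u y powr (q - 1)) + (\<Sum>j. ennreal (c j * B j)) \<le>
      ennreal (LINT y|lborel. K powr (q - 1) * u y powr (q - 1)) +
      ennreal (\<Sum>j. (2 * K) powr (q - 1) * B 0 * (1 / 4) ^ j)"
  proof (rule add_left_mono)
    have "(\<Sum>j. ennreal (c j * B j)) \<le> (\<Sum>j. ennreal ((2 * K) powr (q - 1) * B 0 * (1 / 4) ^ j))"
      by (intro suminf_le summableI ennreal_leI cB)
    also have "\<dots> = ennreal (\<Sum>j. (2 * K) powr (q - 1) * B 0 * (1 / 4) ^ j)"
      by (intro suminf_ennreal2 summable_mult summable_geometric) (auto simp: B_def tail_nonneg)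
    finally show "(\<Sum>j. ennreal (c j * B j)) \<le> ennreal (\<Sum>j. (2 * K) powr (q - 1) * B 0 * (1 / 4) ^ j)" .
  qed
  finally have "(\<integral>\<^sup>+y. ennreal (u y powr (2 * (q - 1))) \<partial>lborel) < \<infinity>"
    by (rule le_less_trans) simp
  then show ?thesis
    by (intro integrableI_nonneg) auto
qed

end

section \<open>The Pohozaev inequality\<close>

text \<open>
  The graph of a convex power lies above its tangent at \<open>b\<close>.
\<close>

lemma powr_tangent_le:
  fixes a b r :: real
  assumes "0 \<le> a" "0 \<le> b" "1 \<le> r"
  shows "b powr r - a powr r \<le> r * b powr (r - 1) * (b - a)"
proof -
  consider "a = b" | "b = 0" | "a = 0" "0 < b" | "0 < a" "a < b" | "0 < b" "b < a"
    using assms by linarith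
  then show ?thesis
  proof cases
    case 2
    then show ?thesis by simp
  next
    case 3
    have "1 * b powr r \<le> r * b powr r"
      using assms by (intro mult_right_mono) auto
    moreover have "b powr (r - 1) * b = b powr r"
      using 3 powr_add[of b "r - 1" 1] by simp
    ultimately show ?thesis
      using 3 by (simp add: mult.assoc)
  next
    case 4
    have "\<exists>z. a < z \<and> z < b \<and> b powr r - a powr r = (b - a) * (r * z powr (r - 1))"
      using 4 by (intro MVT2 has_real_derivative_powr) auto
    then obtain z where z: "a < z" "z < b" "b powr r - a powr r = (b - a) * (r * z powr (r - 1))"
      by blast
    have "(b - a) * (r * z powr (r - 1)) \<le> (b - a) * (r * b powr (r - 1))"
      using z 4 assms by (intro mult_left_mono powr_mono2) auto
    then show ?thesis
      by (simp add: z(3) mult_ac)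
  next
    case 5
    have "\<exists>z. b < z \<and> z < a \<and> a powr r - b powr r = (a - b) * (r * z powr (r - 1))"
      using 5 by (intro MVT2 has_real_derivative_powr) auto
    then obtain z where z: "b < z" "z < a" "a powr r - b powr r = (a - b) * (r * z powr (r - 1))"
      by blast
    have "(a - b) * (r * b powr (r - 1)) \<le> (a - b) * (r * z powr (r - 1))"
      using z 5 assms by (intro mult_left_mono powr_mono2) auto
    then show ?thesis
      using z(3) by (simp add: algebra_simps)
  qed simp
qed

lemma powr_increment_le:
  fixes a b r M :: real
  assumes "0 \<le> a" "a \<le> M" "0 \<le> b" "b \<le> M" "1 \<le> r"
  shows "(b powr r - a powr r) * (b - a) \<le> r * M powr (r - 1) * (b - a)\<^sup>2"
proof -
  have *: "(y powr r - x powr r) * (y - x) \<le> r * M powr (r - 1) * (y - x)\<^sup>2"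
    if "0 \<le> x" "x \<le> y" "y \<le> M" for x y
  proof -
    have "(y powr r - x powr r) * (y - x) \<le> (r * y powr (r - 1) * (y - x)) * (y - x)"
      using that assms by (intro mult_right_mono powr_tangent_le) auto
    also have "\<dots> \<le> (r * M powr (r - 1) * (y - x)) * (y - x)"
      using that assms by (intro mult_right_mono mult_left_mono powr_mono2) auto
    finally show ?thesis
      by (simp add: power2_eq_square mult_ac)
  qed
  show ?thesis
  proof (cases "a \<le> b")
    case True
    then show ?thesis using * assms by simp
  next
    case False
    then show ?thesis
      using *[of b a] assms by (simp add: power2_commute[of b a]) (simp add: algebra_simps)
  qed
qed

text \<open>
  Below the height \<open>M\<close> the function \<open>z powr (q - 1)\<close> is Lipschitz and the defect is quadratic.
  Above \<open>M\<close> the increment of \<open>z powr (q - 1)\<close> is bounded by its larger value, and the product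
  with \<open>\<bar>b - a\<bar>\<close> is split by Young's inequality with weight \<open>\<epsilon>\<close>.
\<close>

lemma powr_convexity_defect:
  fixes a b q M :: real
  assumes "0 \<le> a" "0 \<le> b" "2 \<le> q" "0 < \<epsilon>"
  shows "(b powr q - a powr q) / q \<le> a powr (q - 1) * (b - a) + ((q - 1) * M powr (q - 2) + \<epsilon>) * (b - a)\<^sup>2 +
    (a powr (2 * (q - 1)) * indicator {M..} a + b powr (2 * (q - 1)) * indicator {M..} b) / (2 * \<epsilon>)"
proof -
  define f where "f = (\<lambda>z::real. z powr (q - 1))"
  define g where "g = (\<lambda>z. f z * indicator {M..} z)"
  have f: "0 \<le> f z" for z
    by (simp add: f_def)
  have g: "0 \<le> g z" for z
    by (simp add: g_def f_def)
  have g2: "(g z)\<^sup>2 = z powr (2 * (q - 1)) * indicator {M..} z" for z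
    by (simp add: g_def f_def indicator_def power2_eq_square powr_add[symmetric])
  have f_mono: "f x \<le> f y" if "0 \<le> x" "x \<le> y" for x y
    using that assms by (auto simp: f_def intro: powr_mono2)
  have cr: "(f b - f a) * (b - a) \<le> (q - 1) * M powr (q - 2) * (b - a)\<^sup>2 + (g a + g b) * \<bar>b - a\<bar>"
  proof (cases "a \<le> M \<and> b \<le> M")
    case True
    then have "(f b - f a) * (b - a) \<le> (q - 1) * M powr (q - 2) * (b - a)\<^sup>2"
      using powr_increment_le[of a M b "q - 1"] assms by (simp add: f_def)
    moreover have "0 \<le> (g a + g b) * \<bar>b - a\<bar>"
      using g by simp
    ultimately show ?thesis by linarith
  next
    case False
    have "\<bar>f b - f a\<bar> \<le> g a + g b"
    proof (cases "a \<le> b")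
      case True
      then have "g b = f b"
        using False by (auto simp: g_def)
      then show ?thesis
        using f_mono[OF assms(1) True] f[of a] g[of a] by simp
    next
      case ba: False
      then have "g a = f a"
        using False by (auto simp: g_def)
      then show ?thesis
        using f_mono[of b a] ba assms f[of b] g[of b] by simp
    qed
    then have "\<bar>f b - f a\<bar> * \<bar>b - a\<bar> \<le> (g a + g b) * \<bar>b - a\<bar>"
      by (intro mult_right_mono) auto
    moreover have "(f b - f a) * (b - a) \<le> \<bar>f b - f a\<bar> * \<bar>b - a\<bar>"
      by (simp flip: abs_mult)
    moreover have "0 \<le> (q - 1) * M powr (q - 2) * (b - a)\<^sup>2"
      using assms by simp
    ultimately show ?thesis by linarith
  qed
  have young: "g z * \<bar>b - a\<bar> \<le> (g z)\<^sup>2 / (2 * \<epsilon>) + \<epsilon> / 2 * (b - a)\<^sup>2" for z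
  proof -
    have "0 \<le> (g z - \<epsilon> * \<bar>b - a\<bar>)\<^sup>2 / (2 * \<epsilon>)"
      using assms by simp
    also have "\<dots> = (g z)\<^sup>2 / (2 * \<epsilon>) + \<epsilon> / 2 * (b - a)\<^sup>2 - g z * \<bar>b - a\<bar>"
      using assms by (simp add: power2_eq_square field_simps)
    finally show ?thesis by simp
  qed
  have "(b powr q - a powr q) / q \<le> f b * (b - a)"
    using powr_tangent_le[of a b q] assms by (simp add: f_def field_simps)
  also have "\<dots> = f a * (b - a) + (f b - f a) * (b - a)"
    by (simp add: algebra_simps)
  also have "\<dots> \<le> f a * (b - a) + ((q - 1) * M powr (q - 2) * (b - a)\<^sup>2 +
      ((g a)\<^sup>2 / (2 * \<epsilon>) + \<epsilon> / 2 * (b - a)\<^sup>2) + ((g b)\<^sup>2 / (2 * \<epsilon>) + \<epsilon> / 2 * (b - a)\<^sup>2))"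
    using cr young[of a] young[of b] by (simp add: distrib_right)
  also have "\<dots> = f a * (b - a) + ((q - 1) * M powr (q - 2) + \<epsilon>) * (b - a)\<^sup>2 + ((g a)\<^sup>2 + (g b)\<^sup>2) / (2 * \<epsilon>)"
    by (simp add: distrib_right add_divide_distrib)
  finally show ?thesis
    by (simp add: g2) (simp add: f_def)
qed

context brezis_nirenberg_solution
begin

text \<open>
  The parameter in the Cauchy-Schwarz inequality is the square root of the scaling factor
  of the energy in question, which balances its two terms.
\<close>

lemma dilation_test:
  assumes t: "1 < t" and star: "\<And>x. a + t *\<^sub>R (x - a) \<in> \<Omega> \<Longrightarrow> x \<in> \<Omega>"
    and R: "0 \<le> R" "\<Omega> \<subseteq> cball a R"
  defines "v \<equiv> (\<lambda>x. u ((a - t *\<^sub>R a) + t *\<^sub>R x))"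
  shows "(LINT x|lborel. (u x powr (q - 1) + lam * u x powr p) * v x) \<le>
      t powr ((2 - real DIM('a)) / 2) * (LINT x|lborel. (norm (G x))\<^sup>2) +
      t powr ((2 * s - real DIM('a)) / 2) * (LINT z|lborel. gagliardo_kernel s u u z)"
    and "integrable lborel (\<lambda>x. (v x - u x)\<^sup>2)"
    and "(LINT x|lborel. (v x - u x)\<^sup>2) \<le> 4 * ((t - 1) * R)\<^sup>2 * (LINT x|lborel. (norm (G x))\<^sup>2)"
proof -
  let ?n = "real DIM('a)"
  define c where "c = a - t *\<^sub>R a"
  define H where "H = (\<lambda>x. t *\<^sub>R G (c + t *\<^sub>R x))"
  have v: "v = (\<lambda>x. u (c + t *\<^sub>R x))"
    by (simp add: v_def c_def)
  have t0: "0 < t" "t \<noteq> 0" using t by auto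
  have vH: "H10_pair \<Omega> v H"
    unfolding v H_def using t star by (intro H10_pair_affine[OF uG]) (auto simp: c_def algebra_simps)
  note [measurable] = H10_pair_measurable[OF vH]
  have "(LINT x|lborel. (norm (G x))\<^sup>2) = t ^ DIM('a) * (LINT x|lborel. (norm (G (c + t *\<^sub>R x)))\<^sup>2)"
    using lborel_integral_affine[of "\<lambda>x. (norm (G x))\<^sup>2" t c] t0 by simp
  then have "t powr (2 - ?n) * (LINT x|lborel. (norm (G x))\<^sup>2) =
      (t powr (2 - ?n) * t powr ?n) * (LINT x|lborel. (norm (G (c + t *\<^sub>R x)))\<^sup>2)"
    using t0 by (simp add: powr_realpow)
  also have "t powr (2 - ?n) * t powr ?n = t\<^sup>2"
    using t0 by (simp add: powr_add[symmetric] powr_numeral)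
  finally have E1: "(LINT x|lborel. (norm (H x))\<^sup>2) = t powr (2 - ?n) * (LINT x|lborel. (norm (G x))\<^sup>2)"
    by (simp add: H_def power_mult_distrib)
  have iH: "integrable lborel (\<lambda>x. (norm (H x))\<^sup>2)"
    using H10_pair_finite(2)[OF vH] by (intro l2sq_integral) auto
  have "(LINT x|lborel. G x \<bullet> H x) \<le>
      (LINT x|lborel. (t powr ((2 - ?n) / 2) * (norm (G x))\<^sup>2 + (norm (H x))\<^sup>2 / t powr ((2 - ?n) / 2)) / 2)"
  proof (rule integral_mono')
    let ?c = "t powr ((2 - ?n) / 2)"
    have c0: "0 < ?c" using t0 by simp
    show "integrable lborel (\<lambda>x. (?c * (norm (G x))\<^sup>2 + (norm (H x))\<^sup>2 / ?c) / 2)"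
      using integrable_norm_G iH by simp
    fix x
    show "0 \<le> (?c * (norm (G x))\<^sup>2 + (norm (H x))\<^sup>2 / ?c) / 2"
      using c0 by simp
    have "0 \<le> (?c * norm (G x) - norm (H x))\<^sup>2 / (2 * ?c)"
      using c0 by simp
    also have "\<dots> = (?c * (norm (G x))\<^sup>2 + (norm (H x))\<^sup>2 / ?c) / 2 - norm (G x) * norm (H x)"
      using c0 by (simp add: power2_eq_square field_simps)
    finally show "G x \<bullet> H x \<le> (?c * (norm (G x))\<^sup>2 + (norm (H x))\<^sup>2 / ?c) / 2"
      using norm_cauchy_schwarz[of "G x" "H x"] by linarith
  qed
  also have "\<dots> = (t powr ((2 - ?n) / 2) * (LINT x|lborel. (norm (G x))\<^sup>2) +
      (LINT x|lborel. (norm (H x))\<^sup>2) / t powr ((2 - ?n) / 2)) / 2"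
    using integrable_norm_G iH by simp
  also have "\<dots> = t powr ((2 - ?n) / 2) * (LINT x|lborel. (norm (G x))\<^sup>2)"
    unfolding E1 times_divide_eq_left[symmetric] powr_diff[symmetric] by (simp add: field_simps)
  finally have local: "(LINT x|lborel. G x \<bullet> H x) \<le> t powr ((2 - ?n) / 2) * (LINT x|lborel. (norm (G x))\<^sup>2)" .
  have "(LINT z|lborel. gagliardo_kernel s u v z) \<le>
      (t powr ((2 * s - ?n) / 2) * (LINT z|lborel. gagliardo_kernel s u u z) +
       (LINT z|lborel. gagliardo_kernel s v v z) / t powr ((2 * s - ?n) / 2)) / 2"
    using t0 by (intro gagliardo_kernel_mixed_le kernel_integrable gagliardo_kernel_integrable[OF vH s]) simp
  also have "\<dots> = t powr ((2 * s - ?n) / 2) * (LINT z|lborel. gagliardo_kernel s u u z)"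
    unfolding v gagliardo_kernel_scaling[OF u_measurable t0(1)] times_divide_eq_left[symmetric] powr_diff[symmetric]
    by (simp add: field_simps)
  finally show "(LINT x|lborel. (u x powr (q - 1) + lam * u x powr p) * v x) \<le>
      t powr ((2 - ?n) / 2) * (LINT x|lborel. (norm (G x))\<^sup>2) +
      t powr ((2 * s - ?n) / 2) * (LINT z|lborel. gagliardo_kernel s u u z)"
    unfolding weak[OF vH, symmetric] using local by (intro add_mono)
  have "l2sq (\<lambda>x. u (x + ((t - 1) *\<^sub>R x + - (t - 1) *\<^sub>R a)) - u x) \<le> 4 * ennreal (((t - 1) * R)\<^sup>2) * l2sq G"
  proof (rule H10_pair_flow_estimate[OF uG])
    show "0 \<le> t - 1" "0 \<le> (t - 1) * R"
      using t R by auto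
    fix x and \<sigma> :: real
    assume \<sigma>: "0 \<le> \<sigma>" "\<sigma> \<le> 1" and "x + \<sigma> *\<^sub>R ((t - 1) *\<^sub>R x + - (t - 1) *\<^sub>R a) \<in> \<Omega>"
    moreover have "x + \<sigma> *\<^sub>R ((t - 1) *\<^sub>R x + - (t - 1) *\<^sub>R a) = a + (1 + \<sigma> * (t - 1)) *\<^sub>R (x - a)"
      by (simp add: algebra_simps)
    ultimately have "(1 + \<sigma> * (t - 1)) * norm (x - a) \<le> R"
      using R(2) t by (auto simp: subset_iff dist_norm)
    moreover have "1 * norm (x - a) \<le> (1 + \<sigma> * (t - 1)) * norm (x - a)"
      using \<sigma> t by (intro mult_right_mono) auto
    ultimately have "norm (x - a) \<le> R"
      by linarith
    moreover have "(t - 1) *\<^sub>R x + - (t - 1) *\<^sub>R a = (t - 1) *\<^sub>R (x - a)"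
      by (simp add: algebra_simps)
    ultimately show "norm ((t - 1) *\<^sub>R x + - (t - 1) *\<^sub>R a) \<le> (t - 1) * R"
      using t by (simp add: mult_left_mono)
  qed
  moreover have "(\<lambda>x. u (x + ((t - 1) *\<^sub>R x + - (t - 1) *\<^sub>R a)) - u x) = (\<lambda>x. v x - u x)"
    by (simp add: v_def algebra_simps)
  ultimately have l2: "l2sq (\<lambda>x. v x - u x) \<le> 4 * ennreal (((t - 1) * R)\<^sup>2) * l2sq G"
    by simp
  also have "\<dots> = ennreal (4 * ((t - 1) * R)\<^sup>2 * (LINT x|lborel. (norm (G x))\<^sup>2))"
    using l2sq_integrable(1)[OF integrable_norm_G] by (simp add: ennreal_mult)
  finally have l2: "l2sq (\<lambda>x. v x - u x) \<le> ennreal (4 * ((t - 1) * R)\<^sup>2 * (LINT x|lborel. (norm (G x))\<^sup>2))" .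
  then have fin: "l2sq (\<lambda>x. v x - u x) < \<infinity>"
    by (rule le_less_trans) simp
  show "integrable lborel (\<lambda>x. (v x - u x)\<^sup>2)"
    using l2sq_integral(1)[OF _ fin] by simp
  show "(LINT x|lborel. (v x - u x)\<^sup>2) \<le> 4 * ((t - 1) * R)\<^sup>2 * (LINT x|lborel. (norm (G x))\<^sup>2)"
    using l2 l2sq_integral(2)[OF _ fin] by (subst (asm) l2sq_integral(2)[OF _ fin]) (auto simp: ennreal_le_iff)
qed

text \<open>
  The error consists of a part that is quadratic in \<open>t - 1\<close>, with a constant depending on \<open>M\<close>,
  and a part that is linear in \<open>t - 1\<close>, with a coefficient that can be made small by choosing
  \<open>\<epsilon>\<close> small and then \<open>M\<close> large. The term with \<open>lam \<le> 0\<close> has the favourable sign in the convexity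
  inequality and produces no error.
\<close>

lemma dilation_lower_bound:
  fixes a :: 'a and M :: real
  assumes t: "1 < t" and \<epsilon>: "0 < \<epsilon>"
  defines "v \<equiv> (\<lambda>x. u ((a - t *\<^sub>R a) + t *\<^sub>R x))"
  assumes d: "integrable lborel (\<lambda>x. (v x - u x)\<^sup>2)" "(LINT x|lborel. (v x - u x)\<^sup>2) \<le> D * (t - 1)\<^sup>2"
  defines "J \<equiv> (LINT x|lborel. u x powr q) / q + lam * (LINT x|lborel. u x powr (p + 1)) / (p + 1)"
    and "W \<equiv> (LINT x|lborel. u x powr (2 * (q - 1)) * indicator {M..} (u x))"
  shows "(LINT x|lborel. u x powr q + lam * u x powr (p + 1)) + (t powr (- real DIM('a)) - 1) * J
      - (t - 1) * ((q - 1) * M powr (q - 2) * D * (t - 1) + \<epsilon> * D + W / \<epsilon>)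
    \<le> (LINT x|lborel. (u x powr (q - 1) + lam * u x powr p) * v x)"
proof -
  let ?n = "real DIM('a)"
  define c where "c = a - t *\<^sub>R a"
  have v: "v = (\<lambda>x. u (c + t *\<^sub>R x))"
    by (simp add: v_def c_def)
  have [measurable]: "v \<in> borel_measurable borel"
    by (simp add: v)
  have v0: "0 \<le> v x" for x
    by (simp add: v u_nonneg)
  define m where "m = t powr (- ?n)"
  have t0: "0 < t" "t \<noteq> 0" using t by auto
  have dil: "integrable lborel (\<lambda>x. f (v x))" "(LINT x|lborel. f (v x)) = m * (LINT x|lborel. f (u x))"
    if "integrable lborel (\<lambda>x. f (u x))" for f :: "real \<Rightarrow> real"
  proof -
    show "integrable lborel (\<lambda>x. f (v x))"
      unfolding v using lborel_integrable_affine[OF that t0(2)] by simp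
    have "(LINT x|lborel. f (u x)) = t powr ?n * (LINT x|lborel. f (v x))"
      using lborel_integral_affine[of "\<lambda>x. f (u x)" t c] that t0 by (simp add: v powr_realpow)
    then show "(LINT x|lborel. f (v x)) = m * (LINT x|lborel. f (u x))"
      using t0 by (simp add: m_def mult.assoc[symmetric] powr_add[symmetric])
  qed
  have m: "0 \<le> m" "m \<le> 1"
    using t powr_mono[of "- ?n" 0 t] by (auto simp: m_def)
  define \<gamma> where "\<gamma> = (\<lambda>z. z powr (2 * (q - 1)) * indicator {M..} z)"
  have [measurable]: "\<gamma> \<in> borel_measurable borel"
    by (simp add: \<gamma>_def)
  have iu: "integrable lborel (\<lambda>x. u x powr q)" "integrable lborel (\<lambda>x. u x powr (p + 1))"
    using integrable_u_powr q_gt p by auto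
  have i\<gamma>: "integrable lborel (\<lambda>x. \<gamma> (u x))"
    by (rule Bochner_Integration.integrable_bound[OF integrable_u_powr_2q]) (auto simp: \<gamma>_def indicator_def)
  have iv: "integrable lborel (\<lambda>x. v x powr q)" "integrable lborel (\<lambda>x. v x powr (p + 1))"
    by (intro dil(1)[where f = "\<lambda>z. z powr _"] iu)+
  note iv\<gamma> = dil(1)[of \<gamma>, OF i\<gamma>]
  have W: "W = (LINT x|lborel. \<gamma> (u x))" "0 \<le> W"
    by (auto simp: W_def \<gamma>_def)
  \<comment> \<open>Young's inequality is used with weight \<open>\<epsilon> / (t - 1)\<close>, as the mean square of \<open>v - u\<close> is of order \<open>(t - 1)\<^sup>2\<close>.\<close>
  define \<kappa> where "\<kappa> = (q - 1) * M powr (q - 2) + \<epsilon> / (t - 1)"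
  have \<kappa>: "0 \<le> \<kappa>"
    using q_gt t \<epsilon> by (simp add: \<kappa>_def)
  have mixed: "integrable lborel (\<lambda>x. u x powr r * v x)"
    if r: "0 < r" "integrable lborel (\<lambda>x. u x powr (r + 1))" for r
  proof (rule Bochner_Integration.integrable_bound)
    show "integrable lborel (\<lambda>x. u x powr (r + 1) + v x powr (r + 1))"
      using r(2) dil(1)[where f = "\<lambda>z. z powr (r + 1)"] by simp
    show "AE x in lborel. norm (u x powr r * v x) \<le> norm (u x powr (r + 1) + v x powr (r + 1))"
    proof (rule AE_I2)
      fix x
      have prod: "z powr r * z = z powr (r + 1)" if "0 \<le> z" for z :: real
        using that r(1) by (cases "z = 0") (auto simp: powr_add)
      have "u x powr r * v x \<le> u x powr (r + 1) + v x powr (r + 1)"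
      proof (cases "u x \<le> v x")
        case True
        then have "u x powr r * v x \<le> v x powr r * v x"
          using u_nonneg[of x] v0[of x] r by (intro mult_right_mono powr_mono2) auto
        then show ?thesis
          by (simp add: prod v0 add_increasing)
      next
        case False
        then have "u x powr r * v x \<le> u x powr r * u x"
          by (intro mult_left_mono) auto
        then show ?thesis
          by (simp add: prod u_nonneg add_increasing2)
      qed
      then show "norm (u x powr r * v x) \<le> norm (u x powr (r + 1) + v x powr (r + 1))"
        using v0[of x] by (simp add: abs_mult)
    qed
  qed simp
  have imix: "integrable lborel (\<lambda>x. u x powr (q - 1) * v x)" "integrable lborel (\<lambda>x. u x powr p * v x)"
    using mixed[of "q - 1"] mixed[of p] iu q_gt p by auto
  let ?lower = "\<lambda>x. (u x powr q + lam * u x powr (p + 1)) + (v x powr q - u x powr q) / q +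
      lam * (v x powr (p + 1) - u x powr (p + 1)) / (p + 1) - \<kappa> * (v x - u x)\<^sup>2 -
      (\<gamma> (u x) + \<gamma> (v x)) / (2 * (\<epsilon> / (t - 1)))"
  have "(LINT x|lborel. ?lower x) \<le> (LINT x|lborel. u x powr (q - 1) * v x + lam * (u x powr p * v x))"
  proof (rule integral_mono)
    show "integrable lborel ?lower"
      using iu iv d(1) i\<gamma> iv\<gamma> by simp
    show "integrable lborel (\<lambda>x. u x powr (q - 1) * v x + lam * (u x powr p * v x))"
      using imix by simp
    fix x
    have "(v x powr q - u x powr q) / q \<le> u x powr (q - 1) * (v x - u x) + \<kappa> * (v x - u x)\<^sup>2 +
        (\<gamma> (u x) + \<gamma> (v x)) / (2 * (\<epsilon> / (t - 1)))"
      unfolding \<kappa>_def \<gamma>_def using t \<epsilon> q_gt by (intro powr_convexity_defect u_nonneg v0) auto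
    moreover have "u x powr (q - 1) * u x = u x powr q" "u x powr p * u x = u x powr (p + 1)"
      using power_split[of "q - 1" x] power_split[of p x] q_gt p by auto
    moreover have "lam * (v x powr (p + 1) - u x powr (p + 1)) / (p + 1) \<le> lam * (u x powr p * (v x - u x))"
    proof -
      have "u x powr (p + 1) - v x powr (p + 1) \<le> (p + 1) * u x powr p * (u x - v x)"
        using powr_tangent_le[of "v x" "u x" "p + 1"] u_nonneg v0 p by simp
      then have "u x powr p * (v x - u x) \<le> (v x powr (p + 1) - u x powr (p + 1)) / (p + 1)"
        using p by (simp add: field_simps)
      from mult_left_mono_neg[OF this lam] show ?thesis
        by simp
    qed
    ultimately show "?lower x \<le> u x powr (q - 1) * v x + lam * (u x powr p * v x)"
      by (simp add: right_diff_distrib)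
  qed
  also have "(LINT x|lborel. ?lower x) = (LINT x|lborel. u x powr q + lam * u x powr (p + 1)) +
      (m - 1) * J - \<kappa> * (LINT x|lborel. (v x - u x)\<^sup>2) - (1 + m) * W / (2 * (\<epsilon> / (t - 1)))"
  proof -
    have "(LINT x|lborel. ?lower x) = (LINT x|lborel. u x powr q + lam * u x powr (p + 1)) +
        ((LINT x|lborel. v x powr q) - (LINT x|lborel. u x powr q)) / q +
        lam * ((LINT x|lborel. v x powr (p + 1)) - (LINT x|lborel. u x powr (p + 1))) / (p + 1) -
        \<kappa> * (LINT x|lborel. (v x - u x)\<^sup>2) -
        ((LINT x|lborel. \<gamma> (u x)) + (LINT x|lborel. \<gamma> (v x))) / (2 * (\<epsilon> / (t - 1)))"
      using iu iv d(1) i\<gamma> iv\<gamma> by simp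
    also have "\<dots> = (LINT x|lborel. u x powr q + lam * u x powr (p + 1)) +
      (m - 1) * J - \<kappa> * (LINT x|lborel. (v x - u x)\<^sup>2) - (1 + m) * W / (2 * (\<epsilon> / (t - 1)))"
      unfolding dil(2)[where f = "\<lambda>z. z powr q", OF iu(1)] dil(2)[where f = "\<lambda>z. z powr (p + 1)", OF iu(2)]
        dil(2)[of \<gamma>, OF i\<gamma>] W(1)[symmetric] J_def
      by (simp add: algebra_simps add_divide_distrib diff_divide_distrib)
    finally show ?thesis .
  qed
  also have "(LINT x|lborel. u x powr (q - 1) * v x + lam * (u x powr p * v x)) =
      (LINT x|lborel. (u x powr (q - 1) + lam * u x powr p) * v x)"
    by (simp add: algebra_simps)
  finally have main: "(LINT x|lborel. u x powr q + lam * u x powr (p + 1)) + (m - 1) * J -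
      \<kappa> * (LINT x|lborel. (v x - u x)\<^sup>2) - (1 + m) * W / (2 * (\<epsilon> / (t - 1)))
      \<le> (LINT x|lborel. (u x powr (q - 1) + lam * u x powr p) * v x)" .
  have "\<kappa> * (LINT x|lborel. (v x - u x)\<^sup>2) \<le> \<kappa> * (D * (t - 1)\<^sup>2)"
    by (intro mult_left_mono d \<kappa>)
  also have "\<dots> = (t - 1) * ((q - 1) * M powr (q - 2) * D * (t - 1) + \<epsilon> * D)"
    using t by (simp add: \<kappa>_def power2_eq_square field_simps)
  finally have e1: "\<kappa> * (LINT x|lborel. (v x - u x)\<^sup>2) \<le> (t - 1) * ((q - 1) * M powr (q - 2) * D * (t - 1) + \<epsilon> * D)" .
  have "(1 + m) * W / (2 * (\<epsilon> / (t - 1))) \<le> 2 * W / (2 * (\<epsilon> / (t - 1)))"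
    using m W(2) t \<epsilon> by (intro divide_right_mono mult_right_mono) auto
  also have "\<dots> = (t - 1) * (W / \<epsilon>)"
    using t \<epsilon> by simp
  finally have e2: "(1 + m) * W / (2 * (\<epsilon> / (t - 1))) \<le> (t - 1) * (W / \<epsilon>)" .
  show ?thesis
    using main e1 e2 unfolding m_def[symmetric] by (simp only: distrib_left)
qed

text \<open>
  At \<open>t = 1\<close> the bounds of \<open>dilation_test\<close> and \<open>dilation_lower_bound\<close> coincide by the energy
  identity, so the inequality between them passes to the one-sided derivatives.
\<close>

lemma Pohozaev_inequality:
  assumes star: "\<And>t x. 1 < t \<Longrightarrow> a + t *\<^sub>R (x - a) \<in> \<Omega> \<Longrightarrow> x \<in> \<Omega>"
  defines "E \<equiv> (LINT x|lborel. (norm (G x))\<^sup>2)" and "K \<equiv> (LINT z|lborel. gagliardo_kernel s u u z)"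
    and "J \<equiv> (LINT x|lborel. u x powr q) / q + lam * (LINT x|lborel. u x powr (p + 1)) / (p + 1)"
  shows "0 \<le> (2 - real DIM('a)) / 2 * E + (2 * s - real DIM('a)) / 2 * K + real DIM('a) * J"
proof -
  let ?n = "real DIM('a)"
  obtain R where R: "0 \<le> R" "\<Omega> \<subseteq> cball a R"
    using bounded_subset_ballD[OF \<Omega>(2), of a] ball_subset_cball[of a] by (meson less_imp_le subset_trans)
  define D where "D = 4 * R\<^sup>2 * E"
  have D: "0 \<le> D"
    by (simp add: D_def E_def)
  define W where "W = (\<lambda>M. LINT x|lborel. u x powr (2 * (q - 1)) * indicator {M..} (u x))"
  define \<Phi> where "\<Phi> = (\<lambda>t. t powr ((2 - ?n) / 2) * E + t powr ((2 * s - ?n) / 2) * K - (t powr (- ?n) - 1) * J)"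
  define \<Phi>' where "\<Phi>' = (2 - ?n) / 2 * E + (2 * s - ?n) / 2 * K + ?n * J"
  \<comment> \<open>\<open>\<Phi> t - \<Phi> 1\<close> is the upper bound minus the lower bound of the tested equation, up to the error.\<close>
  have deriv: "(\<Phi> has_real_derivative \<Phi>') (at 1)"
  proof -
    have *: "((\<lambda>t::real. t powr r) has_real_derivative r) (at 1)" for r
      using has_real_derivative_powr[of 1 r] by simp
    show ?thesis
      unfolding \<Phi>_def \<Phi>'_def by (rule derivative_eq_intros * refl)+ simp
  qed
  have \<Phi>1: "\<Phi> 1 = (LINT x|lborel. u x powr q + lam * u x powr (p + 1))"
    using energy_identity by (simp add: \<Phi>_def E_def K_def)
  have step: "- ((q - 1) * M powr (q - 2) * D * (t - 1) + \<epsilon> * D + W M / \<epsilon>) \<le> (\<Phi> t - \<Phi> 1) / (t - 1)"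
    if t: "1 < t" and \<epsilon>: "0 < \<epsilon>" for t \<epsilon> M
  proof -
    note test = dilation_test[OF t star[OF t] R]
    have "4 * ((t - 1) * R)\<^sup>2 * (LINT x|lborel. (norm (G x))\<^sup>2) = D * (t - 1)\<^sup>2"
      by (simp add: D_def E_def power_mult_distrib)
    with test(3) have "(LINT x|lborel. (u ((a - t *\<^sub>R a) + t *\<^sub>R x) - u x)\<^sup>2) \<le> D * (t - 1)\<^sup>2"
      by simp
    from order_trans[OF dilation_lower_bound[OF t \<epsilon> test(2) this, of M] test(1)]
    have "- ((t - 1) * ((q - 1) * M powr (q - 2) * D * (t - 1) + \<epsilon> * D + W M / \<epsilon>)) \<le> \<Phi> t - \<Phi> 1"
      unfolding \<Phi>1 by (simp add: \<Phi>_def J_def[symmetric] E_def[symmetric] K_def[symmetric] W_def)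
    then show ?thesis
      using t by (simp add: field_simps)
  qed
  have lim1: "- (\<epsilon> * D + W M / \<epsilon>) \<le> \<Phi>'" if \<epsilon>: "0 < \<epsilon>" for \<epsilon> M
  proof (rule tendsto_le)
    show "((\<lambda>t. (\<Phi> t - \<Phi> 1) / (t - 1)) \<longlongrightarrow> \<Phi>') (at_right 1)"
      using deriv unfolding has_field_derivative_iff by (rule tendsto_within_subset) simp
    have "((\<lambda>t. - ((q - 1) * M powr (q - 2) * D * (t - 1) + \<epsilon> * D + W M / \<epsilon>)) \<longlongrightarrow>
        - ((q - 1) * M powr (q - 2) * D * (1 - 1) + \<epsilon> * D + W M / \<epsilon>)) (at_right 1)"
      by (intro tendsto_intros) (use \<epsilon> in auto)
    then show "((\<lambda>t. - ((q - 1) * M powr (q - 2) * D * (t - 1) + \<epsilon> * D + W M / \<epsilon>)) \<longlongrightarrow>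
        - (\<epsilon> * D + W M / \<epsilon>)) (at_right 1)"
      by simp
    show "\<forall>\<^sub>F t in at_right 1. - ((q - 1) * M powr (q - 2) * D * (t - 1) + \<epsilon> * D + W M / \<epsilon>) \<le> (\<Phi> t - \<Phi> 1) / (t - 1)"
      using eventually_at_right_less[of "1::real"] by eventually_elim (rule step[OF _ \<epsilon>])
  qed simp
  have W0: "(\<lambda>j. W (real j)) \<longlonglongrightarrow> 0"
    unfolding W_def by (rule integral_above_level_tendsto_0[OF integrable_u_powr_2q])
  have lim2: "- (\<epsilon> * D) \<le> \<Phi>'" if \<epsilon>: "0 < \<epsilon>" for \<epsilon>
  proof (rule LIMSEQ_le_const2)
    have "(\<lambda>j. - (\<epsilon> * D + W (real j) / \<epsilon>)) \<longlonglongrightarrow> - (\<epsilon> * D + 0 / \<epsilon>)"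
      by (intro tendsto_intros W0) (use \<epsilon> in auto)
    then show "(\<lambda>j. - (\<epsilon> * D + W (real j) / \<epsilon>)) \<longlonglongrightarrow> - (\<epsilon> * D)"
      by simp
  qed (use lim1[OF \<epsilon>] in auto)
  have "0 \<le> \<Phi>'"
  proof (rule field_le_epsilon)
    fix e :: real
    assume e: "0 < e"
    have "- (e / (D + 1) * D) \<le> \<Phi>'"
      using e D by (intro lim2) auto
    moreover have "e / (D + 1) * D \<le> e"
      using e D by (simp add: field_simps)
    ultimately show "0 \<le> \<Phi>' + e"
      by linarith
  qed
  then show ?thesis
    by (simp add: \<Phi>'_def)
qed

text \<open>
  In the Pohozaev inequality the critical terms cancel against \<open>(n - 2) / 2\<close> times the energy
  identity. What remains of the energies is \<open>(1 - s) * K\<close>, because the nonlocal form scales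
  differently from the local one.
\<close>

lemma no_nontrivial_solution:
  assumes star: "\<And>t x. 1 < t \<Longrightarrow> a + t *\<^sub>R (x - a) \<in> \<Omega> \<Longrightarrow> x \<in> \<Omega>"
  shows "AE x in lborel. u x = 0"
proof -
  let ?n = "real DIM('a)"
  define E where "E = (LINT x|lborel. (norm (G x))\<^sup>2)"
  define K where "K = (LINT z|lborel. gagliardo_kernel s u u z)"
  define A where "A = (LINT x|lborel. u x powr q)"
  define B where "B = (LINT x|lborel. u x powr (p + 1))"
  have energy: "E + K = A + lam * B"
    using energy_identity integrable_u_powr[of q] integrable_u_powr[of "p + 1"] q_gt p
    by (simp add: E_def K_def A_def B_def)
  have poh: "0 \<le> (2 - ?n) / 2 * E + (2 * s - ?n) / 2 * K + ?n * (A / q + lam * B / (p + 1))"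
    using Pohozaev_inequality[OF star] by (simp add: E_def K_def A_def B_def)
  have nq: "?n * (A / q) = (?n - 2) / 2 * A"
    using dim by (simp add: q_eq)
  have "(1 - s) * K \<le> lam * B * (?n / (p + 1) - (?n - 2) / 2)"
  proof -
    have "(2 - ?n) / 2 * E + (2 * s - ?n) / 2 * K + ?n * (A / q + lam * B / (p + 1)) =
        - ((?n - 2) / 2) * (E + K) - (1 - s) * K + (?n - 2) / 2 * A + ?n * (lam * B / (p + 1))"
      unfolding distrib_left nq by (simp add: field_simps)
    also have "\<dots> = lam * B * (?n / (p + 1) - (?n - 2) / 2) - (1 - s) * K"
    proof -
      have "- h * (A + lam * B) - X + h * A + ?n * (lam * B / (p + 1)) = lam * B * (?n / (p + 1) - h) - X" for h X
        by (simp add: algebra_simps)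
      then show ?thesis
        unfolding energy .
    qed
    finally show ?thesis
      using poh by linarith
  qed
  also have "\<dots> \<le> 0"
  proof -
    have "(?n - 2) / 2 \<le> ?n / (p + 1)"
      using dim p by (simp add: q_eq field_simps)
    moreover have "lam * B \<le> 0"
      using lam by (simp add: B_def mult_nonpos_nonneg)
    ultimately show ?thesis
      by (simp add: mult_nonpos_nonneg)
  qed
  finally have "K \<le> 0"
    using s by (simp add: mult_le_0_iff)
  then show ?thesis
    using kernel_integrable \<Omega> u_outside unfolding K_def
    by (intro gagliardo_zero_imp_zero[where \<Omega> = \<Omega>]) auto
qed

end

section \<open>Nonexistence\<close>

lemma solution_Borel_representative:
  fixes \<Omega> :: "'a::euclidean_space set"
  assumes u: "is_solution s lam p \<Omega> u" and "open \<Omega>"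
  obtains u' G where "AE x in lborel. u x = u' x" "H10_pair \<Omega> u' G"
    "\<And>x. 0 \<le> u' x" "\<And>x. x \<notin> \<Omega> \<Longrightarrow> u' x = 0"
    "\<And>v H. H10_pair \<Omega> v H \<Longrightarrow>
      (LINT x|lborel. G x \<bullet> H x) + (LINT z|lborel. gagliardo_kernel s u' v z) =
      (LINT x|lborel. (u' x powr (critical_exponent DIM('a) - 1) + lam * u' x powr p) * v x)"
proof -
  have [measurable]: "\<Omega> \<in> sets borel"
    using \<open>open \<Omega>\<close> by simp
  have "u \<in> X12 \<Omega>"
    using u by (simp add: is_solution_def)
  then obtain u\<^sub>0 G where u0: "H10_pair \<Omega> u\<^sub>0 G" "AE x in lborel. u x = u\<^sub>0 x"
    using X12_imp_H10_pair[OF _ \<open>open \<Omega>\<close>] by blast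
  note [measurable] = H10_pair_measurable[OF u0(1)]
  define u' where "u' = (\<lambda>x. indicator \<Omega> x * max 0 (u\<^sub>0 x))"
  have [measurable]: "u' \<in> borel_measurable borel"
    by (simp add: u'_def)
  have nn: "AE x in lborel. x \<in> \<Omega> \<longrightarrow> 0 \<le> u x"
    using u by (simp add: is_solution_def AE_completion_iff)
  have u0u': "AE x in lborel. u\<^sub>0 x = u' x"
    using nn u0(2) H10_pair_zero_outside(1)[OF u0(1) \<open>open \<Omega>\<close>]
    by eventually_elim (auto simp: u'_def indicator_def)
  have pair: "H10_pair \<Omega> u' G"
    using u0u' by (intro H10_pair_cong_AE[OF u0(1)]) auto
  have uu': "AE x in lborel. u x = u' x"
    using u0(2) u0u' by eventually_elim simp
  have wgu: "AE x in lborel. weak_gradient UNIV u x = G x"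
    using weak_gradient_eq[OF open_UNIV H10_pair_has_weak_gradient[OF pair uu']] by simp
  have weak: "(LINT x|lborel. G x \<bullet> H x) + (LINT z|lborel. gagliardo_kernel s u' v z) =
      (LINT x|lborel. (u' x powr (critical_exponent DIM('a) - 1) + lam * u' x powr p) * v x)"
    if v: "H10_pair \<Omega> v H" for v H
  proof -
    note [measurable] = H10_pair_measurable[OF v]
    have "v \<in> X12 \<Omega>"
      using v \<open>open \<Omega>\<close> by (rule H10_pair_in_X12)
    with u have eq: "local_form \<Omega> u v + nonlocal_form s u v =
        (LINT x:\<Omega>|lebesgue. (u x powr (critical_exponent DIM('a) - 1) + lam * u x powr p) * v x)"
      by (simp add: is_solution_def)
    have wgv: "AE x in lborel. weak_gradient UNIV v x = H x"
      using weak_gradient_eq[OF open_UNIV H10_pair_has_weak_gradient[OF v]] by simp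
    have "local_form \<Omega> u v = (LINT x|lborel. G x \<bullet> H x)"
      unfolding local_form_def set_lebesgue_integral_def
    proof (rule lebesgue_integral_AE_eq_borel)
      show "AE x in lborel. indicator \<Omega> x *\<^sub>R (weak_gradient UNIV u x \<bullet> weak_gradient UNIV v x) = G x \<bullet> H x"
        using wgu wgv H10_pair_zero_outside(2)[OF pair \<open>open \<Omega>\<close>]
        by eventually_elim (auto simp: indicator_def)
    qed simp
    moreover have "nonlocal_form s u v = (LINT z|lborel. gagliardo_kernel s u' v z)"
      by (rule nonlocal_form_eq[OF uu']) auto
    moreover have "(LINT x:\<Omega>|lebesgue. (u x powr (critical_exponent DIM('a) - 1) + lam * u x powr p) * v x) =
        (LINT x|lborel. (u' x powr (critical_exponent DIM('a) - 1) + lam * u' x powr p) * v x)"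
      unfolding set_lebesgue_integral_def
    proof (rule lebesgue_integral_AE_eq_borel)
      show "AE x in lborel. indicator \<Omega> x *\<^sub>R ((u x powr (critical_exponent DIM('a) - 1) + lam * u x powr p) * v x) =
          (u' x powr (critical_exponent DIM('a) - 1) + lam * u' x powr p) * v x"
        using uu' by eventually_elim (auto simp: indicator_def u'_def)
    qed simp
    ultimately show ?thesis
      using eq by simp
  qed
  show thesis
    by (rule that[OF uu' pair _ _ weak]) (auto simp: u'_def)
qed

theorem theorem1p3:
  fixes \<Omega> :: "(real ^ 'n) set" and s lam p :: real
  assumes "CARD('n) \<ge> 3"
    and "0 < s" and "s < 1"
    and "lam \<le> 0"
    and "\<Omega> \<noteq> {}" and "open \<Omega>" and "bounded \<Omega>" and "starlike \<Omega>"
    and "1 \<le> p" and "p < critical_exponent CARD('n) - 1"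
  shows "\<not> (\<exists>u. is_solution s lam p \<Omega> u)"
proof
  assume "\<exists>u. is_solution s lam p \<Omega> u"
  then obtain u where u: "is_solution s lam p \<Omega> u"
    by blast
  obtain u' G where u': "AE x in lborel. u x = u' x" "H10_pair \<Omega> u' G"
    "\<And>x. 0 \<le> u' x" "\<And>x. x \<notin> \<Omega> \<Longrightarrow> u' x = 0"
    "\<And>v H. H10_pair \<Omega> v H \<Longrightarrow>
      (LINT x|lborel. G x \<bullet> H x) + (LINT z|lborel. gagliardo_kernel s u' v z) =
      (LINT x|lborel. (u' x powr (critical_exponent DIM(real ^ 'n) - 1) + lam * u' x powr p) * v x)"
    using solution_Borel_representative[OF u \<open>open \<Omega>\<close>] by blast
  interpret brezis_nirenberg_solution \<Omega> s lam p "critical_exponent CARD('n)" u' G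
    by unfold_locales (use assms u' in \<open>auto simp: critical_exponent_def\<close>)
  obtain a where a: "a \<in> \<Omega>" "\<And>x. x \<in> \<Omega> \<Longrightarrow> closed_segment a x \<subseteq> \<Omega>"
    using \<open>starlike \<Omega>\<close> by (auto simp: starlike_def)
  \<comment> \<open>Star-shapedness says that dilating the solution towards the centre keeps its support in \<open>\<Omega>\<close>.\<close>
  have star: "x \<in> \<Omega>" if t: "1 < t" and x: "a + t *\<^sub>R (x - a) \<in> \<Omega>" for t x
  proof -
    have "x = (1 - 1 / t) *\<^sub>R a + (1 / t) *\<^sub>R (a + t *\<^sub>R (x - a))"
      using t by (simp add: algebra_simps)
    then have "x \<in> closed_segment a (a + t *\<^sub>R (x - a))"
      using t unfolding closed_segment_def by (auto intro!: exI[of _ "1 / t"])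
    with a(2)[OF x] show ?thesis
      by blast
  qed
  have "AE x in lborel. u' x = 0"
    by (rule no_nontrivial_solution[OF star])
  with u'(1) have "AE x in lborel. \<not> (x \<in> \<Omega> \<and> 0 < u x)"
    by eventually_elim simp
  then have "AE x in lebesgue. \<not> (x \<in> \<Omega> \<and> 0 < u x)"
    by (rule AE_completion)
  then have "{x \<in> \<Omega>. 0 < u x} \<in> null_sets lebesgue"
    by (simp add: completion.AE_iff_null_sets)
  then show False
    using u by (simp add: is_solution_def null_sets_def)
qed

end
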